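(* Let $m\in\frac12\mathbb N$ and $s\in\frac12\mathbb N_{\rm odd}$. Then the following identities hold. 1) $$\begin{aligned} &\theta_{0,2m+1}\Big(\tau,\tfrac{-\frac12+2m(z_1-z_2)}{2m+1}\Big)\,\Phi^{[m,\frac12]}(2\tau,2z_1,2z_2,0)\\ &=-i\,\eta(2\tau)^3\Bigg\{\frac{\theta_{0,2m+1}\big(\tau,\frac{\frac12+z_1-z_2}{2m+1}+z_1+z_2\big)}{\vartheta_{11}(2\tau,2z_1)}+\frac{\theta_{0,2m+1}\big(\tau,\frac{\frac12+z_1-z_2}{2m+1}-z_1-z_2\big)}{\vartheta_{11}(2\tau,2z_2)}\Bigg\}\\ &\quad+\sum_{j=1}^{\infty}\sum_{r=1}^{j}\sum_{\substack{k=1\\ k\ {\rm odd}}}^{2m-1}(-1)^j q^{(2m+1)j^2-\frac1{8m}(4m(j-r)+k)^2}\big\{e^{\pi i(4mr-k)(z_1-z_2)}+e^{-\pi i(4mr-k)(z_1-z_2)}\big\}\big[\theta_{k,2m}-\theta_{-k,2m}\big](\tau,z_1+z_2)\\ &\quad-\sum_{j=1}^{\infty}\sum_{r=0}^{j-1}\sum_{\substack{k=1\\ k\ {\rm odd}}}^{2m-1}(-1)^j q^{(2m+1)j^2-\frac1{8m}(4m(j-r)-k)^2}\big\{e^{\pi i(4mr+k)(z_1-z_2)}+e^{-\pi i(4mr+k)(z_1-z_2)}\big\}\big[\theta_{k,2m}-\theta_{-k,2m}\big](\tau,z_1+z_2). \end{aligned}$$ 2) $$\begin{aligned} &\theta_{0,2m+1}\Big(\tau,\tfrac{-\frac12+2m(z_1-z_2)}{2m+1}\Big)\,\Phi^{[m,s]}(2\tau,2z_1,2z_2,0)\\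 &=-i\,\eta(2\tau)^3\Bigg\{\frac{\theta_{0,2m+1}\big(\tau,\frac{\frac12+z_1-z_2}{2m+1}+z_1+z_2\big)}{\vartheta_{11}(2\tau,2z_1)}+\frac{\theta_{0,2m+1}\big(\tau,\frac{\frac12+z_1-z_2}{2m+1}-z_1-z_2\big)}{\vartheta_{11}(2\tau,2z_2)}\Bigg\}\\ &\quad+\sum_{j=1}^{\infty}\sum_{r=1}^{j}\sum_{\substack{k=1\\ k\ {\rm odd}}}^{2m-1}(-1)^j q^{(2m+1)j^2-\frac1{8m}(4m(j-r)+k)^2}\big\{e^{\pi i(4mr-k)(z_1-z_2)}+e^{-\pi i(4mr-k)(z_1-z_2)}\big\}\big[\theta_{k,2m}-\theta_{-k,2m}\big](\tau,z_1+z_2)\\ &\quad-\sum_{j=1}^{\infty}\sum_{r=0}^{j-1}\sum_{\substack{k=1\\ k\ {\rm odd}}}^{2m-1}(-1)^j q^{(2m+1)j^2-\frac1{8m}(4m(j-r)-k)^2}\big\{e^{\pi i(4mr+k)(z_1-z_2)}+e^{-\pi i(4mr+k)(z_1-z_2)}\big\}\big[\theta_{k,2m}-\theta_{-k,2m}\big](\tau,z_1+z_2)\\ &\quad-\theta_{0,2m+1}\Big(\tau,\tfrac{-\frac12+2m(z_1-z_2)}{2m+1}\Big)\sum_{k=0}^{s-\frac32}e^{\pi i(1+2k)(z_1-z_2)}q^{-\frac{(1+2k)^2}{8m}}\big[\theta_{\frac12+k,m}-\theta_{-(\frac12+k),m}\big](2\tau,2(z_1+z_2)). \end{aligned}$$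
   Context: $\mathbb N$ is the set of positive integers and $\mathbb N_{\rm odd}$ the set of positive odd integers. $\tau$ lies in the upper half-plane, $z_1,z_2,t\in\mathbb C$, $q=e^{2\pi i\tau}$, $q^a:=e^{2\pi i a\tau}$. For $m\in\frac12\mathbb N$, $s\in\frac12\mathbb Z$: $$\Phi^{[m,s]}_1(\tau,z_1,z_2,t)=e^{-2\pi imt}\sum_{j\in\mathbb Z}\frac{e^{2\pi imj(z_1+z_2)+2\pi isz_1}q^{mj^2+sj}}{1-e^{2\pi iz_1}q^j},\qquad \Phi^{[m,s]}_2(\tau,z_1,z_2,t)=e^{-2\pi imt}\sum_{j\in\mathbb Z}\frac{e^{-2\pi imj(z_1+z_2)-2\pi isz_2}q^{mj^2+sj}}{1-e^{-2\pi iz_2}q^j},$$ $\Phi^{[m,s]}=\Phi^{[m,s]}_1-\Phi^{[m,s]}_2$. Jacobi theta function: $\theta_{k,m}(\tau,z)=\sum_{j\in\mathbb Z}e^{2\pi im(j+\frac{k}{2m})z}q^{m(j+\frac{k}{2m})^2}$. In these definitions $q=e^{2\pi i\tau}$ for the first argument $\tau$ (so a first argument $2\tau$ means replacing $q$ by $q^2$). $[\theta_{k,m}-\theta_{-k,m}](\tau,z)$ means $\theta_{k,m}(\tau,z)-\theta_{-k,m}(\tau,z)$. $\eta$ is the Dedekind eta function and $\vartheta_{ab}(\tau,z)=\sum_{n\in\mathbb Z}e^{\pi i(n+\frac a2)^2\tau+2\pi i(n+\frac a2)(z+\frac b2)}$ ($a,b\in\{0,1\}$) are Mumford's theta functions.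 Empty sums are $0$. Identities are identities of meromorphic functions of the variables. *)

theory Defs
  imports "HOL-Analysis.Analysis"
begin

text \<open>
  The power \<open>q\<^sup>a\<close> of \<open>q = exp (2\<pi>i\<tau>)\<close> for a real exponent: the branch is
  determined by \<open>\<tau>\<close>, not by the value of \<open>q\<close>.
\<close>

definition qpow :: "complex \<Rightarrow> real \<Rightarrow> complex" where
  "qpow \<tau> a = exp (2 * of_real pi * \<i> * of_real a * \<tau>)"

definition Phi1 :: "real \<Rightarrow> real \<Rightarrow> complex \<Rightarrow> complex \<Rightarrow> complex \<Rightarrow> complex \<Rightarrow> complex" where
  "Phi1 m s \<tau> z1 z2 t =
     exp (- 2 * of_real pi * \<i> * of_real m * t) *
     (\<Sum>\<^sub>\<infinity>j\<in>(UNIV :: int set).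
        exp (2 * of_real pi * \<i> * of_real m * of_int j * (z1 + z2)
             + 2 * of_real pi * \<i> * of_real s * z1)
          * qpow \<tau> (m * (of_int j)\<^sup>2 + s * of_int j)
        / (1 - exp (2 * of_real pi * \<i> * z1) * qpow \<tau> (of_int j)))"

definition Phi2 :: "real \<Rightarrow> real \<Rightarrow> complex \<Rightarrow> complex \<Rightarrow> complex \<Rightarrow> complex \<Rightarrow> complex" where
  "Phi2 m s \<tau> z1 z2 t =
     exp (- 2 * of_real pi * \<i> * of_real m * t) *
     (\<Sum>\<^sub>\<infinity>j\<in>(UNIV :: int set).
        exp (- 2 * of_real pi * \<i> * of_real m * of_int j * (z1 + z2)
             - 2 * of_real pi * \<i> * of_real s * z2)
          * qpow \<tau> (m * (of_int j)\<^sup>2 + s * of_int j)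
        / (1 - exp (- 2 * of_real pi * \<i> * z2) * qpow \<tau> (of_int j)))"

definition Phi :: "real \<Rightarrow> real \<Rightarrow> complex \<Rightarrow> complex \<Rightarrow> complex \<Rightarrow> complex \<Rightarrow> complex" where
  "Phi m s \<tau> z1 z2 t = Phi1 m s \<tau> z1 z2 t - Phi2 m s \<tau> z1 z2 t"

definition jacobi_theta :: "real \<Rightarrow> real \<Rightarrow> complex \<Rightarrow> complex \<Rightarrow> complex" where
  "jacobi_theta k m \<tau> z =
     (\<Sum>\<^sub>\<infinity>j\<in>(UNIV :: int set).
        exp (2 * of_real pi * \<i> * of_real (m * (of_int j + k / (2 * m))) * z)
          * qpow \<tau> (m * (of_int j + k / (2 * m))\<^sup>2))"

definition mumford_theta :: "nat \<Rightarrow> nat \<Rightarrow> complex \<Rightarrow> complex \<Rightarrow> complex" where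
  "mumford_theta a b \<tau> z =
     (\<Sum>\<^sub>\<infinity>n\<in>(UNIV :: int set).
        exp (of_real pi * \<i> * (of_int n + of_nat a / 2)\<^sup>2 * \<tau>
             + 2 * of_real pi * \<i> * (of_int n + of_nat a / 2) * (z + of_nat b / 2)))"

definition dedekind_eta :: "complex \<Rightarrow> complex" where
  "dedekind_eta \<tau> = qpow \<tau> (1 / 24) * prodinf (\<lambda>n. 1 - qpow \<tau> (real (Suc n)))"

end

theory Submission
  imports Defs
begin

text \<open>
  Write \<open>q = exp (2\<pi>i\<tau>)\<close>, \<open>a = exp (2\<pi>iz\<^sub>1)\<close>, \<open>b = exp (2\<pi>iz\<^sub>2)\<close>, \<open>M = 2m\<close> and
  \<open>f(x) = x / (1 - x\<^sup>2)\<close>. Then \<open>\<Phi>\<close> with \<open>s = 1/2\<close> is \<open>P(a, b) - P(1/b, 1/a)\<close>, where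
  \<open>P(a, b)\<close> is the sum over \<open>j\<close> of \<open>(ab)\<^sup>M\<^sup>j q\<^sup>M\<^sup>j\<^sup>j f(a q\<^sup>j)\<close>. The proof compares poles and then identifies
  the entire remainder, all by rearranging absolutely convergent sums.

  The quotient \<open>- i \<eta>(2\<tau>)\<^sup>3 / \<theta>\<^sub>1\<^sub>1(2\<tau>, 2z\<^sub>1)\<close> has the partial fraction expansion
  \<open>\<Sum> (-1)\<^sup>l q\<^sup>l\<^sup>l f(a q\<^sup>l)\<close>. It is obtained as a limit (\<open>theta_times_lerch\<close>): the finite product of the factors
  \<open>1 - y q\<^sup>2\<^sup>k\<close> over \<open>\<bar>k\<bar> \<le> n\<close> is expanded by the \<open>q\<close>-binomial theorem, its reciprocal by partial
  fractions, and the product of the two expansions is \<open>1\<close>.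

  Consequently the product of the left theta function with \<open>P(a, b)\<close> and the first theta quotient on
  the right are double sums over the same functions \<open>f(a q\<^sup>j)\<close>. After a change of indices the two coefficients
  of \<open>f(x)\<close>, \<open>x = a q\<^sup>j\<close>, differ by a factor \<open>x\<^sup>2\<^sup>N\<close> with an integer \<open>N\<close>, and \<open>(x\<^sup>2\<^sup>N - 1) f(x)\<close> is a
  finite geometric sum. The poles cancel, and what is left is a sum of signed monomials over the
  triples \<open>(J, p, v)\<close> with \<open>v\<close> between \<open>p\<close> and \<open>MJ\<close> (\<open>theta_times_appell\<close>).

  Subtracting the same expression with \<open>(1/b, 1/a)\<close> in place of \<open>(a, b)\<close> makes the summand, for fixed
  \<open>v\<close>, a product of a function of \<open>J\<close> and a function of \<open>p\<close>. The first one sums to zero over all \<open>J\<close>,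
  because \<open>J \<mapsto> - J - (2v + 1)\<close> changes its sign. This completes the half sums over \<open>p\<close> to
  full ones, which are the antisymmetrised theta functions (\<open>infsum_between_sign_product\<close>). Pairing
  \<open>v\<close> with \<open>- 1 - v\<close> leaves a sum over the odd numbers \<open>w = 2v + 1\<close> with \<open>0 < w < 2MJ\<close>
  (\<open>cone_sum_folded\<close>). The antisymmetrised theta function is odd and \<open>2M\<close>-periodic in \<open>w\<close>, hence zero for
  \<open>w \<equiv> M\<close>, so writing \<open>w = 2Mr \<mp> k\<close> with \<open>0 < k < M\<close> gives the two triple sums of the first identity.

  The second identity follows from the first one, since raising \<open>s\<close> by one changes each summand of
  \<open>P(a, b)\<close> by a single monomial, and these add up to a theta function (\<open>Phi_shift\<close>).
\<close>

section \<open>Absolutely convergent sums over the integers\<close>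

lemma summable_on_exp_neg_abs_int: "(\<lambda>n::int. exp (- real_of_int \<bar>n\<bar>)) summable_on UNIV"
proof -
  have "summable (\<lambda>n::nat. norm (exp (-1::real) ^ n))"
    by (simp add: norm_power summable_geometric)
  then have *: "(\<lambda>n::nat. exp (-1::real) ^ n) summable_on UNIV"
    by (rule norm_summable_imp_summable_on)
  have "(\<lambda>n::int. exp (- real_of_int \<bar>n\<bar>)) summable_on range int"
    using * by (subst summable_on_reindex) (auto simp: o_def exp_of_nat_mult[symmetric])
  moreover have "(\<lambda>n::int. exp (- real_of_int \<bar>n\<bar>)) summable_on range (\<lambda>n. - int n)"
    using * by (subst summable_on_reindex) (auto simp: o_def exp_of_nat_mult[symmetric] inj_on_def)
  ultimately have "(\<lambda>n::int. exp (- real_of_int \<bar>n\<bar>)) summable_on (range int \<union> range (\<lambda>n. - int n))"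
    by (rule summable_on_union)
  moreover have "range int \<union> range (\<lambda>n. - int n) = UNIV"
  proof -
    have "n \<in> range int \<union> range (\<lambda>n. - int n)" for n
      by (cases n rule: int_cases2) auto
    then show ?thesis by auto
  qed
  ultimately show ?thesis by simp
qed

text \<open>
  Completing the square bounds the Gaussian by a constant multiple of \<open>exp (- \<bar>n\<bar>)\<close>. This is the
  majorant behind every convergence statement below.
\<close>

lemma summable_on_gaussian_int:
  fixes c d :: real
  assumes "d > 0"
  shows "(\<lambda>n::int. exp (c * \<bar>of_int n\<bar> - d * (of_int n)\<^sup>2)) summable_on UNIV"
proof (rule summable_on_comparison_test)
  show "(\<lambda>n::int. exp ((c + 1)\<^sup>2 / (4 * d)) * exp (- real_of_int \<bar>n\<bar>)) summable_on UNIV"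
    by (intro summable_on_cmult_right summable_on_exp_neg_abs_int)
next
  fix n :: int
  define x where "x = \<bar>real_of_int n\<bar>"
  have "0 \<le> d * (x - (c + 1) / (2 * d))\<^sup>2" using assms by simp
  also have "\<dots> = d * x\<^sup>2 - (c + 1) * x + (c + 1)\<^sup>2 / (4 * d)"
    using assms by (simp add: field_simps power2_eq_square)
  finally have "c * x - d * x\<^sup>2 \<le> (c + 1)\<^sup>2 / (4 * d) - x"
    by (simp add: algebra_simps)
  then show "exp (c * \<bar>of_int n\<bar> - d * (of_int n)\<^sup>2)
      \<le> exp ((c + 1)\<^sup>2 / (4 * d)) * exp (- real_of_int \<bar>n\<bar>)"
    by (simp add: x_def exp_add[symmetric])
qed simp

lemma summable_on_exp_quadratic_int:
  fixes B L :: complex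
  assumes "Re L < 0"
  shows "(\<lambda>n::int. exp (of_int n * B + (of_int n)\<^sup>2 * L)) summable_on UNIV"
proof -
  have "(\<lambda>n::int. norm (exp (of_int n * B + (of_int n)\<^sup>2 * L))) summable_on UNIV"
  proof (rule Infinite_Sum.abs_summable_on_comparison_test')
    show "(\<lambda>n::int. exp (\<bar>Re B\<bar> * \<bar>of_int n\<bar> - (- Re L) * (of_int n)\<^sup>2)) summable_on UNIV"
      using assms by (intro summable_on_gaussian_int) simp
  next
    fix n :: int
    have "of_int n * Re B \<le> \<bar>Re B\<bar> * \<bar>of_int n\<bar>"
      by (metis abs_ge_self abs_mult mult.commute)
    moreover have "Re ((of_int n)\<^sup>2 * L) = (of_int n)\<^sup>2 * Re L"
      by (metis Re_complex_of_real Re_divide_of_nat of_real_of_int_eq of_real_power scaleR_complex.sel(1) scaleR_conv_of_real)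
    ultimately show "norm (exp (of_int n * B + (of_int n)\<^sup>2 * L))
      \<le> exp (\<bar>Re B\<bar> * \<bar>of_int n\<bar> - (- Re L) * (of_int n)\<^sup>2)"
      by simp
  qed
  then show ?thesis by (rule abs_summable_summable)
qed

lemma summable_on_powi_exp_quadratic_int:
  fixes B L :: complex
  assumes "Re L < 0"
  shows "(\<lambda>n::int. (-1) powi n * exp (of_int n * B + (of_int n)\<^sup>2 * L)) summable_on UNIV"
proof -
  have "(\<lambda>n::int. norm ((-1) powi n * exp (of_int n * B + (of_int n)\<^sup>2 * L))) summable_on UNIV"
    using summable_on_exp_quadratic_int[OF assms, of B]
    by (subst (asm) summable_on_iff_abs_summable_on_complex) (simp add: norm_mult norm_power_int)
  then show ?thesis by (rule abs_summable_summable)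
qed

lemma
  fixes f :: "'a \<Rightarrow> complex" and g :: "'b \<Rightarrow> complex"
  assumes f: "f summable_on A" and g: "g summable_on B"
  shows summable_on_times_complex: "(\<lambda>(x, y). f x * g y) summable_on A \<times> B"
    and infsum_times_complex: "infsum f A * infsum g B = (\<Sum>\<^sub>\<infinity>(x, y)\<in>A \<times> B. f x * g y)"
proof -
  have f': "(\<lambda>x. norm (f x)) summable_on A" and g': "(\<lambda>x. norm (g x)) summable_on B"
    using f g by (simp_all add: summable_on_iff_abs_summable_on_complex)
  have "(\<lambda>z. norm (case z of (x, y) \<Rightarrow> f x * g y)) summable_on A \<times> B"
    unfolding Infinite_Sum.abs_summable_on_Sigma_iff
    using f' g' by (auto simp: norm_mult infsum_cmult_right' infsum_nonneg
                         intro: summable_on_cmult_right summable_on_cmult_left)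
  then show *: "(\<lambda>(x, y). f x * g y) summable_on A \<times> B"
    by (rule abs_summable_summable)
  show "infsum f A * infsum g B = (\<Sum>\<^sub>\<infinity>(x, y)\<in>A \<times> B. f x * g y)"
    using infsum_Sigma'_banach[OF *] by (simp add: infsum_cmult_right' infsum_cmult_left')
qed

lemma summable_on_times_real:
  fixes f :: "'a \<Rightarrow> real" and g :: "'b \<Rightarrow> real"
  assumes f: "f summable_on A" and g: "g summable_on B"
  shows "(\<lambda>(x, y). f x * g y) summable_on A \<times> B"
proof -
  have f': "(\<lambda>x. norm (f x)) summable_on A" and g': "(\<lambda>x. norm (g x)) summable_on B"
    using f g summable_on_iff_abs_summable_on_real by blast+
  have "(\<lambda>z. norm (case z of (x, y) \<Rightarrow> f x * g y)) summable_on A \<times> B"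
    unfolding Infinite_Sum.abs_summable_on_Sigma_iff
    using f' g' by (auto simp: norm_mult abs_mult infsum_cmult_right' infsum_nonneg
                         intro: summable_on_cmult_right summable_on_cmult_left)
  then show ?thesis
    by (rule abs_summable_summable)
qed

text \<open>
  Tannery's theorem, carried over from series to sums over the integers by an enumeration.
\<close>

lemma tendsto_infsum_dominated_int:
  fixes f :: "nat \<Rightarrow> int \<Rightarrow> complex"
  assumes lim: "\<And>k. (\<lambda>n. f n k) \<longlonglongrightarrow> g k"
    and bound: "\<And>n k. norm (f n k) \<le> h k" and h: "h summable_on UNIV"
  shows "(\<lambda>n. \<Sum>\<^sub>\<infinity>k. f n k) \<longlonglongrightarrow> (\<Sum>\<^sub>\<infinity>k. g k)"
proof -
  define e :: "nat \<Rightarrow> int" where "e = int_decode"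
  have e: "bij_betw e UNIV UNIV"
    unfolding e_def using bij_int_decode by simp
  have bound_g: "norm (g k) \<le> h k" for k
    by (rule Lim_bounded[OF tendsto_norm[OF lim]]) (use bound in auto)
  have h': "(\<lambda>i. h (e i)) summable_on UNIV"
    using h summable_on_reindex_bij_betw[OF e, of h] by simp
  have sm: "summable (\<lambda>i. h (e i))"
    by (rule summable_on_imp_summable[OF h'])
  have eq: "(\<Sum>\<^sub>\<infinity>k. F k) = (\<Sum>i. F (e i))" if "\<And>k. norm (F k) \<le> h k" for F :: "int \<Rightarrow> complex"
  proof -
    have "(\<lambda>i. norm (F (e i))) summable_on UNIV"
      by (rule Infinite_Sum.abs_summable_on_comparison_test'[OF h']) (use that in auto)
    then have "(\<lambda>i. F (e i)) summable_on UNIV" by (rule abs_summable_summable)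
    then have "((\<lambda>i. F (e i)) has_sum (\<Sum>\<^sub>\<infinity>i. F (e i))) UNIV"
      by simp
    then have "(\<lambda>i. F (e i)) sums (\<Sum>\<^sub>\<infinity>i. F (e i))" by (rule has_sum_imp_sums)
    then show ?thesis
      using infsum_reindex_bij_betw[OF e, of F] by (simp add: sums_iff)
  qed
  have "(\<lambda>n. \<Sum>i. f n (e i)) \<longlonglongrightarrow> (\<Sum>i. g (e i))"
    using tannerys_theorem[where a = "\<lambda>i n. f n (e i)" and b = "\<lambda>i. g (e i)" and M = "\<lambda>i. h (e i)" and F = sequentially]
      lim bound sm by (simp add: eventually_True case_prod_unfold)
  then show ?thesis
    using eq[of g] eq[of "f _"] bound bound_g by simp
qed

section \<open>Finite q-series identities\<close>

text \<open>
  The \<open>q\<close>-Pochhammer symbol \<open>(Q; Q)\<^sub>n\<close>.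
\<close>

definition qpoch :: "'a::field \<Rightarrow> nat \<Rightarrow> 'a" where
  "qpoch Q n = (\<Prod>k<n. 1 - Q ^ Suc k)"

text \<open>
  The Gaussian binomial coefficient. Extending it by zero to \<open>j > N\<close> makes Pascal's rules hold
  at the boundary.
\<close>

definition qbinom :: "'a::field \<Rightarrow> nat \<Rightarrow> nat \<Rightarrow> 'a" where
  "qbinom Q N j = (if j \<le> N then qpoch Q N / (qpoch Q j * qpoch Q (N - j)) else 0)"

lemma qpoch_0 [simp]: "qpoch Q 0 = 1"
  by (simp add: qpoch_def)

lemma qpoch_Suc: "qpoch Q (Suc n) = qpoch Q n * (1 - Q ^ Suc n)"
  by (simp add: qpoch_def)

context
  fixes Q :: "'a::field"
  assumes Q_not_root: "\<And>k. Q ^ Suc k \<noteq> 1"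
begin

lemma qpoch_nonzero: "qpoch Q n \<noteq> 0"
  using Q_not_root by (auto simp: qpoch_def simp del: power_Suc)

lemma qbinom_0 [simp]: "qbinom Q N 0 = 1"
  using qpoch_nonzero by (simp add: qbinom_def)

lemma qbinom_eq_0: "N < j \<Longrightarrow> qbinom Q N j = 0"
  by (simp add: qbinom_def)

lemma
  assumes "j \<le> N"
  shows qbinom_pascal: "qbinom Q (Suc N) (Suc j) = qbinom Q N (Suc j) + Q ^ (N - j) * qbinom Q N j"
    and qbinom_pascal': "qbinom Q (Suc N) (Suc j) = Q ^ Suc j * qbinom Q N (Suc j) + qbinom Q N j"
proof -
  have "qbinom Q (Suc N) (Suc j) = qbinom Q N (Suc j) + Q ^ (N - j) * qbinom Q N j \<and>
        qbinom Q (Suc N) (Suc j) = Q ^ Suc j * qbinom Q N (Suc j) + qbinom Q N j"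
  proof (cases "j = N")
    case True
    then show ?thesis using qpoch_nonzero by (simp add: qbinom_def)
  next
    case False
    then obtain d where N: "N = Suc (j + d)"
      using assms by (metis le_neq_implies_less less_iff_Suc_add)
    have nz: "1 - Q ^ Suc j \<noteq> 0" "1 - Q ^ Suc d \<noteq> 0"
      using Q_not_root by (simp_all del: power_Suc)
    have 1: "qbinom Q N (Suc j) = qpoch Q N / (qpoch Q j * (1 - Q ^ Suc j) * qpoch Q d)"
      and 2: "qbinom Q N j = qpoch Q N / (qpoch Q j * (qpoch Q d * (1 - Q ^ Suc d)))"
      and 3: "qbinom Q (Suc N) (Suc j) = qpoch Q N * (1 - Q ^ Suc j * Q ^ Suc d) /
         (qpoch Q j * (1 - Q ^ Suc j) * (qpoch Q d * (1 - Q ^ Suc d)))"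
      using N by (simp_all add: qbinom_def qpoch_Suc Suc_diff_le power_add del: power_Suc)
         (simp add: power_add mult_ac)
    have Nj: "N - j = Suc d" using N by simp
    show ?thesis
      unfolding 1 2 3 Nj using nz qpoch_nonzero[of j] qpoch_nonzero[of d]
      by (simp add: divide_simps del: power_Suc) (simp add: algebra_simps)
  qed
  then show "qbinom Q (Suc N) (Suc j) = qbinom Q N (Suc j) + Q ^ (N - j) * qbinom Q N j"
    and "qbinom Q (Suc N) (Suc j) = Q ^ Suc j * qbinom Q N (Suc j) + qbinom Q N j"
    by blast+
qed

lemma sum_qbinom_Suc:
  "(\<Sum>j\<le>N. F (Suc j) * qbinom Q N (Suc j)) = (\<Sum>j\<le>N. F j * qbinom Q N j) - F 0"
proof -
  have "(\<Sum>j\<le>Suc N. F j * qbinom Q N j) = F 0 + (\<Sum>j\<le>N. F (Suc j) * qbinom Q N (Suc j))"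
    by (subst sum.atMost_Suc_shift) simp
  moreover have "(\<Sum>j\<le>Suc N. F j * qbinom Q N j) = (\<Sum>j\<le>N. F j * qbinom Q N j)"
    by (simp add: qbinom_eq_0)
  ultimately show ?thesis by (simp add: algebra_simps)
qed

lemma choose_2_Suc: "Suc j choose 2 = j + (j choose 2)"
  by (simp add: numeral_2_eq_2)

lemma q_binomial_theorem:
  "(\<Prod>k<N. 1 - y * Q ^ k) = (\<Sum>j\<le>N. (-1) ^ j * Q ^ (j choose 2) * y ^ j * qbinom Q N j)"
proof (induction N)
  case (Suc N)
  define F where "F j = (-1) ^ j * Q ^ (j choose 2) * y ^ j" for j
  have "(\<Sum>j\<le>Suc N. F j * qbinom Q (Suc N) j)
      = 1 + (\<Sum>j\<le>N. F (Suc j) * qbinom Q (Suc N) (Suc j))"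
    by (subst sum.atMost_Suc_shift) (simp add: F_def numeral_2_eq_2)
  also have "(\<Sum>j\<le>N. F (Suc j) * qbinom Q (Suc N) (Suc j))
      = (\<Sum>j\<le>N. F (Suc j) * qbinom Q N (Suc j) - y * Q ^ N * (F j * qbinom Q N j))"
  proof (rule sum.cong)
    fix j assume "j \<in> {..N}"
    then have j: "j \<le> N" by simp
    have "Q ^ N = Q ^ j * Q ^ (N - j)"
      using j by (simp flip: power_add)
    then have *: "F (Suc j) * Q ^ (N - j) = - y * Q ^ N * F j"
      by (simp add: F_def choose_2_Suc power_add)
    then show "F (Suc j) * qbinom Q (Suc N) (Suc j)
        = F (Suc j) * qbinom Q N (Suc j) - y * Q ^ N * (F j * qbinom Q N j)"
      unfolding qbinom_pascal[OF j] distrib_left mult.assoc[symmetric] * by simp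
  qed simp
  also have "\<dots> = (\<Sum>j\<le>N. F j * qbinom Q N j) - F 0 - y * Q ^ N * (\<Sum>j\<le>N. F j * qbinom Q N j)"
    by (simp only: sum_subtractf sum_qbinom_Suc sum_distrib_left)
  also have "1 + \<dots> = (\<Sum>j\<le>N. F j * qbinom Q N j) * (1 - y * Q ^ N)"
    by (simp add: F_def numeral_2_eq_2 algebra_simps)
  finally show ?case
    using Suc.IH by (simp add: F_def)
qed (simp add: numeral_2_eq_2)

text \<open>
  The partial fraction expansion in \<open>y\<close>, whose coefficients are Gaussian binomials up to sign and a power
  of \<open>Q\<close>. Each of Pascal's rules expresses the sum for \<open>N + 1\<close> by the sums for \<open>N\<close> at \<open>y\<close> and at \<open>yQ\<close>;
  one of them keeps \<open>s\<close>, the other raises it by one, and together they reach every \<open>s \<le> N\<close>.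
  The case \<open>N = 2n\<close>, \<open>s = n\<close> is needed: there the coefficients at a fixed distance from the middle
  index converge as \<open>n\<close> grows, up to a common factor.
\<close>

lemma q_partial_fractions:
  assumes "Q \<noteq> 0" and "s \<le> N" and "\<And>k. y * Q ^ k \<noteq> 1"
  shows "(\<Sum>k\<le>N. (-1) ^ k * Q ^ (Suc k choose 2) / Q ^ (k * s) / (1 - y * Q ^ k) * qbinom Q N k)
       = qpoch Q N * y ^ s / (\<Prod>k\<le>N. 1 - y * Q ^ k)"
  using assms(2,3)
proof (induction N arbitrary: s y)
  case 0
  then show ?case by (simp add: numeral_2_eq_2)
next
  case (Suc N)
  define F where "F s y k = (-1) ^ k * Q ^ (Suc k choose 2) / Q ^ (k * s) / (1 - y * Q ^ k)" for s y k
  have yQ: "\<And>k. (y * Q) * Q ^ k \<noteq> 1"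
    using Suc.prems(2)[of "Suc _"] by (simp add: mult_ac)
  have shift: "F s y (Suc k) = - (Q ^ Suc k / Q ^ s) * F s (y * Q) k" for s y k
    by (simp add: F_def choose_2_Suc[of "Suc k"] power_add mult_ac)
  define p where "p = (\<Prod>k\<le>N. 1 - y * Q ^ Suc k)"
  have p: "p \<noteq> 0" using Suc.prems(2) by (simp add: p_def del: power_Suc)
  have y1: "1 - y \<noteq> 0" using Suc.prems(2)[of 0] by simp
  have yN: "1 - y * Q ^ Suc N \<noteq> 0" using Suc.prems(2)[of "Suc N"] by (simp del: power_Suc)
  have prod_Suc: "(\<Prod>k\<le>Suc N. 1 - y * Q ^ k) = (1 - y) * p"
    unfolding p_def by (subst prod.atMost_Suc_shift) simp
  then have prod_N: "(\<Prod>k\<le>N. 1 - y * Q ^ k) = (1 - y) * p / (1 - y * Q ^ Suc N)"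
    using yN by (simp add: field_simps)
  have prod_yQ: "(\<Prod>k\<le>N. 1 - (y * Q) * Q ^ k) = p"
    by (simp add: p_def mult_ac)
  have step: "(\<Sum>k\<le>Suc N. F s y k * qbinom Q (Suc N) k)
      = F s y 0 + (\<Sum>k\<le>N. F s y (Suc k) * qbinom Q (Suc N) (Suc k))" for s
    by (subst sum.atMost_Suc_shift) simp
  have "(\<Sum>k\<le>Suc N. F s y k * qbinom Q (Suc N) k)
       = qpoch Q (Suc N) * y ^ s / (\<Prod>k\<le>Suc N. 1 - y * Q ^ k)"
  proof (cases "s \<le> N")
    case True
    have "(\<Sum>k\<le>N. F s y (Suc k) * qbinom Q (Suc N) (Suc k))
        = (\<Sum>k\<le>N. F s y (Suc k) * qbinom Q N (Suc k) - Q ^ Suc N / Q ^ s * (F s (y * Q) k * qbinom Q N k))"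
    proof (rule sum.cong)
      fix k assume "k \<in> {..N}"
      then have k: "k \<le> N" by simp
      have "Q ^ Suc N = Q ^ Suc k * Q ^ (N - k)"
        using k by (simp flip: power_add)
      then show "F s y (Suc k) * qbinom Q (Suc N) (Suc k)
        = F s y (Suc k) * qbinom Q N (Suc k) - Q ^ Suc N / Q ^ s * (F s (y * Q) k * qbinom Q N k)"
        unfolding qbinom_pascal[OF k] shift by (auto simp: ring_distribs)
    qed simp
    also have "\<dots> = (\<Sum>k\<le>N. F s y k * qbinom Q N k) - F s y 0
        - Q ^ Suc N / Q ^ s * (\<Sum>k\<le>N. F s (y * Q) k * qbinom Q N k)"
      by (simp only: sum_subtractf sum_qbinom_Suc sum_distrib_left)
    also have "(\<Sum>k\<le>N. F s y k * qbinom Q N k) = qpoch Q N * y ^ s * (1 - y * Q ^ Suc N) / ((1 - y) * p)"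
      using Suc.IH[OF True Suc.prems(2)] unfolding prod_N F_def by simp
    also have "(\<Sum>k\<le>N. F s (y * Q) k * qbinom Q N k) = qpoch Q N * (y * Q) ^ s / p"
      using Suc.IH[OF True yQ] unfolding prod_yQ F_def by simp
    also have "qpoch Q N * y ^ s * (1 - y * Q ^ Suc N) / ((1 - y) * p) - F s y 0
          - Q ^ Suc N / Q ^ s * (qpoch Q N * (y * Q) ^ s / p)
        = qpoch Q N * y ^ s / ((1 - y) * p) * ((1 - y * Q ^ Suc N) - Q ^ Suc N * (1 - y)) - F s y 0"
      using y1 p assms(1) by (simp add: divide_simps power_mult_distrib del: power_Suc) 
         (simp add: algebra_simps)
    also have "(1 - y * Q ^ Suc N) - Q ^ Suc N * (1 - y) = 1 - Q ^ Suc N"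
      by (simp add: algebra_simps)
    finally show ?thesis
      unfolding step prod_Suc by (simp add: qpoch_Suc del: power_Suc)
  next
    case False
    with Suc.prems obtain t where s: "s = Suc t" and t: "t \<le> N"
      by (metis Suc_le_mono le_SucE order_refl)
    have "(\<Sum>k\<le>N. F s y (Suc k) * qbinom Q (Suc N) (Suc k))
        = (\<Sum>k\<le>N. F t y (Suc k) * qbinom Q N (Suc k) - 1 / Q ^ t * (F t (y * Q) k * qbinom Q N k))"
    proof (rule sum.cong)
      fix k assume "k \<in> {..N}"
      then have k: "k \<le> N" by simp
      have "F s y (Suc k) * Q ^ Suc k = F t y (Suc k)"
        using assms(1) by (simp add: F_def s power_add)
      moreover have "F s y (Suc k) = - 1 / Q ^ t * F t (y * Q) k"
        unfolding shift using assms(1) by (simp add: s F_def power_add)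
      ultimately show "F s y (Suc k) * qbinom Q (Suc N) (Suc k)
        = F t y (Suc k) * qbinom Q N (Suc k) - 1 / Q ^ t * (F t (y * Q) k * qbinom Q N k)"
        unfolding qbinom_pascal'[OF k] by (metis (no_types, lifting) diff_conv_add_uminus
          distrib_left divide_minus_left mult.assoc mult_minus_left)
    qed simp
    also have "\<dots> = (\<Sum>k\<le>N. F t y k * qbinom Q N k) - F t y 0
        - 1 / Q ^ t * (\<Sum>k\<le>N. F t (y * Q) k * qbinom Q N k)"
      by (simp only: sum_subtractf sum_qbinom_Suc sum_distrib_left)
    also have "(\<Sum>k\<le>N. F t y k * qbinom Q N k) = qpoch Q N * y ^ t * (1 - y * Q ^ Suc N) / ((1 - y) * p)"
      using Suc.IH[OF t Suc.prems(2)] unfolding prod_N F_def by simp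
    also have "(\<Sum>k\<le>N. F t (y * Q) k * qbinom Q N k) = qpoch Q N * (y * Q) ^ t / p"
      using Suc.IH[OF t yQ] unfolding prod_yQ F_def by simp
    also have "F t y 0 = F s y 0" by (simp add: F_def)
    also have "qpoch Q N * y ^ t * (1 - y * Q ^ Suc N) / ((1 - y) * p) - F s y 0
          - 1 / Q ^ t * (qpoch Q N * (y * Q) ^ t / p)
        = qpoch Q N * y ^ t / ((1 - y) * p) * ((1 - y * Q ^ Suc N) - (1 - y)) - F s y 0"
      using y1 p assms(1) by (simp add: divide_simps power_mult_distrib del: power_Suc) 
         (simp add: algebra_simps)
    also have "(1 - y * Q ^ Suc N) - (1 - y) = y * (1 - Q ^ Suc N)"
      by (simp add: algebra_simps)
    finally show ?thesis
      unfolding step prod_Suc by (simp add: s qpoch_Suc mult_ac)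
  qed
  then show ?case by (simp add: F_def)
qed

end

lemma two_choose_two: "2 * (j choose 2) = j * (j - 1)"
proof -
  have "even (j * (j - 1))" by (cases j) auto
  then show ?thesis by (simp add: choose_two)
qed

lemma power_square_choose_2:
  fixes q :: "'a::field"
  shows "(q\<^sup>2) ^ (j choose 2) = q powi (int j * int j - int j)"
proof -
  have "(q\<^sup>2) ^ (j choose 2) = q ^ (j * (j - 1))"
    by (simp flip: power_mult add: two_choose_two)
  also have "\<dots> = q powi (int (j * (j - 1)))" by (simp only: power_int_of_nat)
  also have "int (j * (j - 1)) = int j * int j - int j"
    by (cases j) (auto simp: algebra_simps)
  finally show ?thesis .
qed

text \<open>
  The product of \<open>1 - y q\<^sup>2\<^sup>k\<close> over \<open>\<bar>k\<bar> \<le> n\<close> is expanded in two ways: the product itself by the \<open>q\<close>-binomial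
  theorem, its reciprocal by partial fractions. Centring both summation ranges produces powers
  of \<open>y\<close> and \<open>q\<close> that cancel. With base \<open>q\<^sup>2\<close> all exponents are integers.
\<close>

lemma finite_theta_times_finite_lerch:
  fixes q y :: "'a::field"
  assumes q: "q \<noteq> 0" and y: "y \<noteq> 0"
    and root: "\<And>k. (q\<^sup>2) ^ Suc k \<noteq> 1"
    and pole: "\<And>k::int. y * q powi (2 * k) \<noteq> 1"
  defines "P \<equiv> qpoch (q\<^sup>2)"
  shows "(\<Sum>i\<in>{- int n..int n + 1}. (-1) powi i * q powi (i * i - i) * y powi i
             * (P (2 * n + 1) / (P (nat (int n + i)) * P (nat (int n + 1 - i)))))
       * (\<Sum>l\<in>{- int n..int n}. (-1) powi l * q powi (l * l + l) / (1 - y * q powi (2 * l))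
             / (P (nat (int n + l)) * P (nat (int n - l)))) = 1"
    (is "?S * ?T = 1")
proof -
  note P = qpoch_nonzero[OF root, folded P_def]
  \<comment> \<open>The factors \<open>1 - z q\<^sup>2\<^sup>k\<close> with \<open>k \<le> 2n\<close> are the \<open>1 - y q\<^sup>2\<^sup>k\<close> with \<open>\<bar>k\<bar> \<le> n\<close>.\<close>
  define z where "z = y / (q\<^sup>2) ^ n"
  have q2: "(q\<^sup>2) ^ k = q powi (2 * int k)" for k
    by (simp add: power_int_mult)
  have z: "z = y * q powi (- 2 * int n)"
    using power_int_minus[of q "2 * int n"] by (simp add: z_def q2 divide_inverse del: power_int_mult_distrib_numeral1)
  have zQ: "z * (q\<^sup>2) ^ k = y * q powi (2 * (int k - int n))" for k
  proof -
    have "z * (q\<^sup>2) ^ k = y * (q powi (- 2 * int n) * q powi (2 * int k))"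
      unfolding z q2 by (simp only: mult.assoc)
    also have "\<dots> = y * q powi (2 * (int k - int n))"
      using q by (simp flip: power_int_add add: algebra_simps)
    finally show ?thesis .
  qed
  have zpole: "z * (q\<^sup>2) ^ k \<noteq> 1" for k
    unfolding zQ by (rule pole)
  have S: "(\<Prod>k\<le>2 * n. 1 - z * (q\<^sup>2) ^ k) = (-1) ^ n * y ^ n * q powi (- (int n * int n + int n)) * ?S"
  proof -
    have "(\<Prod>k\<le>2 * n. 1 - z * (q\<^sup>2) ^ k)
        = (\<Sum>j\<le>2 * n + 1. (-1) ^ j * (q\<^sup>2) ^ (j choose 2) * z ^ j * qbinom (q\<^sup>2) (2 * n + 1) j)"
      using q_binomial_theorem[OF root, where N = "2 * n + 1" and y = z]
      by (simp add: lessThan_Suc_atMost)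
    also have "\<dots> = (\<Sum>i\<in>{- int n..int n + 1}. (-1) ^ n * y ^ n * q powi (- (int n * int n + int n)) *
         ((-1) powi i * q powi (i * i - i) * y powi i
             * (P (2 * n + 1) / (P (nat (int n + i)) * P (nat (int n + 1 - i))))))"
    proof (rule sum.reindex_bij_witness[of _ "\<lambda>i. nat (i + int n)" "\<lambda>j. int j - int n"])
      fix j assume "j \<in> {..2 * n + 1}"
      then have j: "j \<le> 2 * n + 1" by simp
      have e: "nat (int n + (int j - int n)) = j" "nat (int n + 1 - (int j - int n)) = 2 * n + 1 - j"
        using j by auto
      have sgn: "(-1::'a) ^ n * (-1) powi (int j - int n) = (-1) ^ j"
        by (simp add: power_int_diff)
      have yy: "y ^ n * y powi (int j - int n) = y ^ j"
        using y by (simp add: power_int_diff)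
      have "z ^ j = y ^ j * q powi (- 2 * int n * int j)"
        unfolding z by (simp only: power_mult_distrib power_int_power')
      then have "(q\<^sup>2) ^ (j choose 2) * z ^ j = y ^ j * (q powi (int j * int j - int j) * q powi (- 2 * int n * int j))"
        by (simp only: power_square_choose_2 mult_ac)
      also have "q powi (int j * int j - int j) * q powi (- 2 * int n * int j)
          = q powi (- (int n * int n + int n)) * q powi ((int j - int n) * (int j - int n) - (int j - int n))"
        using q by (simp flip: power_int_add add: algebra_simps)
      finally have qq: "(q\<^sup>2) ^ (j choose 2) * z ^ j = (y ^ n * y powi (int j - int n)) * (q powi (- (int n * int n + int n)) * q powi ((int j - int n) * (int j - int n) - (int j - int n)))"
        by (simp only: yy)
      have b: "qbinom (q\<^sup>2) (2 * n + 1) j = P (2 * n + 1) / (P j * P (2 * n + 1 - j))"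
        using j by (simp add: qbinom_def P_def)
      show "(-1) ^ n * y ^ n * q powi (- (int n * int n + int n)) *
         ((-1) powi (int j - int n) * q powi ((int j - int n) * (int j - int n) - (int j - int n)) * y powi (int j - int n)
             * (P (2 * n + 1) / (P (nat (int n + (int j - int n))) * P (nat (int n + 1 - (int j - int n))))))
         = (-1) ^ j * (q\<^sup>2) ^ (j choose 2) * z ^ j * qbinom (q\<^sup>2) (2 * n + 1) j"
        unfolding e b mult.assoc[of "(-1) ^ j" "(q\<^sup>2) ^ (j choose 2)" "z ^ j"] qq
        unfolding sgn[symmetric] by (simp only: mult_ac)
    qed auto
    finally show ?thesis by (simp only: sum_distrib_left)
  qed
  have T: "qpoch (q\<^sup>2) (2 * n) * z ^ n / (\<Prod>k\<le>2 * n. 1 - z * (q\<^sup>2) ^ k)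
      = P (2 * n) * ((-1) ^ n * q powi (int n - int n * int n) * ?T)"
  proof -
    have "qpoch (q\<^sup>2) (2 * n) * z ^ n / (\<Prod>k\<le>2 * n. 1 - z * (q\<^sup>2) ^ k)
        = (\<Sum>k\<le>2 * n. (-1) ^ k * (q\<^sup>2) ^ (Suc k choose 2) / (q\<^sup>2) ^ (k * n) / (1 - z * (q\<^sup>2) ^ k) * qbinom (q\<^sup>2) (2 * n) k)"
      by (subst q_partial_fractions[OF root]) (use q zpole in auto)
    also have "\<dots> = (\<Sum>l\<in>{- int n..int n}. P (2 * n) * ((-1) ^ n * q powi (int n - int n * int n) *
        ((-1) powi l * q powi (l * l + l) / (1 - y * q powi (2 * l))
             / (P (nat (int n + l)) * P (nat (int n - l))))))"
    proof (rule sum.reindex_bij_witness[of _ "\<lambda>i. nat (i + int n)" "\<lambda>j. int j - int n"])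
      fix j assume "j \<in> {..2 * n}"
      then have j: "j \<le> 2 * n" by simp
      have e: "nat (int n + (int j - int n)) = j" "nat (int n - (int j - int n)) = 2 * n - j"
        using j by auto
      have sgn: "(-1::'a) ^ n * (-1) powi (int j - int n) = (-1) ^ j"
        by (simp add: power_int_diff)
      have "(q\<^sup>2) ^ (j * n) = q powi (2 * int n * int j)"
        unfolding q2 by (simp add: mult_ac)
      then have "(q\<^sup>2) ^ (Suc j choose 2) / (q\<^sup>2) ^ (j * n)
         = q powi (int (Suc j) * int (Suc j) - int (Suc j) - 2 * int n * int j)"
        using q by (simp only: power_square_choose_2) (simp add: power_int_diff)
      also have "int (Suc j) * int (Suc j) - int (Suc j) - 2 * int n * int j
         = (int n - int n * int n) + ((int j - int n) * (int j - int n) + (int j - int n))"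
        by (simp add: algebra_simps)
      also have "q powi \<dots> = q powi (int n - int n * int n) * q powi ((int j - int n) * (int j - int n) + (int j - int n))"
        by (rule power_int_add) (simp add: q)
      finally have qq: "(q\<^sup>2) ^ (Suc j choose 2) / (q\<^sup>2) ^ (j * n)
         = q powi (int n - int n * int n) * q powi ((int j - int n) * (int j - int n) + (int j - int n))" .
      have b: "qbinom (q\<^sup>2) (2 * n) j = P (2 * n) / (P j * P (2 * n - j))"
        using j by (simp add: qbinom_def P_def)
      have "(-1) ^ j * (q\<^sup>2) ^ (Suc j choose 2) / (q\<^sup>2) ^ (j * n) = 
         (-1) ^ n * (-1) powi (int j - int n) * (q powi (int n - int n * int n) * q powi ((int j - int n) * (int j - int n) + (int j - int n)))"
        unfolding sgn qq[symmetric] by simp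
      then show "P (2 * n) * ((-1) ^ n * q powi (int n - int n * int n) *
          ((-1) powi (int j - int n) * q powi ((int j - int n) * (int j - int n) + (int j - int n))
             / (1 - y * q powi (2 * (int j - int n)))
             / (P (nat (int n + (int j - int n))) * P (nat (int n - (int j - int n))))))
         = (-1) ^ j * (q\<^sup>2) ^ (Suc j choose 2) / (q\<^sup>2) ^ (j * n) / (1 - z * (q\<^sup>2) ^ j) * qbinom (q\<^sup>2) (2 * n) j"
        unfolding e b zQ[symmetric] by (simp add: mult_ac)
    qed auto
    finally show ?thesis by (simp only: sum_distrib_left)
  qed
  have zn: "z ^ n = y ^ n * (q powi (- (int n * int n + int n)) * q powi (int n - int n * int n))"
  proof -
    have "z ^ n = y ^ n * q powi (- 2 * int n * int n)"
      unfolding z by (simp only: power_mult_distrib power_int_power')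
    also have "- 2 * int n * int n = - (int n * int n + int n) + (int n - int n * int n)"
      by simp
    also have "q powi \<dots> = q powi (- (int n * int n + int n)) * q powi (int n - int n * int n)"
      by (rule power_int_add) (simp add: q)
    finally show ?thesis .
  qed
  have nz: "(\<Prod>k\<le>2 * n. 1 - z * (q\<^sup>2) ^ k) \<noteq> 0"
    using zpole by (simp flip: power_mult)
  have "P (2 * n) * z ^ n = (\<Prod>k\<le>2 * n. 1 - z * (q\<^sup>2) ^ k)
      * (qpoch (q\<^sup>2) (2 * n) * z ^ n / (\<Prod>k\<le>2 * n. 1 - z * (q\<^sup>2) ^ k))"
    using nz by (simp add: P_def)
  also have "\<dots> = (\<Prod>k\<le>2 * n. 1 - z * (q\<^sup>2) ^ k) * (P (2 * n) * ((-1) ^ n * q powi (int n - int n * int n) * ?T))"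
    by (simp only: T)
  also have "\<dots> = P (2 * n) * z ^ n * (?S * ?T)"
    unfolding S zn by (simp add: mult_ac)
  finally show ?thesis
    using P[of "2 * n"] q y by (simp add: z_def)
qed

section \<open>The reciprocal of the theta function\<close>

text \<open>
  This is \<open>- 1 / (2 sinh u)\<close>, an odd function with simple poles at the multiples of \<open>\<pi>i\<close>.
\<close>

definition lerch_summand :: "complex \<Rightarrow> complex" where
  "lerch_summand u = exp u / (1 - exp (2 * u))"

lemma qpoch_tendsto:
  fixes Q :: complex
  assumes "norm Q < 1"
  shows "qpoch Q \<longlonglongrightarrow> prodinf (\<lambda>n. 1 - Q ^ Suc n)" and "prodinf (\<lambda>n. 1 - Q ^ Suc n) \<noteq> 0"
proof -
  have ne: "1 - Q ^ Suc n \<noteq> 0" for n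
  proof
    assume "1 - Q ^ Suc n = 0"
    then have "norm (Q ^ Suc n) = 1" by (simp del: power_Suc)
    then show False using assms power_strict_mono[of "norm Q" 1 "Suc n"]
      by (simp add: norm_power del: power_Suc)
  qed
  have "summable (\<lambda>n. norm Q ^ Suc n)"
    using summable_geometric[of "norm Q"] assms by (subst summable_Suc_iff) simp
  then have "summable (\<lambda>n. norm (- (Q ^ Suc n)))"
    by (simp only: norm_minus_cancel norm_power)
  then have "convergent_prod (\<lambda>n. 1 + - (Q ^ Suc n))"
    by (rule summable_imp_convergent_prod_complex) (use ne in \<open>simp del: power_Suc\<close>)
  then have conv: "convergent_prod (\<lambda>n. 1 - Q ^ Suc n)" by simp
  then have lim: "(\<lambda>n. \<Prod>k\<le>n. 1 - Q ^ Suc k) \<longlonglongrightarrow> prodinf (\<lambda>n. 1 - Q ^ Suc n)"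
    by (rule convergent_prod_LIMSEQ)
  then show "qpoch Q \<longlonglongrightarrow> prodinf (\<lambda>n. 1 - Q ^ Suc n)"
    unfolding qpoch_def by (simp only: LIMSEQ_lessThan_iff_atMost)
  show "prodinf (\<lambda>n. 1 - Q ^ Suc n) \<noteq> 0"
    using conv lim convergent_prod_iff_nz_lim[of "\<lambda>n. 1 - Q ^ Suc n"] ne LIMSEQ_unique by metis
qed

text \<open>
  At distance at least \<open>1\<close> from the imaginary axis the function is bounded by \<open>1\<close>, and only finitely
  many of the points \<open>A + jL\<close> are closer.
\<close>

lemma lerch_summand_bounded:
  fixes A L :: complex
  assumes "Re L < 0"
  shows "\<exists>K. \<forall>j::int. norm (lerch_summand (A + of_int j * L)) \<le> K"
proof -
  define u where "u j = A + of_int j * L" for j :: int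
  have far: "norm (lerch_summand (u j)) \<le> 1" if "\<bar>Re (u j)\<bar> \<ge> 1" for j
  proof -
    define r where "r = exp (Re (u j))"
    have r0: "r > 0" by (simp add: r_def)
    \<comment> \<open>The modulus \<open>r\<close> of \<open>exp u\<close> avoids \<open>(1/2, 2)\<close>, and off this interval \<open>\<bar>1 - r\<^sup>2\<bar> \<ge> r\<close>.\<close>
    have e: "exp (1::real) \<ge> 2" using exp_ge_add_one_self[of 1] by simp
    have r: "r \<ge> 2 \<or> r \<le> 1 / 2"
    proof (cases "Re (u j) \<ge> 1")
      case True
      then have "r \<ge> exp 1" by (simp add: r_def)
      with e show ?thesis by linarith
    next
      case False
      with that have "r \<le> exp (-1)" by (simp add: r_def)
      also have "exp (-1::real) = 1 / exp 1" by (simp add: exp_minus field_simps)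
      also have "\<dots> \<le> 1 / 2" using e by (simp add: field_simps)
      finally show ?thesis by blast
    qed
    have "norm (exp (2 * u j)) = r\<^sup>2"
      by (simp add: r_def power2_eq_square flip: exp_add)
    then have "norm (1 - exp (2 * u j)) \<ge> \<bar>1 - r\<^sup>2\<bar>"
      by (metis norm_one norm_triangle_ineq3)
    moreover have "\<bar>1 - r\<^sup>2\<bar> \<ge> r"
      using r
    proof
      assume "r \<ge> 2"
      then have "r\<^sup>2 \<ge> 2 * r" by (simp add: power2_eq_square)
      with \<open>r \<ge> 2\<close> show ?thesis by linarith
    next
      assume *: "r \<le> 1 / 2"
      then have "r\<^sup>2 \<le> 1 / 2 * r" unfolding power2_eq_square using r0 by (intro mult_right_mono) auto
      with * show ?thesis by linarith
    qed
    ultimately have "norm (1 - exp (2 * u j)) \<ge> r" by linarith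
    then show ?thesis using r0
      by (simp add: lerch_summand_def norm_divide r_def divide_simps)
  qed
  have "finite {j::int. \<bar>Re (u j)\<bar> < 1}"
  proof (rule finite_subset)
    define N where "N = \<lceil>(1 + \<bar>Re A\<bar>) / (- Re L)\<rceil>"
    show "{j::int. \<bar>Re (u j)\<bar> < 1} \<subseteq> {- N..N}"
    proof
      fix j assume "j \<in> {j::int. \<bar>Re (u j)\<bar> < 1}"
      then have "\<bar>Re A + real_of_int j * Re L\<bar> < 1" by (simp add: u_def)
      then have "\<bar>real_of_int j * Re L\<bar> \<le> 1 + \<bar>Re A\<bar>" by linarith
      then have "\<bar>real_of_int j\<bar> * (- Re L) \<le> 1 + \<bar>Re A\<bar>"
        using assms by (simp add: abs_mult)
      then have "\<bar>real_of_int j\<bar> \<le> (1 + \<bar>Re A\<bar>) / (- Re L)"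
        using assms by (subst pos_le_divide_eq) auto
      then have "\<bar>real_of_int j\<bar> \<le> N" unfolding N_def by linarith
      then show "j \<in> {- N..N}" by auto
    qed
  qed simp
  then have fin: "finite ((\<lambda>j. norm (lerch_summand (u j))) ` {j::int. \<bar>Re (u j)\<bar> < 1})" by simp
  have "norm (lerch_summand (u j)) \<le> Max (insert 1 ((\<lambda>j. norm (lerch_summand (u j))) ` {j::int. \<bar>Re (u j)\<bar> < 1}))" for j
  proof (cases "\<bar>Re (u j)\<bar> < 1")
    case True
    then show ?thesis using fin by (intro Max_ge) auto
  next
    case False
    then have "norm (lerch_summand (u j)) \<le> 1" using far by simp
    also have "1 \<le> Max (insert 1 ((\<lambda>j. norm (lerch_summand (u j))) ` {j::int. \<bar>Re (u j)\<bar> < 1}))"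
      using fin by (intro Max_ge) auto
    finally show ?thesis .
  qed
  then show ?thesis unfolding u_def by blast
qed

lemma summable_on_gaussian_lerch:
  fixes A B L L' :: complex
  assumes "Re L < 0" "Re L' < 0"
  shows "(\<lambda>j::int. exp (of_int j * B + (of_int j)\<^sup>2 * L') * lerch_summand (A + of_int j * L)) summable_on UNIV"
proof -
  obtain K where K: "\<And>j::int. norm (lerch_summand (A + of_int j * L)) \<le> K"
    using lerch_summand_bounded[OF assms(1)] by blast
  have "(\<lambda>j::int. norm (exp (of_int j * B + (of_int j)\<^sup>2 * L') * lerch_summand (A + of_int j * L))) summable_on UNIV"
  proof (rule Infinite_Sum.abs_summable_on_comparison_test')
    show "(\<lambda>j::int. norm (exp (of_int j * B + (of_int j)\<^sup>2 * L')) * K) summable_on UNIV"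
      using summable_on_exp_quadratic_int[OF assms(2)]
      by (intro summable_on_cmult_left) (simp only: summable_on_iff_abs_summable_on_complex)
  qed (auto simp only: norm_mult intro!: mult_left_mono K norm_ge_zero)
  then show ?thesis by (rule abs_summable_summable)
qed

lemma summable_on_powi_gaussian_lerch:
  fixes A L :: complex
  assumes "Re L < 0"
  shows "(\<lambda>l::int. (-1) powi l * exp ((of_int l)\<^sup>2 * L) * lerch_summand (A + of_int l * L)) summable_on UNIV"
  using summable_on_gaussian_lerch[OF assms assms, of 0 A]
  by (simp add: summable_on_iff_abs_summable_on_complex norm_mult norm_power_int)

text \<open>
  The limit \<open>n \<longlonglongrightarrow> \<infinity>\<close> of the finite identity. The quotients of \<open>q\<close>-Pochhammer symbols converge and
  are bounded, so Gaussian majorants justify passing to the limit inside both sums. The first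
  sum is \<open>\<theta>\<^sub>1\<^sub>1\<close> and the right-hand side is \<open>\<eta>\<^sup>3\<close>, both up to exponential factors.
\<close>

lemma theta_times_lerch:
  fixes u L :: complex
  assumes L: "Re L < 0" and pole: "\<And>j::int. exp (2 * (u + of_int j * L)) \<noteq> 1"
  shows "(\<Sum>\<^sub>\<infinity>i\<in>(UNIV::int set). (-1) powi i * exp (of_int i * (2 * u - L) + (of_int i)\<^sup>2 * L))
       * (\<Sum>\<^sub>\<infinity>l\<in>(UNIV::int set). (-1) powi l * exp ((of_int l)\<^sup>2 * L) * lerch_summand (u + of_int l * L))
       = exp u * prodinf (\<lambda>n. 1 - exp (2 * L) ^ Suc n) ^ 3"
proof -
  define q where "q = exp L"
  define y where "y = exp (2 * u)"
  define P where "P = qpoch (q\<^sup>2)"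
  define P0 where "P0 = prodinf (\<lambda>n. 1 - (q\<^sup>2) ^ Suc n)"
  have q2: "q\<^sup>2 = exp (2 * L)" by (simp add: q_def exp_double)
  have nq: "norm (q\<^sup>2) < 1" using L by (simp add: q2)
  have root: "(q\<^sup>2) ^ Suc k \<noteq> 1" for k
  proof
    assume "(q\<^sup>2) ^ Suc k = 1"
    then have "norm (q\<^sup>2) ^ Suc k = 1" by (metis norm_one norm_power)
    then show False using nq power_strict_mono[of "norm (q\<^sup>2)" 1 "Suc k"] by (simp del: power_Suc)
  qed
  have Plim: "P \<longlonglongrightarrow> P0" and P0: "P0 \<noteq> 0"
    using qpoch_tendsto[OF nq] by (simp_all add: P_def P0_def)
  have Pnz: "P n \<noteq> 0" for n using qpoch_nonzero[OF root] by (simp add: P_def)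
  have qpow: "q powi k = exp (of_int k * L)" for k by (simp add: q_def exp_power_int)
  have ypow: "y powi k = exp (of_int k * (2 * u))" for k by (simp add: y_def exp_power_int)
  have ypole: "y * q powi (2 * k) \<noteq> 1" for k
    using pole[of k] by (simp add: y_def qpow algebra_simps flip: exp_add)
  obtain K1 where K1: "\<And>n. norm (P n) \<le> K1"
    using Plim convergent_imp_Bseq[of P] by (auto simp: convergent_def Bseq_def)
  obtain K2 where K2: "\<And>n. norm (inverse (P n)) \<le> K2"
    using tendsto_inverse[OF Plim P0] convergent_imp_Bseq[of "\<lambda>n. inverse (P n)"]
    by (auto simp: convergent_def Bseq_def)
  have K: "K1 \<ge> 0" "K2 \<ge> 0"
    using K1[of 0] K2[of 0] norm_ge_zero order_trans by blast+
  have Pshift: "(\<lambda>n. P (nat (int n + c))) \<longlonglongrightarrow> P0" for c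
  proof -
    have "filterlim (\<lambda>n. nat (int n + c)) at_top sequentially"
      by (rule filterlim_at_top_mono[OF filterlim_minus_const_nat_at_top[of "nat \<bar>c\<bar>"]])
         (auto intro!: eventuallyI)
    then show ?thesis by (rule filterlim_compose[OF Plim])
  qed
  have Pshift': "(\<lambda>n. P (2 * n + 1)) \<longlonglongrightarrow> P0"
    by (rule filterlim_compose[OF Plim], rule filterlim_subseq) (auto simp: strict_mono_def)
  define a where "a i = (-1) powi i * exp (of_int i * (2 * u - L) + (of_int i)\<^sup>2 * L)" for i :: int
  define b where "b l = (-1) powi l * exp ((of_int l)\<^sup>2 * L) * lerch_summand (u + of_int l * L)" for l :: int
  have sa: "(\<lambda>i. norm (a i)) summable_on UNIV"
    unfolding a_def using summable_on_powi_exp_quadratic_int[OF L]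
    by (simp only: summable_on_iff_abs_summable_on_complex)
  have sb: "(\<lambda>i. norm (b i)) summable_on UNIV"
    unfolding b_def using summable_on_powi_gaussian_lerch[OF L]
    by (simp only: summable_on_iff_abs_summable_on_complex)
  have aq: "(-1) powi i * q powi (i * i - i) * y powi i = a i" for i
    by (simp add: a_def qpow ypow algebra_simps power2_eq_square flip: exp_add)
  have bq: "(-1) powi l * q powi (l * l + l) / (1 - y * q powi (2 * l)) = b l * exp (- u)" for l
    by (simp add: b_def lerch_summand_def qpow y_def algebra_simps power2_eq_square flip: exp_add exp_diff)
  \<comment> \<open>Extending the finite sums by zero makes both sides sums over all integers.\<close>
  define f where "f n i = (if i \<in> {- int n..int n + 1}
      then a i * (P (2 * n + 1) * inverse (P (nat (int n + i))) * inverse (P (nat (int n + 1 - i)))) else 0)" for n i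
  define g where "g n i = (if i \<in> {- int n..int n}
      then b i * exp (- u) * (inverse (P (nat (int n + i))) * inverse (P (nat (int n - i)))) else 0)" for n i
  have ev: "eventually (\<lambda>n. i \<in> {- int n..int n}) sequentially" for i
    using eventually_ge_at_top[of "nat \<bar>i\<bar>"] by eventually_elim auto
  have f_lim: "(\<lambda>n. f n i) \<longlonglongrightarrow> a i * (P0 * inverse P0 * inverse P0)" for i
  proof (rule Lim_transform_eventually)
    show "(\<lambda>n. a i * (P (2 * n + 1) * inverse (P (nat (int n + i))) * inverse (P (nat (int n + (1 - i))))))
       \<longlonglongrightarrow> a i * (P0 * inverse P0 * inverse P0)"
      by (intro tendsto_intros Pshift Pshift' P0)
    show "\<forall>\<^sub>F n in sequentially. a i * (P (2 * n + 1) * inverse (P (nat (int n + i))) * inverse (P (nat (int n + (1 - i))))) = f n i"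
      using ev[of i] by eventually_elim (auto simp: f_def algebra_simps)
  qed
  have g_lim: "(\<lambda>n. g n i) \<longlonglongrightarrow> b i * exp (- u) * (inverse P0 * inverse P0)" for i
  proof (rule Lim_transform_eventually)
    show "(\<lambda>n. b i * exp (- u) * (inverse (P (nat (int n + i))) * inverse (P (nat (int n + (- i))))))
       \<longlonglongrightarrow> b i * exp (- u) * (inverse P0 * inverse P0)"
      by (intro tendsto_intros Pshift P0)
    show "\<forall>\<^sub>F n in sequentially. b i * exp (- u) * (inverse (P (nat (int n + i))) * inverse (P (nat (int n + (- i))))) = g n i"
      using ev[of i] by eventually_elim (auto simp: g_def algebra_simps)
  qed
  have f_bound: "norm (f n i) \<le> norm (a i) * (K1 * K2 * K2)" for n i
  proof -
    have "norm (P (2 * n + 1) * inverse (P (nat (int n + i))) * inverse (P (nat (int n + 1 - i)))) \<le> K1 * K2 * K2"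
      unfolding norm_mult using K by (intro mult_mono K1 K2) auto
    then show ?thesis using K by (auto simp: f_def norm_mult intro!: mult_left_mono)
  qed
  have g_bound: "norm (g n i) \<le> norm (b i) * (norm (exp (- u)) * (K2 * K2))" for n i
  proof -
    have "norm (inverse (P (nat (int n + i))) * inverse (P (nat (int n - i)))) \<le> K2 * K2"
      unfolding norm_mult using K by (intro mult_mono K2) auto
    then have "norm (exp (- u)) * norm (inverse (P (nat (int n + i))) * inverse (P (nat (int n - i)))) \<le> norm (exp (- u)) * (K2 * K2)"
      by (intro mult_left_mono) auto
    then have "norm (b i) * (norm (exp (- u)) * norm (inverse (P (nat (int n + i))) * inverse (P (nat (int n - i)))))
       \<le> norm (b i) * (norm (exp (- u)) * (K2 * K2))"
      by (intro mult_left_mono) auto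
    then show ?thesis using K by (auto simp: g_def norm_mult mult.assoc)
  qed
  have lim: "(\<lambda>n. (\<Sum>\<^sub>\<infinity>i. f n i) * (\<Sum>\<^sub>\<infinity>i. g n i))
      \<longlonglongrightarrow> (\<Sum>\<^sub>\<infinity>i. a i * (P0 * inverse P0 * inverse P0)) * (\<Sum>\<^sub>\<infinity>i. b i * exp (- u) * (inverse P0 * inverse P0))"
    by (intro tendsto_mult tendsto_infsum_dominated_int[OF f_lim f_bound]
         tendsto_infsum_dominated_int[OF g_lim g_bound] summable_on_cmult_left sa sb)
  have one: "(\<Sum>\<^sub>\<infinity>i. f n i) * (\<Sum>\<^sub>\<infinity>i. g n i) = 1" for n
  proof -
    have "(\<Sum>\<^sub>\<infinity>i. f n i) = (\<Sum>\<^sub>\<infinity>i\<in>{- int n..int n + 1}. f n i)"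
      by (rule infsum_cong_neutral) (auto simp: f_def)
    also have "\<dots> = (\<Sum>i\<in>{- int n..int n + 1}. (-1) powi i * q powi (i * i - i) * y powi i
             * (P (2 * n + 1) / (P (nat (int n + i)) * P (nat (int n + 1 - i)))))"
      unfolding aq by (simp add: f_def divide_inverse mult_ac)
    finally have f: "(\<Sum>\<^sub>\<infinity>i. f n i) = \<dots>" .
    have "(\<Sum>\<^sub>\<infinity>i. g n i) = (\<Sum>\<^sub>\<infinity>i\<in>{- int n..int n}. g n i)"
      by (rule infsum_cong_neutral) (auto simp: g_def)
    also have "\<dots> = (\<Sum>l\<in>{- int n..int n}. (-1) powi l * q powi (l * l + l) / (1 - y * q powi (2 * l))
             / (P (nat (int n + l)) * P (nat (int n - l))))"
      unfolding bq by (simp add: g_def divide_inverse mult_ac)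
    finally have g: "(\<Sum>\<^sub>\<infinity>i. g n i) = \<dots>" .
    show ?thesis
      unfolding f g P_def
    proof (rule finite_theta_times_finite_lerch)
      show "q \<noteq> 0" "y \<noteq> 0" by (simp_all add: q_def y_def)
      show "(q\<^sup>2) ^ Suc k \<noteq> 1" for k by (rule root)
      show "y * q powi (2 * k) \<noteq> 1" for k by (rule ypole)
    qed
  qed
  have "(\<Sum>\<^sub>\<infinity>i. a i * (P0 * inverse P0 * inverse P0)) * (\<Sum>\<^sub>\<infinity>i. b i * exp (- u) * (inverse P0 * inverse P0)) = 1"
    by (rule LIMSEQ_unique[OF lim]) (simp only: one tendsto_const)
  then have "(\<Sum>\<^sub>\<infinity>i. a i) * (\<Sum>\<^sub>\<infinity>i. b i) / (P0 ^ 3 * exp u) = 1"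
    unfolding infsum_cmult_left' using P0 by (simp add: exp_minus field_simps power3_eq_cube)
  then show ?thesis
    using P0 by (simp add: a_def b_def P0_def q2 field_simps)
qed

section \<open>Cancelling the poles\<close>

text \<open>
  The coefficient of \<open>x\<^sup>v\<close> in the Laurent polynomial \<open>(x\<^sup>K - x\<^sup>p) / (1 - x)\<close>.
\<close>

definition between_sign :: "int \<Rightarrow> int \<Rightarrow> int \<Rightarrow> complex" where
  "between_sign p v K = (if p \<le> v \<and> v < K then - 1 else if K \<le> v \<and> v < p then 1 else 0)"

text \<open>
  The monomials of the difference between the two sides. The quadratic form \<open>J\<^sup>2 + Mp\<^sup>2 + 2(J + p)v\<close>
  is indefinite, but it is positive on the double cone where \<open>v\<close> lies between \<open>p\<close> and \<open>MJ\<close>.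
\<close>

definition cone_term :: "int \<Rightarrow> complex \<Rightarrow> complex \<Rightarrow> complex \<Rightarrow> int \<Rightarrow> int \<Rightarrow> int \<Rightarrow> complex" where
  "cone_term M L A B J p v = (-1) powi J *
     exp (of_int (M * p + 2 * v + 1) * A + of_int (M * p) * B
          + of_int (J\<^sup>2 + M * p\<^sup>2 + (J + p) * (2 * v + 1)) * L)"

lemma geometric_step:
  assumes "exp (2 * u) \<noteq> 1"
  shows "(exp (w + 2 * u) - exp w) * lerch_summand u = - exp (w + u)"
proof -
  have "exp (w + 2 * u) - exp w = exp w * (exp (2 * u) - 1)"
    by (simp add: exp_add algebra_simps)
  then have "(exp (w + 2 * u) - exp w) * lerch_summand u = exp w * (exp (2 * u) - 1) * exp u / (1 - exp (2 * u))"
    by (simp add: lerch_summand_def)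
  also have "exp w * (exp (2 * u) - 1) * exp u = - exp (w + u) * (1 - exp (2 * u))"
    by (simp add: exp_add algebra_simps)
  finally show ?thesis using assms by simp
qed

lemma geometric_up:
  assumes "exp (2 * u) \<noteq> 1"
  shows "(exp (2 * of_nat n * u) - 1) * lerch_summand u
       = - (\<Sum>v\<in>{p..<p + int n}. exp (of_int (2 * (v - p) + 1) * u))"
proof (induction n)
  case (Suc n)
  have "{p..<p + int (Suc n)} = insert (p + int n) {p..<p + int n}" by auto
  then have 1: "(\<Sum>v\<in>{p..<p + int (Suc n)}. exp (of_int (2 * (v - p) + 1) * u))
      = exp (2 * of_nat n * u + u) + (\<Sum>v\<in>{p..<p + int n}. exp (of_int (2 * (v - p) + 1) * u))"
    by (simp add: algebra_simps)
  have 2: "(exp (2 * of_nat (Suc n) * u) - exp (2 * of_nat n * u)) * lerch_summand u = - exp (2 * of_nat n * u + u)"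
    using geometric_step[OF assms, of "2 * of_nat n * u"] by (simp add: algebra_simps)
  have "(exp (2 * of_nat (Suc n) * u) - 1) * lerch_summand u
      = (exp (2 * of_nat (Suc n) * u) - exp (2 * of_nat n * u)) * lerch_summand u
        + (exp (2 * of_nat n * u) - 1) * lerch_summand u"
    by (simp only: left_diff_distrib) simp
  then show ?case unfolding 1 2 Suc.IH by simp
qed simp

lemma geometric_down:
  assumes "exp (2 * u) \<noteq> 1"
  shows "(exp (- 2 * of_nat n * u) - 1) * lerch_summand u
       = (\<Sum>v\<in>{p - int n..<p}. exp (of_int (2 * (v - p) + 1) * u))"
proof (induction n)
  case (Suc n)
  define w where "w = - 2 * of_nat (Suc n) * u"
  have "{p - int (Suc n)..<p} = insert (p - int n - 1) {p - int n..<p}" by auto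
  then have 1: "(\<Sum>v\<in>{p - int (Suc n)..<p}. exp (of_int (2 * (v - p) + 1) * u))
      = exp (w + u) + (\<Sum>v\<in>{p - int n..<p}. exp (of_int (2 * (v - p) + 1) * u))"
    by (simp add: w_def algebra_simps)
  have "w + 2 * u = - 2 * of_nat n * u" by (simp add: w_def algebra_simps)
  then have "(exp w - 1) * lerch_summand u
      = - ((exp (w + 2 * u) - exp w) * lerch_summand u) + (exp (- 2 * of_nat n * u) - 1) * lerch_summand u"
    by (simp only: left_diff_distrib) simp
  then show ?case unfolding 1 geometric_step[OF assms] Suc.IH unfolding w_def by simp
qed simp

lemma geometric_between:
  assumes "exp (2 * u) \<noteq> 1"
  shows "((\<lambda>v. between_sign p v K * exp (of_int (2 * (v - p) + 1) * u))
          has_sum (exp (2 * of_int (K - p) * u) - 1) * lerch_summand u) UNIV"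
proof (cases "p \<le> K")
  case True
  show ?thesis
  proof (rule has_sum_finite_neutralI)
    have "(exp (2 * of_int (K - p) * u) - 1) * lerch_summand u
        = - (\<Sum>v\<in>{p..<K}. exp (of_int (2 * (v - p) + 1) * u))"
      using geometric_up[OF assms, of "nat (K - p)" p] True by simp
    also have "\<dots> = (\<Sum>v\<in>{p..<K}. between_sign p v K * exp (of_int (2 * (v - p) + 1) * u))"
      by (simp add: between_sign_def sum_negf[symmetric])
    finally show "(exp (2 * of_int (K - p) * u) - 1) * lerch_summand u = \<dots>" .
  qed (use True in \<open>auto simp: between_sign_def\<close>)
next
  case False
  show ?thesis
  proof (rule has_sum_finite_neutralI)
    have "(exp (2 * of_int (K - p) * u) - 1) * lerch_summand u
        = (\<Sum>v\<in>{K..<p}. exp (of_int (2 * (v - p) + 1) * u))"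
      using geometric_down[OF assms, of "nat (p - K)" p] False by (simp add: algebra_simps)
    also have "\<dots> = (\<Sum>v\<in>{K..<p}. between_sign p v K * exp (of_int (2 * (v - p) + 1) * u))"
      by (simp add: between_sign_def)
    finally show "(exp (2 * of_int (K - p) * u) - 1) * lerch_summand u = \<dots>" .
  qed (use False in \<open>auto simp: between_sign_def\<close>)
qed

text \<open>
  The difference of the two sides is the square of \<open>J + Mp + v\<close> plus \<open>- 2 (v - p) (v - MJ)\<close>, and the
  product is what the cone condition controls.
\<close>

lemma cone_form_lower_bound:
  fixes M J p v :: real
  assumes "M \<ge> 0" and "(v - p) * (v - M * J) \<le> 0"
  shows "(M + 1) * (J\<^sup>2 + M * p\<^sup>2 + 2 * (J + p) * v) \<ge> M * J\<^sup>2 + M * p\<^sup>2 + v\<^sup>2"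
proof -
  have "(M + 1) * (J\<^sup>2 + M * p\<^sup>2 + 2 * (J + p) * v) - (M * J\<^sup>2 + M * p\<^sup>2 + v\<^sup>2)
      = (J + M * p + v)\<^sup>2 - 2 * ((v - p) * (v - M * J))"
    by (simp add: algebra_simps power2_eq_square)
  then show ?thesis using assms(2) zero_le_power2[of "J + M * p + v"] by linarith
qed

lemma cone_sum_summable:
  fixes M :: int
  assumes L: "Re L < 0" and M: "M \<ge> 1"
  shows "(\<lambda>((J, p), v). between_sign p v (M * J) * cone_term M L A B J p v) summable_on UNIV"
proof -
  define a b l m where "a = Re A" and "b = Re B" and "l = Re L" and "m = real_of_int M"
  define d where "d = - l / (m + 1)"
  define c where "c = m * \<bar>a\<bar> + 2 * \<bar>a\<bar> + m * \<bar>b\<bar> + \<bar>l\<bar>"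
  define g where "g n = exp (c * \<bar>of_int n\<bar> - d * (of_int n)\<^sup>2)" for n :: int
  have m: "m \<ge> 1" using M by (simp add: m_def)
  have d: "d > 0" using L m by (auto simp: d_def l_def intro!: divide_pos_pos divide_neg_pos)
  have g: "g summable_on UNIV" unfolding g_def by (rule summable_on_gaussian_int[OF d])
  have "(\<lambda>z. norm (case z of ((J, p), v) \<Rightarrow> between_sign p v (M * J) * cone_term M L A B J p v)) summable_on UNIV"
  proof (rule Infinite_Sum.abs_summable_on_comparison_test')
    have "(\<lambda>(x, v). (case x of (J, p) \<Rightarrow> g J * g p) * g v) summable_on (UNIV \<times> UNIV) \<times> UNIV"
      by (intro summable_on_times_real g)
    then show "(\<lambda>z. exp \<bar>a\<bar> * (case z of ((J, p), v) \<Rightarrow> g J * g p * g v)) summable_on UNIV"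
      by (intro summable_on_cmult_right) (simp add: case_prod_unfold)
  next
    fix z :: "(int \<times> int) \<times> int"
    obtain J p v where z: "z = ((J, p), v)" by (metis surj_pair)
    show "norm (case z of ((J, p), v) \<Rightarrow> between_sign p v (M * J) * cone_term M L A B J p v)
        \<le> exp \<bar>a\<bar> * (case z of ((J, p), v) \<Rightarrow> g J * g p * g v)"
    proof (cases "between_sign p v (M * J) = 0")
      case True
      then show ?thesis by (simp add: z g_def)
    next
      case False
      define j q w where "j = real_of_int J" and "q = real_of_int p" and "w = real_of_int v"
      have "(v - p) * (v - M * J) \<le> 0"
        using False by (auto simp: between_sign_def mult_le_0_iff split: if_splits)
      then have "real_of_int ((v - p) * (v - M * J)) \<le> 0" by linarith
      then have "(w - q) * (w - m * j) \<le> 0" by (simp add: w_def q_def m_def j_def)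
      then have "(m + 1) * (j\<^sup>2 + m * q\<^sup>2 + 2 * (j + q) * w) \<ge> m * j\<^sup>2 + m * q\<^sup>2 + w\<^sup>2"
        using m by (intro cone_form_lower_bound) auto
      moreover have "m * j\<^sup>2 \<ge> 1 * j\<^sup>2" "m * q\<^sup>2 \<ge> 1 * q\<^sup>2"
        using m by (intro mult_right_mono; simp)+
      ultimately have "(m + 1) * (j\<^sup>2 + m * q\<^sup>2 + 2 * (j + q) * w) \<ge> j\<^sup>2 + q\<^sup>2 + w\<^sup>2"
        by linarith
      then have "d * (j\<^sup>2 + q\<^sup>2 + w\<^sup>2) \<le> d * ((m + 1) * (j\<^sup>2 + m * q\<^sup>2 + 2 * (j + q) * w))"
        using d by (intro mult_left_mono) auto
      also have "\<dots> = - l * (j\<^sup>2 + m * q\<^sup>2 + 2 * (j + q) * w)"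
        using m by (simp add: d_def)
      finally have 1: "(j\<^sup>2 + m * q\<^sup>2 + 2 * (j + q) * w) * l \<le> - (d * (j\<^sup>2 + q\<^sup>2 + w\<^sup>2))"
        by (simp add: mult_ac)
      have 2: "(j + q) * l \<le> \<bar>l\<bar> * \<bar>j\<bar> + \<bar>l\<bar> * \<bar>q\<bar>"
      proof -
        have "(j + q) * l \<le> \<bar>j + q\<bar> * \<bar>l\<bar>" by (metis abs_ge_self abs_mult)
        also have "\<dots> \<le> (\<bar>j\<bar> + \<bar>q\<bar>) * \<bar>l\<bar>" by (intro mult_right_mono abs_triangle_ineq) simp
        finally show ?thesis by (simp add: algebra_simps)
      qed
      have 3: "(m * q + 2 * w + 1) * a \<le> m * \<bar>a\<bar> * \<bar>q\<bar> + 2 * \<bar>a\<bar> * \<bar>w\<bar> + \<bar>a\<bar>"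
      proof -
        have "(m * q + 2 * w + 1) * a \<le> \<bar>m * q + 2 * w + 1\<bar> * \<bar>a\<bar>"
          by (metis abs_ge_self abs_mult)
        also have "\<dots> \<le> (m * \<bar>q\<bar> + 2 * \<bar>w\<bar> + 1) * \<bar>a\<bar>"
        proof (intro mult_right_mono)
          have "\<bar>m * q\<bar> = m * \<bar>q\<bar>" using m by (simp add: abs_mult)
          then show "\<bar>m * q + 2 * w + 1\<bar> \<le> m * \<bar>q\<bar> + 2 * \<bar>w\<bar> + 1" by linarith
        qed simp
        finally show ?thesis by (simp add: algebra_simps)
      qed
      have 4: "m * q * b \<le> m * \<bar>b\<bar> * \<bar>q\<bar>"
      proof -
        have "q * b \<le> \<bar>b\<bar> * \<bar>q\<bar>" by (metis abs_ge_self abs_mult mult.commute)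
        then show ?thesis using m by (simp add: mult.assoc mult_left_mono)
      qed
      have c: "c \<ge> 0" "c \<ge> \<bar>l\<bar>" "c \<ge> m * \<bar>a\<bar> + m * \<bar>b\<bar> + \<bar>l\<bar>" "c \<ge> 2 * \<bar>a\<bar>"
        using m by (simp_all add: c_def)
      have 5: "\<bar>l\<bar> * \<bar>j\<bar> + (m * \<bar>a\<bar> + m * \<bar>b\<bar> + \<bar>l\<bar>) * \<bar>q\<bar> + 2 * \<bar>a\<bar> * \<bar>w\<bar> \<le> c * \<bar>j\<bar> + c * \<bar>q\<bar> + c * \<bar>w\<bar>"
        using c by (intro add_mono mult_right_mono) auto
      have "(m * q + 2 * w + 1) * a + m * q * b + (j\<^sup>2 + m * q\<^sup>2 + (j + q) * (2 * w + 1)) * l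
          = (m * q + 2 * w + 1) * a + m * q * b + (j\<^sup>2 + m * q\<^sup>2 + 2 * (j + q) * w) * l + (j + q) * l"
        by (simp add: algebra_simps)
      also have "\<dots> \<le> \<bar>a\<bar> + (c * \<bar>j\<bar> + c * \<bar>q\<bar> + c * \<bar>w\<bar>) - d * (j\<^sup>2 + q\<^sup>2 + w\<^sup>2)"
        using 1 2 3 4 5 by (simp add: algebra_simps)
      finally have *: "(m * q + 2 * w + 1) * a + m * q * b + (j\<^sup>2 + m * q\<^sup>2 + (j + q) * (2 * w + 1)) * l
          \<le> \<bar>a\<bar> + (c * \<bar>j\<bar> + c * \<bar>q\<bar> + c * \<bar>w\<bar>) - d * (j\<^sup>2 + q\<^sup>2 + w\<^sup>2)" .
      have "norm (between_sign p v (M * J) * cone_term M L A B J p v)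
          = exp ((m * q + 2 * w + 1) * a + m * q * b + (j\<^sup>2 + m * q\<^sup>2 + (j + q) * (2 * w + 1)) * l)"
      proof -
        have "norm (between_sign p v (M * J)) = 1" using False by (auto simp: between_sign_def split: if_splits)
        moreover have Re_of_int: "Re (of_int k * z) = real_of_int k * Re z" for k z by simp
        ultimately show ?thesis
          by (simp only: cone_term_def norm_mult norm_power_int norm_minus_cancel norm_one power_int_1_left
               norm_exp_eq_Re plus_complex.sel Re_of_int)
             (simp add: a_def b_def l_def m_def j_def q_def w_def)
      qed
      also have "\<dots> \<le> exp (\<bar>a\<bar> + (c * \<bar>j\<bar> + c * \<bar>q\<bar> + c * \<bar>w\<bar>) - d * (j\<^sup>2 + q\<^sup>2 + w\<^sup>2))"
        using * by simp
      also have "\<dots> = exp \<bar>a\<bar> * (g J * g p * g v)"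
        by (simp add: g_def j_def q_def w_def algebra_simps flip: exp_add)
      finally show ?thesis by (simp add: z)
    qed
  qed
  from abs_summable_summable[OF this] show ?thesis
    by (simp add: case_prod_unfold)
qed

text \<open>
  Both products are double sums of monomials times \<open>lerch_summand\<close> at the points \<open>A + jL\<close>. With
  \<open>j = J + p\<close>, where \<open>J\<close> is the index of the left theta function and \<open>p\<close> that of the right one, the
  monomials at \<open>u = A + (J + p)L\<close> have the quotient \<open>exp (2(MJ - p)u)\<close>. So the poles cancel, and
  \<open>geometric_between\<close> expands the difference.
\<close>

lemma theta_times_appell:
  fixes M :: int
  assumes L: "Re L < 0" and M: "M \<ge> 1" and pole: "\<And>j::int. exp (2 * (A + of_int j * L)) \<noteq> 1"
  shows "(\<Sum>\<^sub>\<infinity>n\<in>UNIV. (-1) powi n * exp (of_int n * (of_int M * (A - B)) + (of_int n)\<^sup>2 * (of_int (M + 1) * L)))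
       * (\<Sum>\<^sub>\<infinity>j\<in>UNIV. exp (of_int j * (of_int M * (A + B)) + (of_int j)\<^sup>2 * (of_int M * L)) * lerch_summand (A + of_int j * L))
     = (\<Sum>\<^sub>\<infinity>l\<in>UNIV. (-1) powi l * exp ((of_int l)\<^sup>2 * L) * lerch_summand (A + of_int l * L))
       * (\<Sum>\<^sub>\<infinity>n\<in>UNIV. (-1) powi n * exp (of_int n * (of_int (M + 2) * A + of_int M * B) + (of_int n)\<^sup>2 * (of_int (M + 1) * L)))
     + (\<Sum>\<^sub>\<infinity>((J, p), v)\<in>UNIV. between_sign p v (M * J) * cone_term M L A B J p v)"
    (is "infsum ?th UNIV * infsum ?ap UNIV = infsum ?le UNIV * infsum ?ps UNIV + _")
proof -
  have ReM: "Re (of_int k * L) < 0" if "k \<ge> 1" for k :: int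
    using that L by (simp add: mult_pos_neg)
  define E where "E J p = of_int ((M + 2) * p) * A + of_int (M * p) * B
     + of_int ((J + p)\<^sup>2 + (M + 1) * p\<^sup>2) * L" for J p :: int
  define u where "u J p = A + of_int (J + p) * L" for J p :: int
  define R where "R = (\<lambda>(J, p). (-1) powi J * exp (E J p) * lerch_summand (u J p))"
  define S where "S = (\<lambda>(J, p). (-1) powi J * exp (E J p + 2 * of_int (M * J - p) * u J p) * lerch_summand (u J p))"
  have th: "?th summable_on UNIV" and ps: "?ps summable_on UNIV"
    using M by (intro summable_on_powi_exp_quadratic_int ReM; simp)+
  have ap: "?ap summable_on UNIV"
    using M L by (intro summable_on_gaussian_lerch ReM) auto
  have le: "?le summable_on UNIV"
    by (rule summable_on_powi_gaussian_lerch[OF L])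
  have Sterm: "S (J, p) = ?th J * ?ap (J + p)" for J p
  proof -
    have "of_int J * (of_int M * (A - B)) + (of_int J)\<^sup>2 * (of_int (M + 1) * L)
        + (of_int (J + p) * (of_int M * (A + B)) + (of_int (J + p))\<^sup>2 * (of_int M * L))
        = E J p + 2 * of_int (M * J - p) * u J p"
      by (simp add: E_def u_def algebra_simps power2_eq_square)
    then show ?thesis
      by (simp add: S_def u_def mult.assoc flip: exp_add)
  qed
  have Rterm: "R (J, p) = ?le (J + p) * ?ps p" for J p
  proof -
    have "(of_int (J + p))\<^sup>2 * L
        + (of_int p * (of_int (M + 2) * A + of_int M * B) + (of_int p)\<^sup>2 * (of_int (M + 1) * L))
        = E J p"
      by (simp add: E_def algebra_simps power2_eq_square)
    then have "?le (J + p) * ?ps p = ((-1) powi (J + p) * (-1) powi p) * exp (E J p) * lerch_summand (u J p)"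
      by (simp only: u_def exp_add[symmetric] mult_ac)
    also have "(-1) powi (J + p) * (-1) powi p = ((-1) powi J :: complex)"
      by (simp add: power_int_add mult.assoc)
    finally show ?thesis by (simp add: R_def)
  qed
  have S: "S summable_on UNIV" "infsum S UNIV = infsum ?th UNIV * infsum ?ap UNIV"
  proof -
    have "S summable_on UNIV \<longleftrightarrow> (\<lambda>(n, j). ?th n * ?ap j) summable_on UNIV \<times> UNIV"
      by (rule summable_on_reindex_bij_witness[of _ "\<lambda>(n, j). (n, j - n)" "\<lambda>(J, p). (J, J + p)"])
         (auto simp: Sterm simp del: of_int_add)
    then show "S summable_on UNIV" using summable_on_times_complex[OF th ap] by simp
    have "infsum S UNIV = (\<Sum>\<^sub>\<infinity>(n, j)\<in>UNIV \<times> UNIV. ?th n * ?ap j)"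
      by (rule infsum_reindex_bij_witness[of _ "\<lambda>(n, j). (n, j - n)" "\<lambda>(J, p). (J, J + p)"])
         (auto simp: Sterm simp del: of_int_add)
    then show "infsum S UNIV = infsum ?th UNIV * infsum ?ap UNIV"
      using infsum_times_complex[OF th ap] by simp
  qed
  have R: "R summable_on UNIV" "infsum R UNIV = infsum ?le UNIV * infsum ?ps UNIV"
  proof -
    have "R summable_on UNIV \<longleftrightarrow> (\<lambda>(l, n). ?le l * ?ps n) summable_on UNIV \<times> UNIV"
      by (rule summable_on_reindex_bij_witness[of _ "\<lambda>(l, n). (l - n, n)" "\<lambda>(J, p). (J + p, p)"])
         (auto simp: Rterm simp del: of_int_add)
    then show "R summable_on UNIV" using summable_on_times_complex[OF le ps] by simp
    have "infsum R UNIV = (\<Sum>\<^sub>\<infinity>(l, n)\<in>UNIV \<times> UNIV. ?le l * ?ps n)"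
      by (rule infsum_reindex_bij_witness[of _ "\<lambda>(l, n). (l - n, n)" "\<lambda>(J, p). (J + p, p)"])
         (auto simp: Rterm simp del: of_int_add)
    then show "infsum R UNIV = infsum ?le UNIV * infsum ?ps UNIV"
      using infsum_times_complex[OF le ps] by simp
  qed
  have cone: "(\<Sum>\<^sub>\<infinity>v\<in>UNIV. case x of (J, p) \<Rightarrow> between_sign p v (M * J) * cone_term M L A B J p v) = S x - R x" for x
  proof -
    obtain J p where x: "x = (J, p)" by (cases x)
    have pole': "exp (2 * u J p) \<noteq> 1" unfolding u_def by (rule pole)
    have cone_eq: "between_sign p v (M * J) * cone_term M L A B J p v
        = (-1) powi J * exp (E J p) * (between_sign p v (M * J) * exp (of_int (2 * (v - p) + 1) * u J p))" for v
    proof -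
      have "of_int (M * p + 2 * v + 1) * A + of_int (M * p) * B
          + of_int (J\<^sup>2 + M * p\<^sup>2 + (J + p) * (2 * v + 1)) * L = E J p + of_int (2 * (v - p) + 1) * u J p"
        by (simp add: E_def u_def algebra_simps power2_eq_square)
      then show ?thesis by (simp only: cone_term_def exp_add mult_ac)
    qed
    have "((\<lambda>v. between_sign p v (M * J) * cone_term M L A B J p v)
        has_sum (-1) powi J * exp (E J p) * ((exp (2 * of_int (M * J - p) * u J p) - 1) * lerch_summand (u J p))) UNIV"
      unfolding cone_eq by (intro has_sum_cmult_right geometric_between pole')
    then have "(\<Sum>\<^sub>\<infinity>v\<in>UNIV. between_sign p v (M * J) * cone_term M L A B J p v)
        = (-1) powi J * exp (E J p) * ((exp (2 * of_int (M * J - p) * u J p) - 1) * lerch_summand (u J p))"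
      by (rule infsumI)
    also have "\<dots> = S x - R x"
      by (simp only: x S_def R_def prod.case exp_add) (simp add: algebra_simps)
    finally show ?thesis by (simp add: x)
  qed
  have "infsum S UNIV - infsum R UNIV = (\<Sum>\<^sub>\<infinity>x. S x - R x)"
    using infsum_add[OF S(1) summable_on_uminus[THEN iffD2, OF R(1)]] by (simp add: infsum_uminus)
  also have "\<dots> = (\<Sum>\<^sub>\<infinity>x\<in>UNIV. \<Sum>\<^sub>\<infinity>v\<in>UNIV. case x of (J, p) \<Rightarrow> between_sign p v (M * J) * cone_term M L A B J p v)"
    by (simp only: cone)
  also have "\<dots> = (\<Sum>\<^sub>\<infinity>((J, p), v)\<in>UNIV \<times> UNIV. between_sign p v (M * J) * cone_term M L A B J p v)"
    using infsum_Sigma_banach[of "\<lambda>((J, p), v). between_sign p v (M * J) * cone_term M L A B J p v" UNIV "\<lambda>_. UNIV"]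
      cone_sum_summable[OF L M, of A B]
    by (simp add: case_prod_unfold)
  finally show ?thesis using S(2) R(2) by (simp add: algebra_simps)
qed

section \<open>Folding the sum over the double cone\<close>

text \<open>
  The part of \<open>cone_term\<close> that depends on \<open>J\<close>.
\<close>

definition parabola_term :: "complex \<Rightarrow> int \<Rightarrow> int \<Rightarrow> complex" where
  "parabola_term L v J = (-1) powi J * exp (of_int J * (of_int (2 * v + 1) * L) + (of_int J)\<^sup>2 * L)"

text \<open>
  In the notation of the theorem this is \<open>\<theta>\<^sub>w\<^sub>,\<^sub>M - \<theta>\<^sub>-\<^sub>w\<^sub>,\<^sub>M\<close> with \<open>L = 2\<pi>i\<tau>\<close> and \<open>Z = 2\<pi>iz\<close>. The two
  series are merged, so that oddness and periodicity in \<open>w\<close> are reindexings of one sum.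
\<close>

definition odd_theta :: "int \<Rightarrow> complex \<Rightarrow> complex \<Rightarrow> int \<Rightarrow> complex" where
  "odd_theta M L Z w = (\<Sum>\<^sub>\<infinity>p\<in>(UNIV::int set).
     (exp ((of_int (M * p) + of_int w / 2) * Z) - exp (- (of_int (M * p) + of_int w / 2) * Z))
     * exp ((of_int (M * p) + of_int w / 2)\<^sup>2 / of_int M * L))"

text \<open>
  The part of the antisymmetrised \<open>cone_term\<close> that depends on \<open>p\<close>. Up to a factor independent of \<open>p\<close>
  it is the summand of \<open>odd_theta\<close> at \<open>w = 2v + 1\<close>.
\<close>

definition odd_theta_term :: "int \<Rightarrow> complex \<Rightarrow> complex \<Rightarrow> complex \<Rightarrow> int \<Rightarrow> int \<Rightarrow> complex" where
  "odd_theta_term M L A B v p = 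
     (exp (of_int (M * p + 2 * v + 1) * A + of_int (M * p) * B)
      - exp (- of_int (M * p) * A - of_int (M * p + 2 * v + 1) * B))
     * exp (of_int (M * p\<^sup>2 + p * (2 * v + 1)) * L)"

lemma cone_term_antisymmetrised:
  "cone_term M L A B J p v - cone_term M L (- B) (- A) J p v
   = parabola_term L v J * odd_theta_term M L A B v p"
proof -
  define e where "e = (of_int (J\<^sup>2 + M * p\<^sup>2 + (J + p) * (2 * v + 1)) * L)"
  have e: "e = (of_int J * (of_int (2 * v + 1) * L) + (of_int J)\<^sup>2 * L) + of_int (M * p\<^sup>2 + p * (2 * v + 1)) * L"
    by (simp add: e_def algebra_simps power2_eq_square)
  have "cone_term M L A B J p v - cone_term M L (- B) (- A) J p v
      = (-1) powi J * exp e * (exp (of_int (M * p + 2 * v + 1) * A + of_int (M * p) * B)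
          - exp (of_int (M * p + 2 * v + 1) * (- B) + of_int (M * p) * (- A)))"
    by (simp only: cone_term_def e_def[symmetric] exp_add) (simp only: ring_distribs mult_ac)
  also have "of_int (M * p + 2 * v + 1) * (- B) + of_int (M * p) * (- A) = - of_int (M * p) * A - of_int (M * p + 2 * v + 1) * B"
    by (simp add: algebra_simps)
  finally show ?thesis
    unfolding e exp_add[of "of_int J * (of_int (2 * v + 1) * L) + (of_int J)\<^sup>2 * L"]
    by (simp only: parabola_term_def odd_theta_term_def mult_ac)
qed

lemma parabola_term_summable:
  assumes "Re L < 0"
  shows "parabola_term L v summable_on S"
proof -
  have "parabola_term L v summable_on UNIV"
    unfolding parabola_term_def by (rule summable_on_powi_exp_quadratic_int[OF assms])
  then show ?thesis by (rule summable_on_subset_banach) simp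
qed

text \<open>
  The reflection \<open>J \<mapsto> - J - (2v + 1)\<close> fixes the exponent \<open>J\<^sup>2 + (2v + 1)J\<close> and, as \<open>2v + 1\<close> is odd,
  reverses the sign.
\<close>

lemma infsum_parabola_term_eq_0: "(\<Sum>\<^sub>\<infinity>J. parabola_term L v J) = 0"
proof -
  have "(\<Sum>\<^sub>\<infinity>J. parabola_term L v J) = (\<Sum>\<^sub>\<infinity>J. - parabola_term L v J)"
  proof (rule infsum_reindex_bij_witness[of _ "\<lambda>J. - J - (2 * v + 1)" "\<lambda>J. - J - (2 * v + 1)"])
    fix J
    have "(-1) powi (- J - (2 * v + 1)) = - ((-1) powi J :: complex)"
    proof -
      have "- J - (2 * v + 1) = - J + - (2 * v + 1)" by simp
      also have "(-1 :: complex) powi \<dots> = (-1) powi (- J) * (-1) powi (- (2 * v + 1))"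
        by (rule power_int_add) simp
      also have "(-1) powi (- (2 * v + 1) :: int) = (-1 :: complex)"
        by (simp add: power_int_minus_one_minus power_int_add power_int_mult)
      finally show ?thesis by (simp add: power_int_minus_one_minus)
    qed
    moreover have "of_int (- J - (2 * v + 1)) * (of_int (2 * v + 1) * L) + (of_int (- J - (2 * v + 1)))\<^sup>2 * L
        = of_int J * (of_int (2 * v + 1) * L) + (of_int J)\<^sup>2 * L"
      by (simp add: algebra_simps power2_eq_square)
    ultimately show "- parabola_term L v (- J - (2 * v + 1)) = parabola_term L v J"
      by (simp only: parabola_term_def) simp
  qed auto
  then show ?thesis by (simp add: infsum_uminus)
qed

lemma infsum_parabola_term_Compl:
  assumes "Re L < 0"
  shows "infsum (parabola_term L v) (- S) = - infsum (parabola_term L v) S"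
proof -
  have "infsum (parabola_term L v) (S \<union> - S) = infsum (parabola_term L v) S + infsum (parabola_term L v) (- S)"
    by (intro infsum_Un_disjoint parabola_term_summable assms) auto
  then show ?thesis using infsum_parabola_term_eq_0[of L v] by (simp add: eq_neg_iff_add_eq_0 add.commute)
qed

lemma odd_theta_term_eq:
  assumes "M \<noteq> 0"
  shows "odd_theta_term M L A B v p =
     exp (of_int (2 * v + 1) / 2 * (A - B) - (of_int (2 * v + 1))\<^sup>2 / (4 * of_int M) * L) *
     ((exp ((of_int (M * p) + of_int (2 * v + 1) / 2) * (A + B)) - exp (- (of_int (M * p) + of_int (2 * v + 1) / 2) * (A + B)))
     * exp ((of_int (M * p) + of_int (2 * v + 1) / 2)\<^sup>2 / of_int M * L))"
proof -
  have M: "of_int M \<noteq> (0::complex)" using assms by simp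
  have 1: "of_int (M * p + 2 * v + 1) * A + of_int (M * p) * B
      = of_int (2 * v + 1) / 2 * (A - B) + (of_int (M * p) + of_int (2 * v + 1) / 2) * (A + B)"
    by (simp add: field_simps)
  have 2: "- of_int (M * p) * A - of_int (M * p + 2 * v + 1) * B
      = of_int (2 * v + 1) / 2 * (A - B) + (- (of_int (M * p) + of_int (2 * v + 1) / 2) * (A + B))"
    by (simp add: field_simps)
  have 3: "of_int (M * p\<^sup>2 + p * (2 * v + 1)) * L = - ((of_int (2 * v + 1))\<^sup>2 / (4 * of_int M) * L)
      + (of_int (M * p) + of_int (2 * v + 1) / 2)\<^sup>2 / of_int M * L"
    using M by (simp add: field_simps power2_eq_square)
  have 4: "exp (of_int (2 * v + 1) / 2 * (A - B) - (of_int (2 * v + 1))\<^sup>2 / (4 * of_int M) * L)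
    = exp (of_int (2 * v + 1) / 2 * (A - B)) * exp (- ((of_int (2 * v + 1))\<^sup>2 / (4 * of_int M) * L))"
    by (simp flip: exp_add)
  show ?thesis
    unfolding odd_theta_term_def 1 2 3 4 exp_add by (simp only: ring_distribs mult_ac)
qed

lemma odd_theta_term_summable:
  assumes "Re L < 0" and "M \<ge> 1"
  shows "odd_theta_term M L A B v summable_on S"
proof -
  have Re: "Re (of_int M * L) < 0" using assms by (simp add: mult_pos_neg)
  have "odd_theta_term M L A B v p =
      exp (of_int (2 * v + 1) * A) * exp (of_int p * (of_int M * (A + B) + of_int (2 * v + 1) * L) + (of_int p)\<^sup>2 * (of_int M * L))
      + (- exp (- of_int (2 * v + 1) * B)) * exp (of_int p * (- of_int M * (A + B) + of_int (2 * v + 1) * L) + (of_int p)\<^sup>2 * (of_int M * L))" for p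
    by (simp add: odd_theta_term_def algebra_simps power2_eq_square flip: exp_add)
  moreover have "(\<lambda>p. exp (of_int (2 * v + 1) * A) * exp (of_int p * (of_int M * (A + B) + of_int (2 * v + 1) * L) + (of_int p)\<^sup>2 * (of_int M * L))
      + (- exp (- of_int (2 * v + 1) * B)) * exp (of_int p * (- of_int M * (A + B) + of_int (2 * v + 1) * L) + (of_int p)\<^sup>2 * (of_int M * L))) summable_on UNIV"
    by (intro summable_on_add summable_on_cmult_right summable_on_exp_quadratic_int Re)
  ultimately have "odd_theta_term M L A B v summable_on UNIV" by presburger
  then show ?thesis by (rule summable_on_subset_banach) simp
qed

lemma infsum_odd_theta_term:
  assumes "M \<noteq> 0"
  shows "(\<Sum>\<^sub>\<infinity>p. odd_theta_term M L A B v p)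
    = exp (of_int (2 * v + 1) / 2 * (A - B) - (of_int (2 * v + 1))\<^sup>2 / (4 * of_int M) * L) * odd_theta M L (A + B) (2 * v + 1)"
  unfolding odd_theta_term_eq[OF assms] infsum_cmult_right' odd_theta_def ..

lemma odd_theta_uminus: "odd_theta M L Z (- w) = - odd_theta M L Z w"
proof -
  have "odd_theta M L Z (- w) = (\<Sum>\<^sub>\<infinity>p\<in>(UNIV::int set).
     - ((exp ((of_int (M * p) + of_int w / 2) * Z) - exp (- (of_int (M * p) + of_int w / 2) * Z))
     * exp ((of_int (M * p) + of_int w / 2)\<^sup>2 / of_int M * L)))"
    unfolding odd_theta_def
  proof (rule infsum_reindex_bij_witness[of _ uminus uminus])
    fix p :: int
    have "of_int (M * - p) + of_int w / 2 = - (of_int (M * p) + of_int (- w) / 2 :: complex)" by simp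
    then show "- ((exp ((of_int (M * - p) + of_int w / 2) * Z) - exp (- (of_int (M * - p) + of_int w / 2) * Z))
        * exp ((of_int (M * - p) + of_int w / 2)\<^sup>2 / of_int M * L))
       = (exp ((of_int (M * p) + of_int (- w) / 2) * Z) - exp (- (of_int (M * p) + of_int (- w) / 2) * Z))
        * exp ((of_int (M * p) + of_int (- w) / 2)\<^sup>2 / of_int M * L)"
      by (simp only: minus_minus power2_minus) (simp add: algebra_simps)
  qed auto
  then show ?thesis by (simp add: infsum_uminus odd_theta_def)
qed

lemma odd_theta_periodic: "odd_theta M L Z (w + 2 * M * r) = odd_theta M L Z w"
  unfolding odd_theta_def
proof (rule infsum_reindex_bij_witness[of _ "\<lambda>p. p - r" "\<lambda>p. p + r"])
  fix p :: int
  have "of_int (M * p) + of_int (w + 2 * M * r) / 2 = (of_int (M * (p + r)) + of_int w / 2 :: complex)"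
    by (simp add: field_simps)
  then show "(exp ((of_int (M * (p + r)) + of_int w / 2) * Z) - exp (- (of_int (M * (p + r)) + of_int w / 2) * Z))
        * exp ((of_int (M * (p + r)) + of_int w / 2)\<^sup>2 / of_int M * L)
      = (exp ((of_int (M * p) + of_int (w + 2 * M * r) / 2) * Z) - exp (- (of_int (M * p) + of_int (w + 2 * M * r) / 2) * Z))
        * exp ((of_int (M * p) + of_int (w + 2 * M * r) / 2)\<^sup>2 / of_int M * L)"
    by (simp only:)
qed auto

text \<open>
  Periodicity leaves finitely many values.
\<close>

lemma odd_theta_bounded:
  assumes "M \<ge> 1"
  shows "\<exists>K. \<forall>w. norm (odd_theta M L Z w) \<le> K"
proof (intro exI allI)
  fix w
  have "odd_theta M L Z w = odd_theta M L Z (w mod (2 * M))"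
    using odd_theta_periodic[of M L Z "w mod (2 * M)" "w div (2 * M)"] by simp
  also have "norm \<dots> \<le> (\<Sum>w\<in>{0..<2 * M}. norm (odd_theta M L Z w))"
    using assms by (intro member_le_sum) auto
  finally show "norm (odd_theta M L Z w) \<le> (\<Sum>w\<in>{0..<2 * M}. norm (odd_theta M L Z w))" .
qed

text \<open>
  For fixed \<open>v\<close> the sign is the indicator of the quadrant \<open>MJ \<le> v < p\<close> minus that of \<open>p \<le> v < MJ\<close>, so
  the sum is a difference of two products of half sums. The half sums over \<open>J\<close> are opposite to each
  other, and the half sums over \<open>p\<close> add up to a full theta series.
\<close>

lemma infsum_between_sign_product:
  fixes M :: int
  assumes L: "Re L < 0" and M: "M \<ge> 1"
  shows "(\<Sum>\<^sub>\<infinity>(J, p)\<in>UNIV. between_sign p v (M * J) * (parabola_term L v J * odd_theta_term M L A B v p))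
    = - (infsum (parabola_term L v) {J. v < M * J} * (\<Sum>\<^sub>\<infinity>p. odd_theta_term M L A B v p))"
proof -
  define S T where "S = {J. v < M * J}" and "T = {p. v < p}"
  define h c where "h = parabola_term L v" and "c = odd_theta_term M L A B v"
  have h: "h summable_on X" for X unfolding h_def by (rule parabola_term_summable[OF L])
  have c: "c summable_on X" for X unfolding c_def by (rule odd_theta_term_summable[OF L M])
  \<comment> \<open>Extension by zero puts the products over different quadrants on one index set.\<close>
  define F where "F X = (\<lambda>z. if z \<in> X then (case z of (J, p) \<Rightarrow> h J * c p) else 0)" for X
  have F: "F (X \<times> Y) summable_on UNIV" "infsum (F (X \<times> Y)) UNIV = infsum h X * infsum c Y" for X Y
  proof -
    have "F (X \<times> Y) summable_on UNIV \<longleftrightarrow> (\<lambda>(J, p). h J * c p) summable_on X \<times> Y"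
      by (rule summable_on_cong_neutral) (auto simp: F_def)
    then show "F (X \<times> Y) summable_on UNIV" using summable_on_times_complex[OF h c] by simp
    have "infsum (F (X \<times> Y)) UNIV = (\<Sum>\<^sub>\<infinity>(J, p)\<in>X \<times> Y. h J * c p)"
      by (rule infsum_cong_neutral) (auto simp: F_def)
    then show "infsum (F (X \<times> Y)) UNIV = infsum h X * infsum c Y"
      using infsum_times_complex[OF h c] by simp
  qed
  have "(\<Sum>\<^sub>\<infinity>(J, p)\<in>UNIV. between_sign p v (M * J) * (h J * c p)) = (\<Sum>\<^sub>\<infinity>z. F ((- S) \<times> T) z + - F (S \<times> (- T)) z)"
    by (rule infsum_cong) (auto simp: F_def S_def T_def between_sign_def split: if_splits)
  also have "\<dots> = infsum (F ((- S) \<times> T)) UNIV + (\<Sum>\<^sub>\<infinity>z. - F (S \<times> (- T)) z)"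
    by (intro infsum_add F summable_on_uminus[THEN iffD2])
  also have "\<dots> = infsum h (- S) * infsum c T - infsum h S * infsum c (- T)"
    by (simp add: infsum_uminus F)
  also have "infsum h (- S) = - infsum h S"
    unfolding h_def by (rule infsum_parabola_term_Compl[OF L])
  also have "- infsum h S * infsum c T - infsum h S * infsum c (- T) = - (infsum h S * (infsum c T + infsum c (- T)))"
    by (simp add: algebra_simps)
  also have "infsum c T + infsum c (- T) = infsum c (T \<union> - T)"
    by (rule infsum_Un_disjoint[symmetric]) (auto intro: c)
  finally show ?thesis by (simp add: h_def c_def S_def)
qed

lemma infsum_parabola_term_reflect:
  assumes L: "Re L < 0"
  shows "infsum (parabola_term L (- 1 - v)) {J. - 1 - v < M * J} = - infsum (parabola_term L v) {J. v < M * J}"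
proof -
  have "infsum (parabola_term L (- 1 - v)) {J. - 1 - v < M * J} = infsum (parabola_term L v) (- {J. v < M * J})"
  proof (rule infsum_reindex_bij_witness[of _ uminus uminus])
    fix J
    have "of_int (- J) * (of_int (2 * v + 1) * L) + (of_int (- J))\<^sup>2 * L
      = of_int J * (of_int (2 * (- 1 - v) + 1) * L) + (of_int J)\<^sup>2 * L"
      by (simp add: algebra_simps)
    then show "parabola_term L v (- J) = parabola_term L (- 1 - v) J"
      by (simp only: parabola_term_def power_int_minus_one_minus)
  qed auto
  then show ?thesis by (simp only: infsum_parabola_term_Compl[OF L])
qed

lemma infsum_odd_theta_term_reflect:
  assumes "M \<noteq> 0"
  shows "(\<Sum>\<^sub>\<infinity>p. odd_theta_term M L A B (- 1 - v) p)
    = - (exp (- of_int (2 * v + 1) * (A - B)) * (\<Sum>\<^sub>\<infinity>p. odd_theta_term M L A B v p))"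
proof -
  have w: "2 * (- 1 - v) + 1 = - (2 * v + 1)" by simp
  have "(\<Sum>\<^sub>\<infinity>p. odd_theta_term M L A B (- 1 - v) p)
      = - (exp (of_int (- (2 * v + 1)) / 2 * (A - B) - (of_int (- (2 * v + 1)))\<^sup>2 / (4 * of_int M) * L) * odd_theta M L (A + B) (2 * v + 1))"
    unfolding infsum_odd_theta_term[OF assms] w odd_theta_uminus by simp
  also have "of_int (- (2 * v + 1)) / 2 * (A - B) - (of_int (- (2 * v + 1)))\<^sup>2 / (4 * of_int M) * L
      = - of_int (2 * v + 1) * (A - B) + (of_int (2 * v + 1) / 2 * (A - B) - (of_int (2 * v + 1))\<^sup>2 / (4 * of_int M) * L)"
    using assms by (simp add: field_simps power2_eq_square)
  finally show ?thesis unfolding infsum_odd_theta_term[OF assms] exp_add by (simp only: mult_ac)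
qed

text \<open>
  The contribution of \<open>J\<close> and \<open>w = 2v + 1\<close> after \<open>v\<close> and \<open>- 1 - v\<close> have been combined.
\<close>

definition folded_term :: "int \<Rightarrow> complex \<Rightarrow> complex \<Rightarrow> complex \<Rightarrow> int \<Rightarrow> int \<Rightarrow> complex" where
  "folded_term M L A B J w = (-1) powi J
     * exp ((of_int J * of_int w + (of_int J)\<^sup>2 - (of_int w)\<^sup>2 / (4 * of_int M)) * L)
     * (exp (of_int w / 2 * (A - B)) + exp (- (of_int w / 2 * (A - B))))
     * odd_theta M L (A + B) w"

lemma folded_term_eq:
  assumes "M \<noteq> 0"
  shows "folded_term M L A B J (2 * v + 1) = parabola_term L v J
     * ((\<Sum>\<^sub>\<infinity>p. odd_theta_term M L A B v p) * (1 + exp (- of_int (2 * v + 1) * (A - B))))"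
proof -
  define w where "w = 2 * v + 1"
  have 1: "exp (- of_int w * (A - B)) = exp (- (of_int w / 2 * (A - B))) * exp (- (of_int w / 2 * (A - B)))"
    by (simp add: mult_2[symmetric] flip: exp_add)
  have 2: "exp (of_int w / 2 * (A - B)) * exp (- (of_int w / 2 * (A - B))) = 1"
    by (simp flip: exp_add)
  have 3: "(of_int J * of_int w + (of_int J)\<^sup>2 - (of_int w)\<^sup>2 / (4 * of_int M)) * L
     = (of_int J * (of_int w * L) + (of_int J)\<^sup>2 * L) + - ((of_int w)\<^sup>2 / (4 * of_int M) * L)"
    by (simp add: algebra_simps)
  have "exp (of_int w / 2 * (A - B)) + exp (- (of_int w / 2 * (A - B)))
      = exp (of_int w / 2 * (A - B)) * (1 + exp (- of_int w * (A - B)))"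
    unfolding 1 using 2 by (simp add: algebra_simps)
  then show ?thesis
    unfolding folded_term_def infsum_odd_theta_term[OF assms] parabola_term_def w_def[symmetric] 3 exp_add
      diff_conv_add_uminus[of "of_int w / 2 * (A - B)"]
    by (simp only: mult_ac)
qed

text \<open>
  On \<open>0 < w \<le> 2MJ\<close> the exponent \<open>J\<^sup>2 + Jw - w\<^sup>2 / (4M)\<close> is at least \<open>J\<^sup>2 + w\<^sup>2 / (4M)\<close>, and the theta
  factor is bounded.
\<close>

lemma folded_term_summable:
  fixes M :: int
  assumes L: "Re L < 0" and M: "M \<ge> 1"
  shows "(\<lambda>(J, v). folded_term M L A B J (2 * v + 1)) summable_on (SIGMA J:{1..}. {0..<M * J})"
proof -
  obtain K where K: "\<And>w. norm (odd_theta M L (A + B) w) \<le> K"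
    using odd_theta_bounded[OF M] by blast
  have K0: "K \<ge> 0" using K[of 0] norm_ge_zero order_trans by blast
  define d k m where "d = - Re L" and "k = \<bar>Re (A - B)\<bar>" and "m = real_of_int M"
  have d: "d > 0" and m: "m \<ge> 1" and k: "k \<ge> 0" using L M by (auto simp: d_def m_def k_def)
  define g1 where "g1 J = exp (0 * \<bar>of_int J\<bar> - d * (of_int J)\<^sup>2)" for J :: int
  define g2 where "g2 v = exp (k * \<bar>of_int v\<bar> - d / m * (of_int v)\<^sup>2)" for v :: int
  have g: "g1 summable_on UNIV" "g2 summable_on UNIV"
    unfolding g1_def g2_def using d m by (intro summable_on_gaussian_int; simp)+
  have "(\<lambda>z. norm (case z of (J, v) \<Rightarrow> folded_term M L A B J (2 * v + 1))) summable_on (SIGMA J:{1..}. {0..<M * J})"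
  proof (rule Infinite_Sum.abs_summable_on_comparison_test')
    have "(\<lambda>z. 2 * exp k * K * (case z of (J, v) \<Rightarrow> g1 J * g2 v)) summable_on UNIV \<times> UNIV"
      by (intro summable_on_cmult_right summable_on_times_real g)
    then show "(\<lambda>z. 2 * exp k * K * (case z of (J, v) \<Rightarrow> g1 J * g2 v)) summable_on (SIGMA J:{1..}. {0..<M * J})"
      by (rule summable_on_subset_banach) simp
  next
    fix z assume z: "z \<in> (SIGMA J:{1..}. {0..<M * J})"
    obtain J v where zJ: "z = (J, v)" by (cases z)
    have v: "0 \<le> v" "v < M * J" using z zJ by auto
    define j w x where "j = real_of_int J" and "w = real_of_int (2 * v + 1)" and "x = real_of_int v"
    have w: "w = 2 * x + 1" "x \<ge> 0" using v by (simp_all add: w_def x_def)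
    have "2 * v + 1 \<le> 2 * (M * J)" using v by linarith
    then have "real_of_int (2 * v + 1) \<le> real_of_int (2 * (M * J))" by (simp only: of_int_le_iff)
    then have wj: "w \<le> 2 * m * j" by (simp add: w_def m_def j_def)
    have "w * w \<le> 2 * m * j * w" using wj w by (intro mult_right_mono) auto
    then have 1: "w\<^sup>2 / (4 * m) + w\<^sup>2 / (4 * m) \<le> j * w"
      using m by (simp add: field_simps power2_eq_square)
    have "x\<^sup>2 \<le> (w / 2)\<^sup>2" using w by (intro power_mono) auto
    then have "x\<^sup>2 / m \<le> w\<^sup>2 / (4 * m)" using m by (simp add: field_simps)
    with 1 have "j * w + j\<^sup>2 - w\<^sup>2 / (4 * m) \<ge> j\<^sup>2 + x\<^sup>2 / m" by linarith
    then have 2: "(j * w + j\<^sup>2 - w\<^sup>2 / (4 * m)) * Re L \<le> (j\<^sup>2 + x\<^sup>2 / m) * Re L"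
      using L by (intro mult_right_mono_neg) auto
    have Re: "Re ((of_int J * of_int (2 * v + 1) + (of_int J)\<^sup>2 - (of_int (2 * v + 1))\<^sup>2 / (4 * of_int M)) * L)
        = (j * w + j\<^sup>2 - w\<^sup>2 / (4 * m)) * Re L"
    proof -
      have "of_int J * of_int (2 * v + 1) + (of_int J)\<^sup>2 - (of_int (2 * v + 1))\<^sup>2 / (4 * of_int M)
        = complex_of_real (j * w + j\<^sup>2 - w\<^sup>2 / (4 * m))"
        by (simp add: j_def w_def m_def)
      then show ?thesis by (simp only: Re_complex_of_real Im_complex_of_real times_complex.sel)
    qed
    have n1: "norm (exp ((of_int J * of_int (2 * v + 1) + (of_int J)\<^sup>2 - (of_int (2 * v + 1))\<^sup>2 / (4 * of_int M)) * L))
        \<le> g1 J * exp (- (d / m * x\<^sup>2))"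
    proof -
      have "- (d * j\<^sup>2) + - (d / m * x\<^sup>2) = (j\<^sup>2 + x\<^sup>2 / m) * Re L" using m by (simp add: d_def field_simps)
      then show ?thesis
        using 2 unfolding norm_exp_eq_Re Re by (simp add: g1_def j_def[symmetric] flip: exp_add)
    qed
    have wk: "w / 2 * \<bar>Re (A - B)\<bar> \<le> k + k * x"
    proof -
      have "w / 2 * k \<le> (1 + x) * k" using w k by (intro mult_right_mono) auto
      then show ?thesis unfolding k_def[symmetric] by (simp add: algebra_simps)
    qed
    have ReAB: "Re (of_int (2 * v + 1) / 2 * (A - B)) = w / 2 * Re (A - B)"
    proof -
      have "of_int (2 * v + 1) / 2 = complex_of_real (w / 2)" by (simp add: w_def)
      then show ?thesis by (simp only: Re_complex_of_real Im_complex_of_real times_complex.sel)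
    qed
    have "\<bar>w / 2 * Re (A - B)\<bar> = w / 2 * \<bar>Re (A - B)\<bar>"
      unfolding abs_mult using w by simp
    then have "\<bar>w / 2 * Re (A - B)\<bar> \<le> k + k * x" using wk by (simp only:)
    then have "norm (exp (of_int (2 * v + 1) / 2 * (A - B))) \<le> exp (k + k * x)"
      "norm (exp (- (of_int (2 * v + 1) / 2 * (A - B)))) \<le> exp (k + k * x)"
      by (simp_all only: norm_exp_eq_Re ReAB uminus_complex.sel exp_le_cancel_iff abs_le_iff)
    then have n2: "norm (exp (of_int (2 * v + 1) / 2 * (A - B)) + exp (- (of_int (2 * v + 1) / 2 * (A - B)))) \<le> 2 * exp (k + k * x)"
      using norm_triangle_ineq[of "exp (of_int (2 * v + 1) / 2 * (A - B))" "exp (- (of_int (2 * v + 1) / 2 * (A - B)))"]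
      by linarith
    have "norm (folded_term M L A B J (2 * v + 1)) \<le> 1 * (g1 J * exp (- (d / m * x\<^sup>2))) * (2 * exp (k + k * x)) * K"
      unfolding folded_term_def norm_mult
      by (intro mult_mono n1 n2 K mult_nonneg_nonneg norm_ge_zero) (auto simp: norm_power_int g1_def)
    also have "\<dots> = 2 * exp k * K * (g1 J * (exp (k * x) * exp (- (d / m * x\<^sup>2))))"
      by (simp add: exp_add)
    also have "exp (k * x) * exp (- (d / m * x\<^sup>2)) = g2 v"
      using w by (simp add: g2_def x_def flip: exp_add)
    finally show "norm (case z of (J, v) \<Rightarrow> folded_term M L A B J (2 * v + 1)) \<le> 2 * exp k * K * (case z of (J, v) \<Rightarrow> g1 J * g2 v)"
      by (simp add: zJ)
  qed
  then show ?thesis by (rule abs_summable_summable)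
qed

text \<open>
  Summing over \<open>(J, p)\<close> first leaves a sum over \<open>v\<close>. The substitution \<open>v \<mapsto> - 1 - v\<close> replaces \<open>w\<close> by
  \<open>- w\<close>, under which both factors are odd up to an exponential, so the negative \<open>v\<close> fold onto the
  nonnegative ones. For \<open>v \<ge> 0\<close> the condition \<open>v < MJ\<close> forces \<open>J \<ge> 1\<close> and makes the inner
  sum finite once \<open>J\<close> is outermost.
\<close>

lemma cone_sum_folded:
  fixes M :: int
  assumes L: "Re L < 0" and M: "M \<ge> 1"
  shows "(\<Sum>\<^sub>\<infinity>((J, p), v)\<in>UNIV. between_sign p v (M * J) * cone_term M L A B J p v)
    - (\<Sum>\<^sub>\<infinity>((J, p), v)\<in>UNIV. between_sign p v (M * J) * cone_term M L (- B) (- A) J p v)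
    = - (\<Sum>\<^sub>\<infinity>J\<in>{1..}. \<Sum>v\<in>{0..<M * J}. folded_term M L A B J (2 * v + 1))"
proof -
  have M0: "M \<noteq> 0" using M by simp
  define H where "H v = infsum (parabola_term L v) {J. v < M * J}" for v
  define C where "C v = (\<Sum>\<^sub>\<infinity>p. odd_theta_term M L A B v p)" for v
  define E where "E v = 1 + exp (- of_int (2 * v + 1) * (A - B))" for v :: int
  define f where "f x v = (case x of (J, p) \<Rightarrow> between_sign p v (M * J) * (parabola_term L v J * odd_theta_term M L A B v p))" for x v
  define f1 where "f1 = (\<lambda>((J, p), v). between_sign p v (M * J) * cone_term M L A B J p v)"
  define f2 where "f2 = (\<lambda>((J, p), v). between_sign p v (M * J) * cone_term M L (- B) (- A) J p v)"
  have f12: "f1 summable_on UNIV" "f2 summable_on UNIV"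
    unfolding f1_def f2_def by (intro cone_sum_summable L M)+
  have f_eq: "f1 z + - f2 z = (case z of (x, v) \<Rightarrow> f x v)" for z
  proof -
    obtain J p v where z: "z = ((J, p), v)" by (metis surj_pair)
    show ?thesis unfolding z f1_def f2_def f_def
      by (simp flip: cone_term_antisymmetrised add: algebra_simps)
  qed
  have fs: "(\<lambda>(x, v). f x v) summable_on UNIV \<times> UNIV"
    using summable_on_add[OF f12(1) summable_on_uminus[THEN iffD2, OF f12(2)]] unfolding f_eq by simp
  have fs': "(\<lambda>(v, x). f x v) summable_on UNIV \<times> UNIV"
    using summable_on_swap[of "\<lambda>(x, v). f x v" UNIV UNIV] fs by simp
  have fv: "(\<Sum>\<^sub>\<infinity>x. f x v) = - (H v * C v)" for v
    using infsum_between_sign_product[OF L M, of v A B] by (simp add: f_def H_def C_def)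
  have "infsum f1 UNIV - infsum f2 UNIV = (\<Sum>\<^sub>\<infinity>z. f1 z + - f2 z)"
    using infsum_add[OF f12(1) summable_on_uminus[THEN iffD2, OF f12(2)]] by (simp add: infsum_uminus)
  also have "\<dots> = (\<Sum>\<^sub>\<infinity>x. \<Sum>\<^sub>\<infinity>v. f x v)"
    using infsum_Sigma'_banach[OF fs] unfolding f_eq by simp
  also have "\<dots> = (\<Sum>\<^sub>\<infinity>v. \<Sum>\<^sub>\<infinity>x. f x v)"
    by (rule infsum_swap_banach[OF fs])
  also have "\<dots> = - (\<Sum>\<^sub>\<infinity>v. H v * C v)"
    by (simp add: fv infsum_uminus)
  finally have 1: "infsum f1 UNIV - infsum f2 UNIV = - (\<Sum>\<^sub>\<infinity>v. H v * C v)" .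
  have HC: "(\<lambda>v. H v * C v) summable_on X" for X
  proof -
    have "(\<lambda>v. - (H v * C v)) summable_on UNIV"
      using summable_on_Sigma_banach[OF fs'] by (simp add: fv)
    then have "(\<lambda>v. H v * C v) summable_on UNIV" by (simp add: summable_on_uminus)
    then show ?thesis by (rule summable_on_subset_banach) simp
  qed
  have refl: "H (- 1 - v) * C (- 1 - v) = H v * C v * exp (- of_int (2 * v + 1) * (A - B))" for v
    unfolding H_def C_def infsum_parabola_term_reflect[OF L] infsum_odd_theta_term_reflect[OF M0]
    by (simp only: minus_mult_minus mult_ac)
  have refl': "H (- 1 - v) * C (- 1 - v) * exp (- of_int (2 * (- 1 - v) + 1) * (A - B)) = H v * C v" for v
    using refl[of "- 1 - v"] by simp
  \<comment> \<open>The map \<open>v \<mapsto> - 1 - v\<close> exchanges negative and nonnegative integers.\<close>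
  have neg: "(\<Sum>\<^sub>\<infinity>v\<in>{..<0}. H v * C v) = (\<Sum>\<^sub>\<infinity>v\<in>{0..}. H v * C v * exp (- of_int (2 * v + 1) * (A - B)))"
  proof (rule infsum_reindex_bij_witness[of _ "\<lambda>v. - 1 - v" "\<lambda>v. - 1 - v"])
    show "H (- 1 - v) * C (- 1 - v) * exp (- of_int (2 * (- 1 - v) + 1) * (A - B)) = H v * C v" for v
      by (rule refl')
  qed auto
  have "(\<lambda>v. H v * C v) summable_on {..<0} \<longleftrightarrow> (\<lambda>v. H v * C v * exp (- of_int (2 * v + 1) * (A - B))) summable_on {0..}"
  proof (rule summable_on_reindex_bij_witness[of _ "\<lambda>v. - 1 - v" "\<lambda>v. - 1 - v"])
    show "H (- 1 - v) * C (- 1 - v) * exp (- of_int (2 * (- 1 - v) + 1) * (A - B)) = H v * C v" for v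
      by (rule refl')
  qed auto
  then have neg_s: "(\<lambda>v. H v * C v * exp (- of_int (2 * v + 1) * (A - B))) summable_on {0..}"
    using HC by blast
  have "(\<Sum>\<^sub>\<infinity>v. H v * C v) = (\<Sum>\<^sub>\<infinity>v\<in>{0..} \<union> {..<0}. H v * C v)"
    by (rule arg_cong[where f = "infsum _"]) auto
  also have "\<dots> = (\<Sum>\<^sub>\<infinity>v\<in>{0..}. H v * C v) + (\<Sum>\<^sub>\<infinity>v\<in>{..<0}. H v * C v)"
    by (intro infsum_Un_disjoint HC) auto
  also have "\<dots> = (\<Sum>\<^sub>\<infinity>v\<in>{0..}. H v * (C v * E v))"
    unfolding neg by (subst infsum_add[symmetric, OF HC neg_s]) (simp add: E_def algebra_simps)
  also have "\<dots> = (\<Sum>\<^sub>\<infinity>v\<in>{0..}. \<Sum>\<^sub>\<infinity>J\<in>{J. v < M * J}. folded_term M L A B J (2 * v + 1))"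
    by (simp add: folded_term_eq[OF M0] H_def C_def E_def infsum_cmult_left')
  also have "\<dots> = (\<Sum>\<^sub>\<infinity>J\<in>{1..}. \<Sum>\<^sub>\<infinity>v\<in>{0..<M * J}. folded_term M L A B J (2 * v + 1))"
  proof -
    note s = folded_term_summable[OF L M, of A B]
    have J1: "1 \<le> J" if "0 \<le> v" "v < M * J" for v J :: int
    proof -
      have "0 < M * J" using that by linarith
      then show ?thesis using M by (simp add: zero_less_mult_iff)
    qed
    have s': "(\<lambda>(v, J). folded_term M L A B J (2 * v + 1)) summable_on (SIGMA v:{0..}. {J. v < M * J})"
      using s by (subst summable_on_reindex_bij_witness[of _ "\<lambda>(J, v). (v, J)" "\<lambda>(v, J). (J, v)" "SIGMA J:{1..}. {0..<M * J}"
           "\<lambda>(J, v). folded_term M L A B J (2 * v + 1)"]) (auto dest: J1)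
    have "(\<Sum>\<^sub>\<infinity>v\<in>{0..}. \<Sum>\<^sub>\<infinity>J\<in>{J. v < M * J}. folded_term M L A B J (2 * v + 1))
        = (\<Sum>\<^sub>\<infinity>(v, J)\<in>(SIGMA v:{0..}. {J. v < M * J}). folded_term M L A B J (2 * v + 1))"
      by (rule infsum_Sigma'_banach[OF s'])
    also have "\<dots> = (\<Sum>\<^sub>\<infinity>(J, v)\<in>(SIGMA J:{1..}. {0..<M * J}). folded_term M L A B J (2 * v + 1))"
      by (rule infsum_reindex_bij_witness[of _ "\<lambda>(J, v). (v, J)" "\<lambda>(v, J). (J, v)"]) (auto dest: J1)
    also have "\<dots> = (\<Sum>\<^sub>\<infinity>J\<in>{1..}. \<Sum>\<^sub>\<infinity>v\<in>{0..<M * J}. folded_term M L A B J (2 * v + 1))"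
      by (rule infsum_Sigma'_banach[OF s, symmetric])
    finally show ?thesis .
  qed
  finally show ?thesis using 1 by (simp add: f1_def f2_def)
qed

section \<open>Residues modulo 2M\<close>

text \<open>
  The odd numbers \<open>w < 2Mj\<close> with residue above \<open>M\<close> are exactly the \<open>2Mr - k\<close>; the next lemma treats
  the residues below \<open>M\<close>, which give \<open>2Mr + k\<close>.
\<close>

lemma sum_odd_residue_gt:
  fixes f :: "int \<Rightarrow> complex"
  assumes M: "M \<ge> 1"
  shows "(\<Sum>v\<in>{v\<in>{0..<M * int j}. (2 * v + 1) mod (2 * M) > M}. f (2 * v + 1))
     = (\<Sum>r = 1..j. \<Sum>k\<in>{k::nat. odd k \<and> 1 \<le> k \<and> int k \<le> M - 1}. f (2 * M * int r - int k))"
proof -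
  define K where "K = {k::nat. odd k \<and> 1 \<le> k \<and> int k \<le> M - 1}"
  have "(\<Sum>v\<in>{v\<in>{0..<M * int j}. (2 * v + 1) mod (2 * M) > M}. f (2 * v + 1))
      = (\<Sum>(r, k)\<in>{1..j} \<times> K. f (2 * M * int r - int k))"
  proof (rule sum.reindex_bij_witness[of _ "\<lambda>(r, k). M * int r - (int k + 1) div 2"
      "\<lambda>v. (nat ((2 * v + 1) div (2 * M)) + 1, nat (2 * M - (2 * v + 1) mod (2 * M)))"])
    fix v assume v: "v \<in> {v\<in>{0..<M * int j}. (2 * v + 1) mod (2 * M) > M}"
    define d e where "d = (2 * v + 1) div (2 * M)" and "e = (2 * v + 1) mod (2 * M)"
    have de: "2 * v + 1 = 2 * M * d + e" by (simp add: d_def e_def)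
    have e: "M < e" "e < 2 * M" using v M by (simp_all add: e_def)
    have d0: "d \<ge> 0" using v M by (simp add: d_def pos_imp_zdiv_nonneg_iff)
    have "odd (2 * M * d + e)" unfolding de[symmetric] by simp
    then have odd_e: "odd e" by simp
    have k: "int (nat (2 * M - e)) = 2 * M - e" using e by simp
    have r: "int (nat d + 1) = d + 1" using d0 by simp
    have "2 * M * d + e < 2 * (M * int j)" using v de by auto
    then have "M * d < M * int j" using e M unfolding mult.assoc by linarith
    then have dj: "d < int j" using M by simp
    have eq: "2 * M * int (nat d + 1) - int (nat (2 * M - e)) = 2 * v + 1"
      unfolding k r de by (simp add: algebra_simps)
    show "(case (nat ((2 * v + 1) div (2 * M)) + 1, nat (2 * M - (2 * v + 1) mod (2 * M))) of
         (r, k) \<Rightarrow> M * int r - (int k + 1) div 2) = v"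
      unfolding d_def[symmetric] e_def[symmetric] prod.case using eq by (simp add: mult.assoc)
    show "(nat ((2 * v + 1) div (2 * M)) + 1, nat (2 * M - (2 * v + 1) mod (2 * M))) \<in> {1..j} \<times> K"
      unfolding d_def[symmetric] e_def[symmetric] using dj d0 e odd_e k by (auto simp: K_def even_nat_iff)
    show "(case (nat ((2 * v + 1) div (2 * M)) + 1, nat (2 * M - (2 * v + 1) mod (2 * M))) of
         (r, k) \<Rightarrow> f (2 * M * int r - int k)) = f (2 * v + 1)"
      unfolding d_def[symmetric] e_def[symmetric] prod.case eq ..
  next
    fix z assume z: "z \<in> {1..j} \<times> K"
    obtain r k where rk: "z = (r, k)" by (cases z)
    have r: "1 \<le> r" "r \<le> j" and k: "odd k" "1 \<le> int k" "int k \<le> M - 1"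
      using z by (auto simp: rk K_def)
    define v where "v = M * int r - (int k + 1) div 2"
    have kk: "2 * ((int k + 1) div 2) = int k + 1"
      using k(1) by (intro dvd_mult_div_cancel) simp
    have v: "2 * v + 1 = 2 * M * (int r - 1) + (2 * M - int k)"
      using kk by (simp add: v_def algebra_simps)
    have div: "(2 * v + 1) div (2 * M) = int r - 1" and mod: "(2 * v + 1) mod (2 * M) = 2 * M - int k"
      by (rule int_div_pos_eq[OF v] int_mod_pos_eq[OF v]; use k M in simp)+
    have "M * int r \<le> M * int j" using r M by simp
    moreover have "M * 1 \<le> M * int r" using r M by (intro mult_left_mono) auto
    ultimately have "0 \<le> v" "v < M * int j" using kk k unfolding v_def by linarith+
    then have "v \<in> {v\<in>{0..<M * int j}. (2 * v + 1) mod (2 * M) > M}"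
      using mod k by simp
    then show "(case z of (r, k) \<Rightarrow> M * int r - (int k + 1) div 2) \<in> {v\<in>{0..<M * int j}. (2 * v + 1) mod (2 * M) > M}"
      by (simp add: rk v_def)
    show "(nat ((2 * (case z of (r, k) \<Rightarrow> M * int r - (int k + 1) div 2) + 1) div (2 * M)) + 1,
           nat (2 * M - (2 * (case z of (r, k) \<Rightarrow> M * int r - (int k + 1) div 2) + 1) mod (2 * M))) = z"
      unfolding rk prod.case v_def[symmetric] div mod using r by auto
  qed
  also have "\<dots> = (\<Sum>r = 1..j. \<Sum>k\<in>K. f (2 * M * int r - int k))"
    by (rule sum.cartesian_product[symmetric])
  finally show ?thesis by (simp add: K_def)
qed

lemma sum_odd_residue_lt:
  fixes f :: "int \<Rightarrow> complex"
  assumes M: "M \<ge> 1" and j: "j \<ge> 1"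
  shows "(\<Sum>v\<in>{v\<in>{0..<M * int j}. (2 * v + 1) mod (2 * M) < M}. f (2 * v + 1))
     = (\<Sum>r = 0..j - 1. \<Sum>k\<in>{k::nat. odd k \<and> 1 \<le> k \<and> int k \<le> M - 1}. f (2 * M * int r + int k))"
proof -
  define K where "K = {k::nat. odd k \<and> 1 \<le> k \<and> int k \<le> M - 1}"
  have "(\<Sum>v\<in>{v\<in>{0..<M * int j}. (2 * v + 1) mod (2 * M) < M}. f (2 * v + 1))
      = (\<Sum>(r, k)\<in>{0..j - 1} \<times> K. f (2 * M * int r + int k))"
  proof (rule sum.reindex_bij_witness[of _ "\<lambda>(r, k). M * int r + (int k - 1) div 2"
      "\<lambda>v. (nat ((2 * v + 1) div (2 * M)), nat ((2 * v + 1) mod (2 * M)))"])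
    fix v assume v: "v \<in> {v\<in>{0..<M * int j}. (2 * v + 1) mod (2 * M) < M}"
    define d e where "d = (2 * v + 1) div (2 * M)" and "e = (2 * v + 1) mod (2 * M)"
    have de: "2 * v + 1 = 2 * M * d + e" by (simp add: d_def e_def)
    have "odd (2 * M * d + e)" unfolding de[symmetric] by simp
    then have odd_e: "odd e" by simp
    have e: "e < M" "0 \<le> e" using v M by (simp_all add: e_def)
    with odd_e have e1: "1 \<le> e" by (cases "e = 0") auto
    have d0: "d \<ge> 0" using v M by (simp add: d_def pos_imp_zdiv_nonneg_iff)
    have "2 * M * d + e < 2 * (M * int j)" using v de by auto
    then have "M * d < M * int j" using e M unfolding mult.assoc by linarith
    then have dj: "d < int j" using M by simp
    have eq: "2 * M * int (nat d) + int (nat e) = 2 * v + 1"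
      using d0 e de by simp
    show "(case (nat ((2 * v + 1) div (2 * M)), nat ((2 * v + 1) mod (2 * M))) of
         (r, k) \<Rightarrow> M * int r + (int k - 1) div 2) = v"
      unfolding d_def[symmetric] e_def[symmetric] prod.case using eq by (simp add: mult.assoc)
    show "(nat ((2 * v + 1) div (2 * M)), nat ((2 * v + 1) mod (2 * M))) \<in> {0..j - 1} \<times> K"
      unfolding d_def[symmetric] e_def[symmetric] using dj d0 e odd_e e1 j by (auto simp: K_def even_nat_iff)
    show "(case (nat ((2 * v + 1) div (2 * M)), nat ((2 * v + 1) mod (2 * M))) of
         (r, k) \<Rightarrow> f (2 * M * int r + int k)) = f (2 * v + 1)"
      unfolding d_def[symmetric] e_def[symmetric] prod.case eq ..
  next
    fix z assume z: "z \<in> {0..j - 1} \<times> K"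
    obtain r k where rk: "z = (r, k)" by (cases z)
    have r: "r < j" and k: "odd k" "1 \<le> int k" "int k \<le> M - 1"
      using z j by (auto simp: rk K_def)
    define v where "v = M * int r + (int k - 1) div 2"
    have kk: "2 * ((int k - 1) div 2) = int k - 1" using k(1) by simp
    have v: "2 * v + 1 = 2 * M * int r + int k"
      using kk by (simp add: v_def algebra_simps)
    have div: "(2 * v + 1) div (2 * M) = int r" and mod: "(2 * v + 1) mod (2 * M) = int k"
      unfolding v using k M by simp_all
    have "M * (int r + 1) \<le> M * int j" using r M by (intro mult_left_mono) auto
    moreover have "0 \<le> M * int r" using M by simp
    ultimately have "0 \<le> v" "v < M * int j" using kk k unfolding v_def by (simp_all add: algebra_simps)
    then have "v \<in> {v\<in>{0..<M * int j}. (2 * v + 1) mod (2 * M) < M}"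
      using mod k by simp
    then show "(case z of (r, k) \<Rightarrow> M * int r + (int k - 1) div 2) \<in> {v\<in>{0..<M * int j}. (2 * v + 1) mod (2 * M) < M}"
      by (simp add: rk v_def)
    show "(nat ((2 * (case z of (r, k) \<Rightarrow> M * int r + (int k - 1) div 2) + 1) div (2 * M)),
           nat ((2 * (case z of (r, k) \<Rightarrow> M * int r + (int k - 1) div 2) + 1) mod (2 * M))) = z"
      unfolding rk prod.case v_def[symmetric] div mod by auto
  qed
  also have "\<dots> = (\<Sum>r = 0..j - 1. \<Sum>k\<in>K. f (2 * M * int r + int k))"
    by (rule sum.cartesian_product[symmetric])
  finally show ?thesis by (simp add: K_def)
qed

text \<open>
  Here \<open>w\<close> and \<open>- w\<close> are congruent modulo \<open>2M\<close>, so periodicity and oddness contradict each other unless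
  the value is zero. For odd \<open>M\<close> this is why \<open>k\<close> may stop before \<open>M\<close>.
\<close>

lemma odd_theta_middle_eq_0: "odd_theta M L Z (M + 2 * M * r) = 0"
proof -
  have "odd_theta M L Z M = odd_theta M L Z (- M + 2 * M * 1)" by simp
  also have "\<dots> = - odd_theta M L Z M" by (simp only: odd_theta_periodic odd_theta_uminus)
  finally show ?thesis by (simp only: odd_theta_periodic) simp
qed

lemma folded_term_eq_0: "w mod (2 * M) = M \<Longrightarrow> folded_term M L A B J w = 0"
  using odd_theta_middle_eq_0[of M L "A + B" "w div (2 * M)"]
  by (metis (no_types, lifting) add.commute folded_term_def mult_div_mod_eq mult_zero_right)

lemma folded_sum_by_residues:
  fixes M :: int
  assumes L: "Re L < 0" and M: "M \<ge> 1"
  defines "K \<equiv> {k::nat. odd k \<and> 1 \<le> k \<and> int k \<le> M - 1}"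
  shows "(\<Sum>\<^sub>\<infinity>J\<in>{1..}. \<Sum>v\<in>{0..<M * J}. folded_term M L A B J (2 * v + 1))
     = (\<Sum>\<^sub>\<infinity>j\<in>{1::nat..}. \<Sum>r = 1..j. \<Sum>k\<in>K. folded_term M L A B (int j) (2 * M * int r - int k))
     + (\<Sum>\<^sub>\<infinity>j\<in>{1::nat..}. \<Sum>r = 0..j - 1. \<Sum>k\<in>K. folded_term M L A B (int j) (2 * M * int r + int k))"
proof -
  define f where "f = folded_term M L A B"
  \<comment> \<open>Each residue condition selects a subfamily of one summable family, so the two parts converge separately.\<close>
  define G where "G P j = (\<Sum>v\<in>{v\<in>{0..<M * int j}. P ((2 * v + 1) mod (2 * M))}. f (int j) (2 * v + 1))" for P j
  have G: "G P summable_on {1..}" for P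
  proof -
    have s: "(\<lambda>(J, v). f J (2 * v + 1)) summable_on (SIGMA J:{1..}. {v\<in>{0..<M * J}. P ((2 * v + 1) mod (2 * M))})"
      unfolding f_def by (rule summable_on_subset_banach[OF folded_term_summable[OF L M]]) auto
    have fin: "finite {v\<in>{0..<M * J}. P ((2 * v + 1) mod (2 * M))}" for J
      by (rule finite_subset[of _ "{0..<M * J}"]) auto
    have "(\<lambda>J. \<Sum>v\<in>{v\<in>{0..<M * J}. P ((2 * v + 1) mod (2 * M))}. f J (2 * v + 1)) summable_on {1..}"
      using summable_on_Sigma_banach[OF s] by (simp only: infsum_finite[OF fin])
    moreover have "G P summable_on {1..} \<longleftrightarrow> (\<lambda>J. \<Sum>v\<in>{v\<in>{0..<M * J}. P ((2 * v + 1) mod (2 * M))}. f J (2 * v + 1)) summable_on {1..}"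
      by (rule summable_on_reindex_bij_witness[of _ nat int]) (auto simp: G_def)
    ultimately show ?thesis by simp
  qed
  have "(\<Sum>\<^sub>\<infinity>J\<in>{1..}. \<Sum>v\<in>{0..<M * J}. f J (2 * v + 1)) = (\<Sum>\<^sub>\<infinity>j\<in>{1::nat..}. G (\<lambda>x. x > M) j + G (\<lambda>x. x < M) j)"
  proof (rule infsum_reindex_bij_witness[of _ int nat])
    fix J :: int assume J: "J \<in> {1..}"
    have "(\<Sum>v\<in>{0..<M * J}. f J (2 * v + 1)) = (\<Sum>v\<in>{v\<in>{0..<M * J}. (2 * v + 1) mod (2 * M) > M} \<union> {v\<in>{0..<M * J}. (2 * v + 1) mod (2 * M) < M}. f J (2 * v + 1))"
      by (rule sum.mono_neutral_right) (auto simp: f_def intro!: folded_term_eq_0)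
    also have "\<dots> = (\<Sum>v\<in>{v\<in>{0..<M * J}. (2 * v + 1) mod (2 * M) > M}. f J (2 * v + 1)) + (\<Sum>v\<in>{v\<in>{0..<M * J}. (2 * v + 1) mod (2 * M) < M}. f J (2 * v + 1))"
      by (rule sum.union_disjoint) (auto intro: finite_subset[of _ "{0..<M * J}"])
    finally show "G (\<lambda>x. x > M) (nat J) + G (\<lambda>x. x < M) (nat J) = (\<Sum>v\<in>{0..<M * J}. f J (2 * v + 1))"
      using J by (simp add: G_def)
  qed auto
  also have "\<dots> = (\<Sum>\<^sub>\<infinity>j\<in>{1::nat..}. G (\<lambda>x. x > M) j) + (\<Sum>\<^sub>\<infinity>j\<in>{1::nat..}. G (\<lambda>x. x < M) j)"
    by (intro infsum_add G)
  also have "(\<Sum>\<^sub>\<infinity>j\<in>{1::nat..}. G (\<lambda>x. x > M) j) = (\<Sum>\<^sub>\<infinity>j\<in>{1::nat..}. \<Sum>r = 1..j. \<Sum>k\<in>K. f (int j) (2 * M * int r - int k))"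
    unfolding G_def K_def by (simp only: sum_odd_residue_gt[OF M])
  also have "(\<Sum>\<^sub>\<infinity>j\<in>{1::nat..}. G (\<lambda>x. x < M) j) = (\<Sum>\<^sub>\<infinity>j\<in>{1::nat..}. \<Sum>r = 0..j - 1. \<Sum>k\<in>K. f (int j) (2 * M * int r + int k))"
    unfolding G_def K_def by (intro infsum_cong sum_odd_residue_lt[OF M]) auto
  finally show ?thesis by (simp add: f_def)
qed

section \<open>The theta functions and the Appell function\<close>

lemma jacobi_theta_summand:
  fixes M :: int and k :: real
  assumes "M \<ge> 1"
  defines "u \<equiv> \<lambda>j::int. complex_of_real (of_int (M * j) + k / 2)"
  shows "exp (2 * of_real pi * \<i> * of_real (of_int M * (of_int j + k / (2 * of_int M))) * z)
          * qpow \<tau> (of_int M * (of_int j + k / (2 * of_int M))\<^sup>2)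
       = exp (u j * (2 * of_real pi * \<i> * z)) * exp ((u j)\<^sup>2 / of_int M * (2 * of_real pi * \<i> * \<tau>))"
proof -
  have 1: "of_int M * (of_int j + k / (2 * of_int M)) = of_int (M * j) + k / 2"
    using assms(1) by (simp add: field_simps)
  have 2: "of_int M * (of_int j + k / (2 * of_int M))\<^sup>2 = (of_int (M * j) + k / 2)\<^sup>2 / of_int M"
    using assms(1) by (simp add: field_simps power2_eq_square)
  show ?thesis
    unfolding 1 2 qpow_def u_def by (simp add: mult_ac)
qed

lemma theta_family_summable:
  fixes M :: int and L Z :: complex
  assumes L: "Re L < 0" and M: "M \<ge> 1"
  shows "(\<lambda>p. exp ((of_int (M * p) + c) * Z) * exp ((of_int (M * p) + c)\<^sup>2 / of_int M * L)) summable_on UNIV"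
proof -
  have Re: "Re (of_int M * L) < 0" using assms by (simp add: mult_pos_neg)
  have "(\<lambda>p. exp (c * Z + c\<^sup>2 / of_int M * L) * exp (of_int p * (of_int M * Z + 2 * c * L) + (of_int p)\<^sup>2 * (of_int M * L))) summable_on UNIV"
    by (intro summable_on_cmult_right summable_on_exp_quadratic_int Re)
  moreover have "exp (c * Z + c\<^sup>2 / of_int M * L) * exp (of_int p * (of_int M * Z + 2 * c * L) + (of_int p)\<^sup>2 * (of_int M * L))
      = exp ((of_int (M * p) + c) * Z) * exp ((of_int (M * p) + c)\<^sup>2 / of_int M * L)" for p
  proof -
    have "(c * Z + c\<^sup>2 / of_int M * L) + (of_int p * (of_int M * Z + 2 * c * L) + (of_int p)\<^sup>2 * (of_int M * L))
       = (of_int (M * p) + c) * Z + (of_int (M * p) + c)\<^sup>2 / of_int M * L"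
      using M by (simp add: field_simps power2_eq_square)
    then show ?thesis by (simp only: exp_add[symmetric])
  qed
  ultimately show ?thesis by (simp only:)
qed

lemma jacobi_theta_diff_eq_odd_theta:
  fixes M w :: int
  assumes tau: "Im \<tau> > 0" and M: "M \<ge> 1"
  shows "jacobi_theta (of_int w) (of_int M) \<tau> z - jacobi_theta (- of_int w) (of_int M) \<tau> z
     = odd_theta M (2 * of_real pi * \<i> * \<tau>) (2 * of_real pi * \<i> * z) w"
proof -
  define L Z where "L = 2 * of_real pi * \<i> * \<tau>" and "Z = 2 * of_real pi * \<i> * z"
  have L: "Re L < 0" using tau by (simp add: L_def)
  define f where "f Z p = exp ((of_int (M * p) + of_int w / 2) * Z) * exp ((of_int (M * p) + of_int w / 2)\<^sup>2 / of_int M * L)" for Z p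
  have f: "f Z summable_on UNIV" for Z
    unfolding f_def by (rule theta_family_summable[OF L M])
  have 1: "jacobi_theta (of_int w) (of_int M) \<tau> z = infsum (f Z) UNIV"
    unfolding jacobi_theta_def jacobi_theta_summand[OF M] f_def L_def Z_def by simp
  have "jacobi_theta (- of_int w) (of_int M) \<tau> z = infsum (f (- Z)) UNIV"
    unfolding jacobi_theta_def jacobi_theta_summand[OF M]
  proof (rule infsum_reindex_bij_witness[of _ uminus uminus])
    fix p :: int
    have "of_int (M * - p) + of_int w / 2 = - complex_of_real (of_int (M * p) + - of_int w / 2)" by simp
    then show "f (- Z) (- p) = exp (complex_of_real (of_int (M * p) + - of_int w / 2) * (2 * of_real pi * \<i> * z))
       * exp ((complex_of_real (of_int (M * p) + - of_int w / 2))\<^sup>2 / of_int M * (2 * of_real pi * \<i> * \<tau>))"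
      by (simp only: f_def L_def Z_def minus_mult_minus power2_minus)
  qed auto
  then have "jacobi_theta (of_int w) (of_int M) \<tau> z - jacobi_theta (- of_int w) (of_int M) \<tau> z
      = infsum (f Z) UNIV + (\<Sum>\<^sub>\<infinity>p. - f (- Z) p)"
    using 1 by (simp add: infsum_uminus)
  also have "\<dots> = (\<Sum>\<^sub>\<infinity>p. f Z p + - f (- Z) p)"
    by (intro infsum_add[symmetric] f summable_on_uminus[THEN iffD2])
  also have "\<dots> = odd_theta M L Z w"
    unfolding odd_theta_def f_def by (simp add: algebra_simps)
  finally show ?thesis by (simp only: L_def Z_def)
qed

lemma jacobi_theta_halve:
  assumes "m \<noteq> 0"
  shows "jacobi_theta (k / 2) m (2 * \<tau>) (2 * z) = jacobi_theta k (2 * m) \<tau> z"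
  unfolding jacobi_theta_def
proof (rule infsum_cong)
  fix j :: int
  have 1: "m * (real_of_int j + k / 2 / (2 * m)) * 2 = 2 * m * (real_of_int j + k / (2 * (2 * m)))"
    using assms by (simp add: field_simps)
  have 2: "m * (real_of_int j + k / 2 / (2 * m))\<^sup>2 * 2 = 2 * m * (real_of_int j + k / (2 * (2 * m)))\<^sup>2"
    using assms by (simp add: field_simps power2_eq_square)
  have 3: "2 * of_real pi * \<i> * complex_of_real x * (2 * y) = 2 * of_real pi * \<i> * complex_of_real (x * 2) * y" for x y
    by simp
  show "exp (2 * of_real pi * \<i> * of_real (m * (real_of_int j + k / 2 / (2 * m))) * (2 * z))
        * qpow (2 * \<tau>) (m * (real_of_int j + k / 2 / (2 * m))\<^sup>2)
      = exp (2 * of_real pi * \<i> * of_real (2 * m * (real_of_int j + k / (2 * (2 * m)))) * z)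
        * qpow \<tau> (2 * m * (real_of_int j + k / (2 * (2 * m)))\<^sup>2)"
    unfolding qpow_def 3 1 2 ..
qed

text \<open>
  A shift of the argument by half a period contributes the factor \<open>(-1)\<^sup>n\<close>, whichever sign \<open>\<sigma>\<close> the
  shift has.
\<close>

lemma jacobi_theta_0_half_shift:
  fixes N :: int
  assumes N: "N \<ge> 1" and c: "(of_int N :: complex) * z = (c + \<sigma> / 2)" and \<sigma>: "\<sigma> \<in> {1, -1}"
  shows "jacobi_theta 0 (of_int N) \<tau> z
    = (\<Sum>\<^sub>\<infinity>n\<in>UNIV. (-1) powi n * exp (of_int n * (2 * of_real pi * \<i> * c) + (of_int n)\<^sup>2 * (of_int N * (2 * of_real pi * \<i> * \<tau>))))"
  unfolding jacobi_theta_def jacobi_theta_summand[OF N]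
proof (rule infsum_cong)
  fix n :: int
  have e: "exp (of_int n * (of_real pi * \<i> * \<sigma>)) = (-1) powi n"
  proof -
    have "exp (of_real pi * \<i> * \<sigma>) = -1"
      using \<sigma> by (auto simp: exp_minus)
    then show ?thesis by (metis exp_power_int)
  qed
  have "of_int (N * n) * (2 * of_real pi * \<i> * z) = of_int n * (2 * of_real pi * \<i> * (of_int N * z))"
    by simp
  also have "\<dots> = of_int n * (of_real pi * \<i> * \<sigma>) + of_int n * (2 * of_real pi * \<i> * c)"
    unfolding c by (simp add: field_simps)
  finally have 1: "exp (complex_of_real (of_int (N * n) + 0 / 2) * (2 * of_real pi * \<i> * z)) = (-1) powi n * exp (of_int n * (2 * of_real pi * \<i> * c))"
    by (simp add: exp_add e flip: of_int_mult)
  have 2: "(complex_of_real (of_int (N * n) + 0 / 2))\<^sup>2 / of_int N = (of_int n)\<^sup>2 * of_int N"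
    using N by (simp add: power2_eq_square)
  show "exp (complex_of_real (of_int (N * n) + 0 / 2) * (2 * of_real pi * \<i> * z))
        * exp ((complex_of_real (of_int (N * n) + 0 / 2))\<^sup>2 / of_int N * (2 * of_real pi * \<i> * \<tau>))
      = (-1) powi n * exp (of_int n * (2 * of_real pi * \<i> * c) + (of_int n)\<^sup>2 * (of_int N * (2 * of_real pi * \<i> * \<tau>)))"
    unfolding 1 2 by (simp add: exp_add mult_ac)
qed

lemma mumford_theta_11_eq:
  fixes \<tau> z :: complex
  defines "L \<equiv> 2 * of_real pi * \<i> * \<tau>" and "u \<equiv> 2 * of_real pi * \<i> * z"
  shows "mumford_theta 1 1 (2 * \<tau>) (2 * z)
    = - \<i> * exp (L / 4 - u) * (\<Sum>\<^sub>\<infinity>i\<in>(UNIV::int set). (-1) powi i * exp (of_int i * (2 * u - L) + (of_int i)\<^sup>2 * L))"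
proof -
  have "mumford_theta 1 1 (2 * \<tau>) (2 * z) = (\<Sum>\<^sub>\<infinity>i\<in>(UNIV::int set).
      - \<i> * exp (L / 4 - u) * ((-1) powi i * exp (of_int i * (2 * u - L) + (of_int i)\<^sup>2 * L)))"
    unfolding mumford_theta_def
  proof (rule infsum_reindex_bij_witness[of _ "\<lambda>i. i - 1" "\<lambda>n. n + 1"])
    fix n :: int
    have e: "exp (of_int n * (of_real pi * \<i>)) = (-1) powi n"
      by (simp flip: exp_power_int)
    have half: "exp (of_real pi * \<i> / 2) = \<i>"
      using cis_conv_exp[of "pi / 2"] by (simp add: mult.commute)
    have "of_real pi * \<i> * (of_int n + of_nat 1 / 2)\<^sup>2 * (2 * \<tau>)
             + 2 * of_real pi * \<i> * (of_int n + of_nat 1 / 2) * (2 * z + of_nat 1 / 2)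
        = (L / 4 - u + (of_int (n + 1) * (2 * u - L) + (of_int (n + 1))\<^sup>2 * L)) + (of_int n * (of_real pi * \<i>) + of_real pi * \<i> / 2)"
      by (simp add: L_def u_def field_simps power2_eq_square)
    then have "exp (of_real pi * \<i> * (of_int n + of_nat 1 / 2)\<^sup>2 * (2 * \<tau>)
             + 2 * of_real pi * \<i> * (of_int n + of_nat 1 / 2) * (2 * z + of_nat 1 / 2))
        = exp (L / 4 - u) * exp (of_int (n + 1) * (2 * u - L) + (of_int (n + 1))\<^sup>2 * L) * ((-1) powi n * \<i>)"
      by (simp only: exp_add e half)
    also have "(-1) powi n * \<i> = - \<i> * (-1) powi (n + 1)"
      by (simp add: power_int_add)
    finally show "- \<i> * exp (L / 4 - u) * ((-1) powi (n + 1) * exp (of_int (n + 1) * (2 * u - L) + (of_int (n + 1))\<^sup>2 * L))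
      = exp (of_real pi * \<i> * (of_int n + of_nat 1 / 2)\<^sup>2 * (2 * \<tau>)
             + 2 * of_real pi * \<i> * (of_int n + of_nat 1 / 2) * (2 * z + of_nat 1 / 2))"
      by (simp only: mult_ac)
  qed auto
  then show ?thesis by (simp only: infsum_cmult_right')
qed

lemma mumford_theta_11_uminus: "mumford_theta 1 1 \<tau> (- z) = - mumford_theta 1 1 \<tau> z"
proof -
  have "mumford_theta 1 1 \<tau> (- z) = (\<Sum>\<^sub>\<infinity>n\<in>(UNIV::int set). - exp (of_real pi * \<i> * (of_int n + of_nat 1 / 2)\<^sup>2 * \<tau>
             + 2 * of_real pi * \<i> * (of_int n + of_nat 1 / 2) * (z + of_nat 1 / 2)))"
    unfolding mumford_theta_def
  proof (rule infsum_reindex_bij_witness[of _ "\<lambda>n. - n - 1" "\<lambda>n. - n - 1"])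
    fix n :: int
    have "of_real pi * \<i> * (of_int (- n - 1) + of_nat 1 / 2)\<^sup>2 * \<tau>
             + 2 * of_real pi * \<i> * (of_int (- n - 1) + of_nat 1 / 2) * (z + of_nat 1 / 2)
       = (of_real pi * \<i> * (of_int n + of_nat 1 / 2)\<^sup>2 * \<tau>
             + 2 * of_real pi * \<i> * (of_int n + of_nat 1 / 2) * (- z + of_nat 1 / 2)) + (2 * of_int (- n) * (of_real pi * \<i>) - of_real pi * \<i>)"
      by (simp add: field_simps power2_eq_square)
    moreover have "exp (2 * of_int (- n) * (of_real pi * \<i>) - of_real pi * \<i>) = -1"
    proof -
      have "exp (2 * of_int (- n) * (of_real pi * \<i>)) = 1"
        using exp_integer_2pi[of "real_of_int (- n)"] by (simp add: mult_ac)
      then show ?thesis by (simp add: exp_diff)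
    qed
    ultimately show "- exp (of_real pi * \<i> * (of_int (- n - 1) + of_nat 1 / 2)\<^sup>2 * \<tau>
             + 2 * of_real pi * \<i> * (of_int (- n - 1) + of_nat 1 / 2) * (z + of_nat 1 / 2))
       = exp (of_real pi * \<i> * (of_int n + of_nat 1 / 2)\<^sup>2 * \<tau>
             + 2 * of_real pi * \<i> * (of_int n + of_nat 1 / 2) * (- z + of_nat 1 / 2))"
      by (simp only: exp_add) simp
  qed auto
  then show ?thesis by (simp add: infsum_uminus mumford_theta_def)
qed

text \<open>
  The partial fraction expansion of the reciprocal theta function. It is \<open>theta_times_lerch\<close> divided by the
  theta series, which cannot vanish because the infinite product on the right does not.
\<close>

lemma eta_cubed_div_theta_11:
  fixes \<tau> z :: complex
  assumes tau: "Im \<tau> > 0" and pole: "\<And>j::int. exp (2 * (2 * of_real pi * \<i> * z + of_int j * (2 * of_real pi * \<i> * \<tau>))) \<noteq> 1"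
  defines "L \<equiv> 2 * of_real pi * \<i> * \<tau>"
  shows "- \<i> * dedekind_eta (2 * \<tau>) ^ 3 / mumford_theta 1 1 (2 * \<tau>) (2 * z)
    = (\<Sum>\<^sub>\<infinity>l\<in>(UNIV::int set). (-1) powi l * exp ((of_int l)\<^sup>2 * L) * lerch_summand (2 * of_real pi * \<i> * z + of_int l * L))"
proof -
  define u where "u = 2 * of_real pi * \<i> * z"
  define P where "P = prodinf (\<lambda>n. 1 - exp (2 * L) ^ Suc n)"
  define S where "S = (\<Sum>\<^sub>\<infinity>i\<in>(UNIV::int set). (-1) powi i * exp (of_int i * (2 * u - L) + (of_int i)\<^sup>2 * L))"
  define T where "T = (\<Sum>\<^sub>\<infinity>l\<in>(UNIV::int set). (-1) powi l * exp ((of_int l)\<^sup>2 * L) * lerch_summand (u + of_int l * L))"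
  have L: "Re L < 0" using tau by (simp add: L_def)
  have ST: "S * T = exp u * P ^ 3"
    unfolding S_def T_def P_def by (rule theta_times_lerch[OF L]) (use pole in \<open>simp add: u_def L_def\<close>)
  have P: "P \<noteq> 0" unfolding P_def by (rule qpoch_tendsto) (use L in simp)
  then have S: "S \<noteq> 0" using ST by auto
  have theta: "mumford_theta 1 1 (2 * \<tau>) (2 * z) = - \<i> * exp (L / 4 - u) * S"
    unfolding S_def u_def L_def by (rule mumford_theta_11_eq)
  have "qpow (2 * \<tau>) (real (Suc n)) = exp (2 * L) ^ Suc n" for n
  proof -
    have "exp (2 * L) ^ Suc n = exp (of_nat (Suc n) * (2 * L))" by (rule exp_of_nat_mult[symmetric])
    then show ?thesis by (simp add: qpow_def L_def mult_ac)
  qed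
  moreover have "qpow (2 * \<tau>) (1 / 24) ^ 3 = exp (L / 4)"
    by (simp add: qpow_def L_def exp_of_nat_mult[symmetric])
  ultimately have eta: "dedekind_eta (2 * \<tau>) ^ 3 = exp (L / 4) * P ^ 3"
    by (simp only: dedekind_eta_def P_def power_mult_distrib)
  have "exp (L / 4) = exp (L / 4 - u) * exp u"
    by (simp flip: exp_add)
  then have "- \<i> * (exp (L / 4) * P ^ 3) / (- \<i> * exp (L / 4 - u) * S) = (exp u * P ^ 3) / S"
    by simp
  also have "\<dots> = T" using ST S by (simp add: field_simps)
  finally show ?thesis unfolding eta theta T_def u_def .
qed

text \<open>
  The series \<open>\<Phi>\<^sub>1\<close> at \<open>s = N/2\<close> in the variables \<open>L = 2\<pi>i\<tau>\<close>, \<open>A = 2\<pi>iz\<^sub>1\<close>, \<open>B = 2\<pi>iz\<^sub>2\<close>. The series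
  \<open>\<Phi>\<^sub>2\<close> is the same function at \<open>(- B, - A)\<close>.
\<close>

definition appell_sum :: "int \<Rightarrow> complex \<Rightarrow> complex \<Rightarrow> complex \<Rightarrow> nat \<Rightarrow> complex" where
  "appell_sum M L A B N = (\<Sum>\<^sub>\<infinity>j\<in>(UNIV::int set).
     exp (of_int j * (of_int M * (A + B)) + (of_int j)\<^sup>2 * (of_int M * L))
     * (exp (of_nat N * (A + of_int j * L)) / (1 - exp (2 * (A + of_int j * L)))))"

lemma Phi_eq_appell_sum:
  fixes \<tau> z1 z2 :: complex
  defines "L \<equiv> 2 * of_real pi * \<i> * \<tau>" and "A \<equiv> 2 * of_real pi * \<i> * z1" and "B \<equiv> 2 * of_real pi * \<i> * z2"
  shows "Phi (of_int M / 2) (real N / 2) (2 * \<tau>) (2 * z1) (2 * z2) 0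
    = appell_sum M L A B N - appell_sum M L (- B) (- A) N"
proof -
  have "Phi1 (of_int M / 2) (real N / 2) (2 * \<tau>) (2 * z1) (2 * z2) 0 = appell_sum M L A B N"
    unfolding Phi1_def appell_sum_def qpow_def L_def A_def B_def
    by (simp add: algebra_simps power2_eq_square flip: exp_add)
  moreover have "Phi2 (of_int M / 2) (real N / 2) (2 * \<tau>) (2 * z1) (2 * z2) 0 = appell_sum M L (- B) (- A) N"
    unfolding Phi2_def appell_sum_def qpow_def L_def A_def B_def
    by (simp add: algebra_simps power2_eq_square flip: exp_add)
  ultimately show ?thesis by (simp add: Phi_def)
qed

lemma has_sum_sum_lessThan:
  fixes f :: "nat \<Rightarrow> 'a \<Rightarrow> complex"
  assumes "\<And>k. k < n \<Longrightarrow> (f k has_sum s k) X"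
  shows "((\<lambda>x. \<Sum>k<n. f k x) has_sum (\<Sum>k<n. s k)) X"
  using assms by (induction n) (auto intro!: has_sum_add)

lemma appell_sum_odd:
  fixes M :: int
  assumes L: "Re L < 0" and M: "M \<ge> 1" and pole: "\<And>j::int. exp (2 * (A + of_int j * L)) \<noteq> 1"
  shows "appell_sum M L A B (2 * S + 1) = appell_sum M L A B 1
    - (\<Sum>k<S. exp (of_int (2 * int k + 1) * A)
        * (\<Sum>\<^sub>\<infinity>j\<in>(UNIV::int set). exp (of_int j * (of_int M * (A + B) + of_int (2 * int k + 1) * L) + (of_int j)\<^sup>2 * (of_int M * L))))"
proof -
  have Re: "Re (of_int M * L) < 0" using assms by (simp add: mult_pos_neg)
  define g where "g j = exp (of_int j * (of_int M * (A + B)) + (of_int j)\<^sup>2 * (of_int M * L))" for j :: int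
  define u where "u j = A + of_int j * L" for j :: int
  define t where "t k j = exp (of_int (2 * int k + 1) * A)
      * exp (of_int j * (of_int M * (A + B) + of_int (2 * int k + 1) * L) + (of_int j)\<^sup>2 * (of_int M * L))" for k and j :: int
  have t: "t k summable_on UNIV" for k
    unfolding t_def by (intro summable_on_cmult_right summable_on_exp_quadratic_int Re)
  have g: "(\<lambda>j. g j * lerch_summand (u j)) summable_on UNIV"
    unfolding g_def u_def by (rule summable_on_gaussian_lerch[OF L Re])
  have gt: "g j * exp (of_int (2 * int k + 1) * u j) = t k j" for j k
    by (simp add: g_def u_def t_def algebra_simps flip: exp_add)
  have step: "g j * (exp (of_nat (2 * S + 1) * u j) / (1 - exp (2 * u j))) = g j * lerch_summand (u j) + (\<Sum>k<S. - t k j)" for j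
  proof -
    have "exp (of_nat (2 * S + 1) * u j) / (1 - exp (2 * u j))
       = lerch_summand (u j) + (exp (2 * of_nat S * u j) - 1) * lerch_summand (u j)"
      by (simp add: lerch_summand_def ring_distribs diff_divide_distrib exp_add)
    also have "(exp (2 * of_nat S * u j) - 1) * lerch_summand (u j)
       = - (\<Sum>v\<in>{0..<0 + int S}. exp (of_int (2 * (v - 0) + 1) * u j))"
      by (rule geometric_up) (use pole in \<open>simp add: u_def\<close>)
    also have "(\<Sum>v\<in>{0..<0 + int S}. exp (of_int (2 * (v - 0) + 1) * u j)) = (\<Sum>k<S. exp (of_int (2 * int k + 1) * u j))"
      by (rule sum.reindex_bij_witness[of _ int nat]) auto
    finally show ?thesis
      by (simp only: distrib_left mult_minus_right sum_distrib_left gt sum_negf)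
  qed
  have "appell_sum M L A B (2 * S + 1) = (\<Sum>\<^sub>\<infinity>j. g j * lerch_summand (u j) + (\<Sum>k<S. - t k j))"
    unfolding appell_sum_def g_def[symmetric] u_def[symmetric] step ..
  also have "\<dots> = (\<Sum>\<^sub>\<infinity>j. g j * lerch_summand (u j)) + (\<Sum>k<S. - infsum (t k) UNIV)"
    by (intro infsumI has_sum_add has_sum_sum_lessThan has_sum_uminusI has_sum_infsum g t)
  also have "(\<Sum>\<^sub>\<infinity>j. g j * lerch_summand (u j)) = appell_sum M L A B 1"
    unfolding appell_sum_def g_def u_def lerch_summand_def by simp
  also have "(\<Sum>k<S. - infsum (t k) UNIV) = - (\<Sum>k<S. infsum (t k) UNIV)"
    by (rule sum_negf)
  finally show ?thesis
    unfolding t_def infsum_cmult_right' by simp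
qed

text \<open>
  Writing \<open>x = exp u\<close>, the quotients \<open>x\<^sup>2\<^sup>S\<^sup>+\<^sup>1 / (1 - x\<^sup>2)\<close> and \<open>x / (1 - x\<^sup>2)\<close> differ by a finite geometric sum of odd
  powers of \<open>x\<close>. The power \<open>x\<^sup>2\<^sup>k\<^sup>+\<^sup>1\<close> contributes the series that appeared above for \<open>v = k\<close>.
\<close>

lemma appell_sum_shift:
  fixes M :: int
  assumes L: "Re L < 0" and M: "M \<ge> 1"
    and poleA: "\<And>j::int. exp (2 * (A + of_int j * L)) \<noteq> 1"
    and poleB: "\<And>j::int. exp (2 * (- B + of_int j * L)) \<noteq> 1"
  shows "appell_sum M L A B (2 * S + 1) - appell_sum M L (- B) (- A) (2 * S + 1)
    = appell_sum M L A B 1 - appell_sum M L (- B) (- A) 1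
      - (\<Sum>k<S. \<Sum>\<^sub>\<infinity>p. odd_theta_term M L A B (int k) p)"
proof -
  have Re: "Re (of_int M * L) < 0" using assms by (simp add: mult_pos_neg)
  define t where "t A B k j = exp (of_int (2 * int k + 1) * A)
      * exp (of_int j * (of_int M * (A + B) + of_int (2 * int k + 1) * L) + (of_int j)\<^sup>2 * (of_int M * L))" for A B k and j :: int
  have t: "t A B k summable_on UNIV" for A B k
    unfolding t_def by (intro summable_on_cmult_right summable_on_exp_quadratic_int Re)
  have "t A B k j + - t (- B) (- A) k j = odd_theta_term M L A B (int k) j" for k j
    by (simp add: odd_theta_term_def t_def algebra_simps power2_eq_square flip: exp_add)
  then have diff: "infsum (t A B k) UNIV - infsum (t (- B) (- A) k) UNIV = (\<Sum>\<^sub>\<infinity>p. odd_theta_term M L A B (int k) p)" for k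
    using infsum_add[OF t summable_on_uminus[THEN iffD2, OF t], of A B k "- B" "- A" k] by (simp add: infsum_uminus)
  have odd: "appell_sum M L A B (2 * S + 1) = appell_sum M L A B 1 - (\<Sum>k<S. infsum (t A B k) UNIV)"
    if "\<And>j::int. exp (2 * (A + of_int j * L)) \<noteq> 1" for A B
    unfolding t_def infsum_cmult_right' by (rule appell_sum_odd[OF L M that])
  show ?thesis
    unfolding odd[OF poleA] odd[OF poleB] diff[symmetric] by (simp add: sum_subtractf)
qed

lemma folded_term_eq_qpow:
  fixes \<tau> z1 z2 :: complex
  assumes "M \<noteq> 0"
  defines "L \<equiv> 2 * of_real pi * \<i> * \<tau>" and "A \<equiv> 2 * of_real pi * \<i> * z1" and "B \<equiv> 2 * of_real pi * \<i> * z2"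
  shows "folded_term M L A B (int j) w = (-1) ^ j
     * qpow \<tau> (real j * of_int w + (real j)\<^sup>2 - (of_int w)\<^sup>2 / (4 * of_int M))
     * (exp (of_real pi * \<i> * of_int w * (z1 - z2)) + exp (- of_real pi * \<i> * of_int w * (z1 - z2)))
     * odd_theta M L (2 * of_real pi * \<i> * (z1 + z2)) w"
proof -
  have 1: "A + B = 2 * of_real pi * \<i> * (z1 + z2)" by (simp add: A_def B_def algebra_simps)
  have 2: "of_int w / 2 * (A - B) = of_real pi * \<i> * of_int w * (z1 - z2)"
    by (simp add: A_def B_def algebra_simps)
  have 3: "exp ((of_int (int j) * of_int w + (of_int (int j))\<^sup>2 - (of_int w)\<^sup>2 / (4 * of_int M)) * L)
    = qpow \<tau> (real j * of_int w + (real j)\<^sup>2 - (of_int w)\<^sup>2 / (4 * of_int M))"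
    by (simp add: qpow_def L_def mult_ac)
  show ?thesis unfolding folded_term_def 1 2 3 by simp
qed

text \<open>
  The decomposition \<open>theta_times_appell\<close> is applied at \<open>(A, B)\<close> and at \<open>(- B, - A)\<close>. The left theta function
  depends on \<open>A - B\<close> alone and so is common to both; the theta quotients give the two terms with
  \<open>\<eta>\<^sup>3\<close>, and the difference of the cone sums gives the triple sums.
\<close>

lemma theta_times_Phi_half:
  fixes m :: real and \<tau> z1 z2 :: complex and M :: int
  assumes m: "m = of_int M / 2" and M: "M \<ge> 1" and tau: "Im \<tau> > 0"
    and poleA: "\<And>j::int. exp (2 * (2 * of_real pi * \<i> * z1 + of_int j * (2 * of_real pi * \<i> * \<tau>))) \<noteq> 1"
    and poleB: "\<And>j::int. exp (2 * (2 * of_real pi * \<i> * (- z2) + of_int j * (2 * of_real pi * \<i> * \<tau>))) \<noteq> 1"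
  shows "jacobi_theta 0 (2*m+1) \<tau> ((- 1/2 + 2 * of_real m * (z1 - z2)) / of_real (2*m+1))
       * Phi m (1/2) (2*\<tau>) (2*z1) (2*z2) 0
     = - \<i> * dedekind_eta (2*\<tau>) ^ 3 *
         (jacobi_theta 0 (2*m+1) \<tau> ((1/2 + z1 - z2) / of_real (2*m+1) + z1 + z2)
            / mumford_theta 1 1 (2*\<tau>) (2*z1)
          + jacobi_theta 0 (2*m+1) \<tau> ((1/2 + z1 - z2) / of_real (2*m+1) - z1 - z2)
            / mumford_theta 1 1 (2*\<tau>) (2*z2))
       + (\<Sum>\<^sub>\<infinity>j\<in>{1::nat..}. \<Sum>r=1..j. \<Sum>k\<in>{k::nat. odd k \<and> 1 \<le> k \<and> real k \<le> 2*m - 1}.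
            (-1) ^ j
            * qpow \<tau> ((2*m+1) * (real j)\<^sup>2 - 1/(8*m) * (4*m * (real j - real r) + real k)\<^sup>2)
            * (exp (of_real pi * \<i> * of_real (4*m * real r - real k) * (z1 - z2))
               + exp (- of_real pi * \<i> * of_real (4*m * real r - real k) * (z1 - z2)))
            * (jacobi_theta (real k) (2*m) \<tau> (z1 + z2) - jacobi_theta (- real k) (2*m) \<tau> (z1 + z2)))
       - (\<Sum>\<^sub>\<infinity>j\<in>{1::nat..}. \<Sum>r=0..j-1. \<Sum>k\<in>{k::nat. odd k \<and> 1 \<le> k \<and> real k \<le> 2*m - 1}.
            (-1) ^ j
            * qpow \<tau> ((2*m+1) * (real j)\<^sup>2 - 1/(8*m) * (4*m * (real j - real r) - real k)\<^sup>2)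
            * (exp (of_real pi * \<i> * of_real (4*m * real r + real k) * (z1 - z2))
               + exp (- of_real pi * \<i> * of_real (4*m * real r + real k) * (z1 - z2)))
            * (jacobi_theta (real k) (2*m) \<tau> (z1 + z2) - jacobi_theta (- real k) (2*m) \<tau> (z1 + z2)))"
    (is "?Th * ?Ph = - \<i> * ?eta * (?t1 / ?v1 + ?t2 / ?v2) + ?X - ?Y")
proof -
  define L A B where "L = 2 * of_real pi * \<i> * \<tau>" and "A = 2 * of_real pi * \<i> * z1" and "B = 2 * of_real pi * \<i> * z2"
  have L: "Re L < 0" using tau by (simp add: L_def)
  have M0: "M \<noteq> 0" using M by simp
  have B': "2 * of_real pi * \<i> * (- z2) = - B" by (simp add: B_def)
  have pA: "exp (2 * (A + of_int j * L)) \<noteq> 1" and pB: "exp (2 * (- B + of_int j * L)) \<noteq> 1" for j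
    using poleA poleB unfolding B' A_def L_def by blast+
  have twom: "2 * m = of_int M" and twom1: "2 * m + 1 = real_of_int (M + 1)" and M1: "M + 1 \<ge> 1"
    using M by (simp_all add: m)
  have Mc: "of_int (M + 1) \<noteq> (0 :: complex)" using M by (metis M1 not_one_le_zero of_int_eq_0_iff)
  define th where "th A B = (\<Sum>\<^sub>\<infinity>n\<in>UNIV. (-1) powi n * exp (of_int n * (of_int M * (A - B)) + (of_int n)\<^sup>2 * (of_int (M + 1) * L)))" for A B
  define le where "le A = (\<Sum>\<^sub>\<infinity>l\<in>UNIV. (-1) powi l * exp ((of_int l)\<^sup>2 * L) * lerch_summand (A + of_int l * L))" for A
  define ps where "ps A B = (\<Sum>\<^sub>\<infinity>n\<in>UNIV. (-1) powi n * exp (of_int n * (of_int (M + 2) * A + of_int M * B) + (of_int n)\<^sup>2 * (of_int (M + 1) * L)))" for A B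
  define co where "co A B = (\<Sum>\<^sub>\<infinity>((J, p), v)\<in>UNIV. between_sign p v (M * J) * cone_term M L A B J p v)" for A B
  have split: "th A B * appell_sum M L A B 1 = le A * ps A B + co A B"
    if "\<And>j::int. exp (2 * (A + of_int j * L)) \<noteq> 1" for A B
    using theta_times_appell[OF L M that, of B]
    by (simp add: th_def le_def ps_def co_def appell_sum_def lerch_summand_def)
  have th_sym: "th (- B) (- A) = th A B" by (simp add: th_def)
  have Ph: "?Ph = appell_sum M L A B 1 - appell_sum M L (- B) (- A) 1"
    using Phi_eq_appell_sum[of M 1 \<tau> z1 z2] by (simp add: m L_def A_def B_def)
  have cancel: "of_int (M + 1) * (x / of_real (real_of_int (M + 1))) = x" for x :: complex
    using Mc by (simp del: of_int_add)
  have Th: "?Th = th A B"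
  proof -
    have c: "of_int (M + 1) * ((- 1/2 + 2 * of_real m * (z1 - z2)) / of_real (real_of_int (M + 1)))
        = of_int M * (z1 - z2) + (-1) / 2"
      unfolding cancel by (simp add: m)
    have e: "of_int n * (2 * of_real pi * \<i> * (of_int M * (z1 - z2))) = of_int n * (of_int M * (A - B))" for n
      by (simp add: A_def B_def algebra_simps)
    show ?thesis
      unfolding twom1 by (subst jacobi_theta_0_half_shift[OF M1 c]) (simp_all only: e th_def L_def insert_iff simp_thms)
  qed
  have t1: "?t1 = ps A B"
  proof -
    have c: "of_int (M + 1) * ((1/2 + z1 - z2) / of_real (real_of_int (M + 1)) + z1 + z2)
        = (z1 - z2 + of_int (M + 1) * (z1 + z2)) + 1 / 2"
      unfolding distrib_left cancel by simp
    have e: "of_int n * (2 * of_real pi * \<i> * (z1 - z2 + of_int (M + 1) * (z1 + z2))) = of_int n * (of_int (M + 2) * A + of_int M * B)" for n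
      by (simp add: A_def B_def algebra_simps)
    show ?thesis
      unfolding twom1 by (subst jacobi_theta_0_half_shift[OF M1 c]) (simp_all only: e ps_def L_def insert_iff simp_thms)
  qed
  have t2: "?t2 = ps (- B) (- A)"
  proof -
    have c: "of_int (M + 1) * ((1/2 + z1 - z2) / of_real (real_of_int (M + 1)) - z1 - z2)
        = (z1 - z2 - of_int (M + 1) * (z1 + z2)) + 1 / 2"
      unfolding right_diff_distrib cancel by (simp add: algebra_simps)
    have e: "of_int n * (2 * of_real pi * \<i> * (z1 - z2 - of_int (M + 1) * (z1 + z2))) = of_int n * (of_int (M + 2) * (- B) + of_int M * (- A))" for n
      by (simp add: A_def B_def algebra_simps)
    show ?thesis
      unfolding twom1 by (subst jacobi_theta_0_half_shift[OF M1 c]) (simp_all only: e ps_def L_def insert_iff simp_thms)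
  qed
  have leA: "- \<i> * ?eta / ?v1 = le A"
    unfolding le_def A_def L_def by (rule eta_cubed_div_theta_11[OF tau poleA])
  have "- \<i> * ?eta / mumford_theta 1 1 (2 * \<tau>) (2 * (- z2)) = le (- B)"
    unfolding le_def B'[symmetric] L_def by (rule eta_cubed_div_theta_11[OF tau poleB])
  \<comment> \<open>The sign comes from \<open>\<theta>\<^sub>1\<^sub>1\<close> being odd.\<close>
  then have leB: "- \<i> * ?eta / ?v2 = - le (- B)"
    using mumford_theta_11_uminus[of "2 * \<tau>" "2 * z2"] by (simp add: minus_equation_iff)
  define K where "K = {k::nat. odd k \<and> 1 \<le> k \<and> int k \<le> M - 1}"
  have K: "{k::nat. odd k \<and> 1 \<le> k \<and> real k \<le> 2*m - 1} = K"
  proof -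
    have "real k \<le> 2 * m - 1 \<longleftrightarrow> int k \<le> M - 1" for k :: nat
      unfolding twom by linarith
    then show ?thesis by (simp add: K_def)
  qed
  have jt: "jacobi_theta (real k) (2*m) \<tau> (z1 + z2) - jacobi_theta (- real k) (2*m) \<tau> (z1 + z2)
      = odd_theta M L (2 * of_real pi * \<i> * (z1 + z2)) (int k)" for k
    using jacobi_theta_diff_eq_odd_theta[OF tau M, of "int k"] unfolding twom L_def by simp
  have X: "?X = - (\<Sum>\<^sub>\<infinity>j\<in>{1::nat..}. \<Sum>r = 1..j. \<Sum>k\<in>K. folded_term M L A B (int j) (2 * M * int r - int k))"
    unfolding K infsum_uminus[symmetric] sum_negf[symmetric]
  proof (intro infsum_cong sum.cong refl)
    fix j r k
    have 1: "(2*m+1) * (real j)\<^sup>2 - 1/(8*m) * (4*m * (real j - real r) + real k)\<^sup>2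
      = real j * of_int (2 * M * int r - int k) + (real j)\<^sup>2 - (of_int (2 * M * int r - int k))\<^sup>2 / (4 * of_int M)"
      using M by (simp add: m field_simps power2_eq_square)
    have 2: "complex_of_real (4*m * real r - real k) = of_int (2 * M * int r - int k)"
      by (simp add: m)
    \<comment> \<open>This sign is the one that separates the two triple sums.\<close>
    have 3: "odd_theta M L' Z (2 * M * int r - int k) = - odd_theta M L' Z (int k)" for L' Z
      using odd_theta_periodic[of M L' Z "- int k" "int r"] by (simp add: odd_theta_uminus)
    show "(-1) ^ j
            * qpow \<tau> ((2*m+1) * (real j)\<^sup>2 - 1/(8*m) * (4*m * (real j - real r) + real k)\<^sup>2)
            * (exp (of_real pi * \<i> * of_real (4*m * real r - real k) * (z1 - z2))
               + exp (- of_real pi * \<i> * of_real (4*m * real r - real k) * (z1 - z2)))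
            * (jacobi_theta (real k) (2*m) \<tau> (z1 + z2) - jacobi_theta (- real k) (2*m) \<tau> (z1 + z2))
      = - folded_term M L A B (int j) (2 * M * int r - int k)"
      unfolding 1 2 jt L_def A_def B_def folded_term_eq_qpow[OF M0]
      unfolding 3 by (simp only: mult_minus_right minus_minus)
  qed
  have Y: "?Y = (\<Sum>\<^sub>\<infinity>j\<in>{1::nat..}. \<Sum>r = 0..j - 1. \<Sum>k\<in>K. folded_term M L A B (int j) (2 * M * int r + int k))"
    unfolding K
  proof (intro infsum_cong sum.cong refl)
    fix j r k
    have 1: "(2*m+1) * (real j)\<^sup>2 - 1/(8*m) * (4*m * (real j - real r) - real k)\<^sup>2
      = real j * of_int (2 * M * int r + int k) + (real j)\<^sup>2 - (of_int (2 * M * int r + int k))\<^sup>2 / (4 * of_int M)"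
      using M by (simp add: m field_simps power2_eq_square)
    have 2: "complex_of_real (4*m * real r + real k) = of_int (2 * M * int r + int k)"
      by (simp add: m)
    have 3: "odd_theta M L' Z (2 * M * int r + int k) = odd_theta M L' Z (int k)" for L' Z
      using odd_theta_periodic[of M L' Z "int k" "int r"] by (simp add: add.commute)
    show "(-1) ^ j
            * qpow \<tau> ((2*m+1) * (real j)\<^sup>2 - 1/(8*m) * (4*m * (real j - real r) - real k)\<^sup>2)
            * (exp (of_real pi * \<i> * of_real (4*m * real r + real k) * (z1 - z2))
               + exp (- of_real pi * \<i> * of_real (4*m * real r + real k) * (z1 - z2)))
            * (jacobi_theta (real k) (2*m) \<tau> (z1 + z2) - jacobi_theta (- real k) (2*m) \<tau> (z1 + z2))
      = folded_term M L A B (int j) (2 * M * int r + int k)"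
      unfolding 1 2 jt L_def A_def B_def folded_term_eq_qpow[OF M0]
      unfolding 3 ..
  qed
  have XY: "co A B - co (- B) (- A) = ?X - ?Y"
    unfolding X Y co_def cone_sum_folded[OF L M] folded_sum_by_residues[OF L M, folded K_def] by simp
  have "?Th * ?Ph = th A B * appell_sum M L A B 1 - th (- B) (- A) * appell_sum M L (- B) (- A) 1"
    unfolding Th Ph th_sym by (simp add: right_diff_distrib)
  also have "\<dots> = le A * ps A B + - le (- B) * ps (- B) (- A) + (co A B - co (- B) (- A))"
    unfolding split[OF pA] split[OF pB] by simp
  also have "\<dots> = - \<i> * ?eta * (?t1 / ?v1 + ?t2 / ?v2) + (?X - ?Y)"
    unfolding XY t1 t2 leA[symmetric] leB[symmetric] by (simp add: distrib_left)
  finally show ?thesis by (simp only: add_diff_eq)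
qed

text \<open>
  The series for \<open>v = k\<close> is the \<open>k\<close>-th summand of the finite correction, by
  \<open>infsum_odd_theta_term\<close> and the rescaling \<open>jacobi_theta_halve\<close>.
\<close>

lemma Phi_shift:
  fixes m s :: real and \<tau> z1 z2 :: complex and M :: int
  assumes m: "m = of_int M / 2" and M: "M \<ge> 1" and s: "s = real (2 * S + 1) / 2" and tau: "Im \<tau> > 0"
    and poleA: "\<And>j::int. exp (2 * (2 * of_real pi * \<i> * z1 + of_int j * (2 * of_real pi * \<i> * \<tau>))) \<noteq> 1"
    and poleB: "\<And>j::int. exp (2 * (2 * of_real pi * \<i> * (- z2) + of_int j * (2 * of_real pi * \<i> * \<tau>))) \<noteq> 1"
  shows "Phi m s (2*\<tau>) (2*z1) (2*z2) 0 = Phi m (1/2) (2*\<tau>) (2*z1) (2*z2) 0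
     - (\<Sum>k\<in>{k::nat. real k \<le> s - 3/2}.
              exp (of_real pi * \<i> * of_real (1 + 2 * real k) * (z1 - z2))
              * qpow \<tau> (- ((1 + 2 * real k)\<^sup>2 / (8*m)))
              * (jacobi_theta (1/2 + real k) m (2*\<tau>) (2 * (z1 + z2))
                 - jacobi_theta (- (1/2 + real k)) m (2*\<tau>) (2 * (z1 + z2))))"
proof -
  define L A B where "L = 2 * of_real pi * \<i> * \<tau>" and "A = 2 * of_real pi * \<i> * z1" and "B = 2 * of_real pi * \<i> * z2"
  have L: "Re L < 0" using tau by (simp add: L_def)
  have M0: "M \<noteq> 0" using M by simp
  have B': "2 * of_real pi * \<i> * (- z2) = - B" by (simp add: B_def)
  have pA: "exp (2 * (A + of_int j * L)) \<noteq> 1" and pB: "exp (2 * (- B + of_int j * L)) \<noteq> 1" for j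
    using poleA poleB unfolding B' A_def L_def by blast+
  have K: "{k::nat. real k \<le> s - 3/2} = {..<S}"
  proof -
    have "s - 3/2 = real S - 1" by (simp add: s field_simps)
    then show ?thesis by auto
  qed
  have term_eq: "exp (of_real pi * \<i> * of_real (1 + 2 * real k) * (z1 - z2))
              * qpow \<tau> (- ((1 + 2 * real k)\<^sup>2 / (8*m)))
              * (jacobi_theta (1/2 + real k) m (2*\<tau>) (2 * (z1 + z2))
                 - jacobi_theta (- (1/2 + real k)) m (2*\<tau>) (2 * (z1 + z2)))
     = (\<Sum>\<^sub>\<infinity>p. odd_theta_term M L A B (int k) p)" for k
  proof -
    have m0: "m \<noteq> 0" using M by (simp add: m)
    have "1/2 + real k = real_of_int (2 * int k + 1) / 2" "- (1/2 + real k) = (- real_of_int (2 * int k + 1)) / 2"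
      by (simp_all add: field_simps)
    then have "jacobi_theta (1/2 + real k) m (2*\<tau>) (2 * (z1 + z2)) - jacobi_theta (- (1/2 + real k)) m (2*\<tau>) (2 * (z1 + z2))
       = jacobi_theta (of_int (2 * int k + 1)) (2 * m) \<tau> (z1 + z2) - jacobi_theta (- of_int (2 * int k + 1)) (2 * m) \<tau> (z1 + z2)"
      by (simp only: jacobi_theta_halve[OF m0])
    also have "\<dots> = odd_theta M L (A + B) (2 * int k + 1)"
      using jacobi_theta_diff_eq_odd_theta[OF tau M, of "2 * int k + 1" "z1 + z2"]
      by (simp add: m L_def A_def B_def ring_distribs)
    finally have 1: "jacobi_theta (1/2 + real k) m (2*\<tau>) (2 * (z1 + z2)) - jacobi_theta (- (1/2 + real k)) m (2*\<tau>) (2 * (z1 + z2))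
       = odd_theta M L (A + B) (2 * int k + 1)" .
    have "of_real pi * \<i> * of_real (1 + 2 * real k) * (z1 - z2) + 2 * of_real pi * \<i> * of_real (- ((1 + 2 * real k)\<^sup>2 / (8*m))) * \<tau>
       = of_int (2 * int k + 1) / 2 * (A - B) - (of_int (2 * int k + 1))\<^sup>2 / (4 * of_int M) * L"
      using M by (simp add: m A_def B_def L_def field_simps power2_eq_square)
    then show ?thesis
      unfolding 1 infsum_odd_theta_term[OF M0] qpow_def by (simp only: exp_add[symmetric])
  qed
  have "Phi m s (2*\<tau>) (2*z1) (2*z2) 0 = appell_sum M L A B (2 * S + 1) - appell_sum M L (- B) (- A) (2 * S + 1)"
    unfolding m s L_def A_def B_def by (rule Phi_eq_appell_sum)
  also have "\<dots> = appell_sum M L A B 1 - appell_sum M L (- B) (- A) 1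
      - (\<Sum>k<S. \<Sum>\<^sub>\<infinity>p. odd_theta_term M L A B (int k) p)"
    by (rule appell_sum_shift[OF L M pA pB])
  also have "appell_sum M L A B 1 - appell_sum M L (- B) (- A) 1 = Phi m (1/2) (2*\<tau>) (2*z1) (2*z2) 0"
    using Phi_eq_appell_sum[of M 1 \<tau> z1 z2] by (simp add: m L_def A_def B_def)
  finally show ?thesis unfolding K term_eq .
qed

lemma exp_lattice_neq_1:
  fixes z \<tau> :: complex
  assumes "\<And>a b :: int. 2 * z \<noteq> of_int a + of_int b * (2 * \<tau>)"
  shows "exp (2 * (2 * of_real pi * \<i> * z + of_int j * (2 * of_real pi * \<i> * \<tau>))) \<noteq> 1"
    and "exp (2 * (2 * of_real pi * \<i> * (- z) + of_int j * (2 * of_real pi * \<i> * \<tau>))) \<noteq> 1"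
proof -
  have *: "\<exists>n::int. w = of_int n" if "exp (2 * of_real pi * \<i> * w) = 1" for w :: complex
  proof -
    from that obtain n :: int where n: "Re (2 * of_real pi * \<i> * w) = 0" "Im (2 * of_real pi * \<i> * w) = of_int (2 * n) * pi"
      unfolding exp_eq_1 by blast
    then have "w = of_int n" by (simp add: complex_eq_iff)
    then show ?thesis ..
  qed
  show "exp (2 * (2 * of_real pi * \<i> * z + of_int j * (2 * of_real pi * \<i> * \<tau>))) \<noteq> 1"
  proof
    assume "exp (2 * (2 * of_real pi * \<i> * z + of_int j * (2 * of_real pi * \<i> * \<tau>))) = 1"
    moreover have "2 * (2 * of_real pi * \<i> * z + of_int j * (2 * of_real pi * \<i> * \<tau>)) = 2 * of_real pi * \<i> * (2 * z + of_int j * (2 * \<tau>))"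
      by (simp add: algebra_simps)
    ultimately obtain n :: int where "2 * z + of_int j * (2 * \<tau>) = of_int n" using * by metis
    then have "2 * z = of_int n + of_int (- j) * (2 * \<tau>)" by (simp add: algebra_simps)
    then show False using assms by blast
  qed
  show "exp (2 * (2 * of_real pi * \<i> * (- z) + of_int j * (2 * of_real pi * \<i> * \<tau>))) \<noteq> 1"
  proof
    assume "exp (2 * (2 * of_real pi * \<i> * (- z) + of_int j * (2 * of_real pi * \<i> * \<tau>))) = 1"
    moreover have "2 * (2 * of_real pi * \<i> * (- z) + of_int j * (2 * of_real pi * \<i> * \<tau>)) = 2 * of_real pi * \<i> * (- (2 * z) + of_int j * (2 * \<tau>))"
      by (simp add: algebra_simps)
    ultimately obtain n :: int where "- (2 * z) + of_int j * (2 * \<tau>) = of_int n" using * by metis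
    then have "2 * z = of_int (- n) + of_int j * (2 * \<tau>)" by (simp add: algebra_simps)
    then show False using assms by blast
  qed
qed

theorem corollary3p1:
  fixes m s :: real and \<tau> z1 z2 :: complex
  assumes m: "\<exists>n::nat. 1 \<le> n \<and> m = real n / 2"
    and s: "\<exists>n::nat. odd n \<and> s = real n / 2"
    and tau: "Im \<tau> > 0"
    and z1: "\<And>a b :: int. 2*z1 \<noteq> of_int a + of_int b * (2*\<tau>)"
    and z2: "\<And>a b :: int. 2*z2 \<noteq> of_int a + of_int b * (2*\<tau>)"
  shows
    "(jacobi_theta 0 (2*m+1) \<tau> ((- 1/2 + 2 * of_real m * (z1 - z2)) / of_real (2*m+1))
       * Phi m (1/2) (2*\<tau>) (2*z1) (2*z2) 0
     = - \<i> * dedekind_eta (2*\<tau>) ^ 3 *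
         (jacobi_theta 0 (2*m+1) \<tau> ((1/2 + z1 - z2) / of_real (2*m+1) + z1 + z2)
            / mumford_theta 1 1 (2*\<tau>) (2*z1)
          + jacobi_theta 0 (2*m+1) \<tau> ((1/2 + z1 - z2) / of_real (2*m+1) - z1 - z2)
            / mumford_theta 1 1 (2*\<tau>) (2*z2))
       + (\<Sum>\<^sub>\<infinity>j\<in>{1::nat..}. \<Sum>r=1..j. \<Sum>k\<in>{k::nat. odd k \<and> 1 \<le> k \<and> real k \<le> 2*m - 1}.
            (-1) ^ j
            * qpow \<tau> ((2*m+1) * (real j)\<^sup>2 - 1/(8*m) * (4*m * (real j - real r) + real k)\<^sup>2)
            * (exp (of_real pi * \<i> * of_real (4*m * real r - real k) * (z1 - z2))
               + exp (- of_real pi * \<i> * of_real (4*m * real r - real k) * (z1 - z2)))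
            * (jacobi_theta (real k) (2*m) \<tau> (z1 + z2) - jacobi_theta (- real k) (2*m) \<tau> (z1 + z2)))
       - (\<Sum>\<^sub>\<infinity>j\<in>{1::nat..}. \<Sum>r=0..j-1. \<Sum>k\<in>{k::nat. odd k \<and> 1 \<le> k \<and> real k \<le> 2*m - 1}.
            (-1) ^ j
            * qpow \<tau> ((2*m+1) * (real j)\<^sup>2 - 1/(8*m) * (4*m * (real j - real r) - real k)\<^sup>2)
            * (exp (of_real pi * \<i> * of_real (4*m * real r + real k) * (z1 - z2))
               + exp (- of_real pi * \<i> * of_real (4*m * real r + real k) * (z1 - z2)))
            * (jacobi_theta (real k) (2*m) \<tau> (z1 + z2) - jacobi_theta (- real k) (2*m) \<tau> (z1 + z2))))
   \<and>
    (jacobi_theta 0 (2*m+1) \<tau> ((- 1/2 + 2 * of_real m * (z1 - z2)) / of_real (2*m+1))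
       * Phi m s (2*\<tau>) (2*z1) (2*z2) 0
     = - \<i> * dedekind_eta (2*\<tau>) ^ 3 *
         (jacobi_theta 0 (2*m+1) \<tau> ((1/2 + z1 - z2) / of_real (2*m+1) + z1 + z2)
            / mumford_theta 1 1 (2*\<tau>) (2*z1)
          + jacobi_theta 0 (2*m+1) \<tau> ((1/2 + z1 - z2) / of_real (2*m+1) - z1 - z2)
            / mumford_theta 1 1 (2*\<tau>) (2*z2))
       + (\<Sum>\<^sub>\<infinity>j\<in>{1::nat..}. \<Sum>r=1..j. \<Sum>k\<in>{k::nat. odd k \<and> 1 \<le> k \<and> real k \<le> 2*m - 1}.
            (-1) ^ j
            * qpow \<tau> ((2*m+1) * (real j)\<^sup>2 - 1/(8*m) * (4*m * (real j - real r) + real k)\<^sup>2)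
            * (exp (of_real pi * \<i> * of_real (4*m * real r - real k) * (z1 - z2))
               + exp (- of_real pi * \<i> * of_real (4*m * real r - real k) * (z1 - z2)))
            * (jacobi_theta (real k) (2*m) \<tau> (z1 + z2) - jacobi_theta (- real k) (2*m) \<tau> (z1 + z2)))
       - (\<Sum>\<^sub>\<infinity>j\<in>{1::nat..}. \<Sum>r=0..j-1. \<Sum>k\<in>{k::nat. odd k \<and> 1 \<le> k \<and> real k \<le> 2*m - 1}.
            (-1) ^ j
            * qpow \<tau> ((2*m+1) * (real j)\<^sup>2 - 1/(8*m) * (4*m * (real j - real r) - real k)\<^sup>2)
            * (exp (of_real pi * \<i> * of_real (4*m * real r + real k) * (z1 - z2))
               + exp (- of_real pi * \<i> * of_real (4*m * real r + real k) * (z1 - z2)))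
            * (jacobi_theta (real k) (2*m) \<tau> (z1 + z2) - jacobi_theta (- real k) (2*m) \<tau> (z1 + z2)))
       - jacobi_theta 0 (2*m+1) \<tau> ((- 1/2 + 2 * of_real m * (z1 - z2)) / of_real (2*m+1))
         * (\<Sum>k\<in>{k::nat. real k \<le> s - 3/2}.
              exp (of_real pi * \<i> * of_real (1 + 2 * real k) * (z1 - z2))
              * qpow \<tau> (- ((1 + 2 * real k)\<^sup>2 / (8*m)))
              * (jacobi_theta (1/2 + real k) m (2*\<tau>) (2 * (z1 + z2))
                 - jacobi_theta (- (1/2 + real k)) m (2*\<tau>) (2 * (z1 + z2)))))"
proof (intro conjI)
  from m obtain n where n: "1 \<le> n" "m = real n / 2" by blast
  from s obtain S where S: "s = real (2 * S + 1) / 2" by (auto elim: oddE)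
  have mM: "m = of_int (int n) / 2" and M: "int n \<ge> 1" using n by simp_all
  note poles = exp_lattice_neq_1(1)[OF z1] exp_lattice_neq_1(2)[OF z2]
  note half = theta_times_Phi_half[OF mM M tau poles]
  note shift = Phi_shift[OF mM M S tau poles]
  have transfer: "c * x' = y - c * d" if "c * x = y" "x' = x - d" for c d x x' y :: complex
    using that by (simp add: right_diff_distrib)
  show "jacobi_theta 0 (2*m+1) \<tau> ((- 1/2 + 2 * of_real m * (z1 - z2)) / of_real (2*m+1))
       * Phi m (1/2) (2*\<tau>) (2*z1) (2*z2) 0
     = - \<i> * dedekind_eta (2*\<tau>) ^ 3 *
         (jacobi_theta 0 (2*m+1) \<tau> ((1/2 + z1 - z2) / of_real (2*m+1) + z1 + z2)
            / mumford_theta 1 1 (2*\<tau>) (2*z1)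
          + jacobi_theta 0 (2*m+1) \<tau> ((1/2 + z1 - z2) / of_real (2*m+1) - z1 - z2)
            / mumford_theta 1 1 (2*\<tau>) (2*z2))
       + (\<Sum>\<^sub>\<infinity>j\<in>{1::nat..}. \<Sum>r=1..j. \<Sum>k\<in>{k::nat. odd k \<and> 1 \<le> k \<and> real k \<le> 2*m - 1}.
            (-1) ^ j
            * qpow \<tau> ((2*m+1) * (real j)\<^sup>2 - 1/(8*m) * (4*m * (real j - real r) + real k)\<^sup>2)
            * (exp (of_real pi * \<i> * of_real (4*m * real r - real k) * (z1 - z2))
               + exp (- of_real pi * \<i> * of_real (4*m * real r - real k) * (z1 - z2)))
            * (jacobi_theta (real k) (2*m) \<tau> (z1 + z2) - jacobi_theta (- real k) (2*m) \<tau> (z1 + z2)))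
       - (\<Sum>\<^sub>\<infinity>j\<in>{1::nat..}. \<Sum>r=0..j-1. \<Sum>k\<in>{k::nat. odd k \<and> 1 \<le> k \<and> real k \<le> 2*m - 1}.
            (-1) ^ j
            * qpow \<tau> ((2*m+1) * (real j)\<^sup>2 - 1/(8*m) * (4*m * (real j - real r) - real k)\<^sup>2)
            * (exp (of_real pi * \<i> * of_real (4*m * real r + real k) * (z1 - z2))
               + exp (- of_real pi * \<i> * of_real (4*m * real r + real k) * (z1 - z2)))
            * (jacobi_theta (real k) (2*m) \<tau> (z1 + z2) - jacobi_theta (- real k) (2*m) \<tau> (z1 + z2)))"
    by (rule half)
  show "jacobi_theta 0 (2*m+1) \<tau> ((- 1/2 + 2 * of_real m * (z1 - z2)) / of_real (2*m+1))
       * Phi m s (2*\<tau>) (2*z1) (2*z2) 0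
     = - \<i> * dedekind_eta (2*\<tau>) ^ 3 *
         (jacobi_theta 0 (2*m+1) \<tau> ((1/2 + z1 - z2) / of_real (2*m+1) + z1 + z2)
            / mumford_theta 1 1 (2*\<tau>) (2*z1)
          + jacobi_theta 0 (2*m+1) \<tau> ((1/2 + z1 - z2) / of_real (2*m+1) - z1 - z2)
            / mumford_theta 1 1 (2*\<tau>) (2*z2))
       + (\<Sum>\<^sub>\<infinity>j\<in>{1::nat..}. \<Sum>r=1..j. \<Sum>k\<in>{k::nat. odd k \<and> 1 \<le> k \<and> real k \<le> 2*m - 1}.
            (-1) ^ j
            * qpow \<tau> ((2*m+1) * (real j)\<^sup>2 - 1/(8*m) * (4*m * (real j - real r) + real k)\<^sup>2)
            * (exp (of_real pi * \<i> * of_real (4*m * real r - real k) * (z1 - z2))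
               + exp (- of_real pi * \<i> * of_real (4*m * real r - real k) * (z1 - z2)))
            * (jacobi_theta (real k) (2*m) \<tau> (z1 + z2) - jacobi_theta (- real k) (2*m) \<tau> (z1 + z2)))
       - (\<Sum>\<^sub>\<infinity>j\<in>{1::nat..}. \<Sum>r=0..j-1. \<Sum>k\<in>{k::nat. odd k \<and> 1 \<le> k \<and> real k \<le> 2*m - 1}.
            (-1) ^ j
            * qpow \<tau> ((2*m+1) * (real j)\<^sup>2 - 1/(8*m) * (4*m * (real j - real r) - real k)\<^sup>2)
            * (exp (of_real pi * \<i> * of_real (4*m * real r + real k) * (z1 - z2))
               + exp (- of_real pi * \<i> * of_real (4*m * real r + real k) * (z1 - z2)))
            * (jacobi_theta (real k) (2*m) \<tau> (z1 + z2) - jacobi_theta (- real k) (2*m) \<tau> (z1 + z2)))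
       - jacobi_theta 0 (2*m+1) \<tau> ((- 1/2 + 2 * of_real m * (z1 - z2)) / of_real (2*m+1))
         * (\<Sum>k\<in>{k::nat. real k \<le> s - 3/2}.
              exp (of_real pi * \<i> * of_real (1 + 2 * real k) * (z1 - z2))
              * qpow \<tau> (- ((1 + 2 * real k)\<^sup>2 / (8*m)))
              * (jacobi_theta (1/2 + real k) m (2*\<tau>) (2 * (z1 + z2))
                 - jacobi_theta (- (1/2 + real k)) m (2*\<tau>) (2 * (z1 + z2))))"
    by (rule transfer[OF half shift])
qed

end
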